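(* Let $d\ge 1$. The generating function for Specht polynomials is $$\sum_{\mu:\ l(\mu)\le d} q_\mu(\mathbf x)\,\mathbf w^{\sum\mu}=P_d(w_1,\dots,w_d)\sum_{\beta^{(1)},\dots,\beta^{(d)}}\binom{\mathbf x}{\beta^{(1)}}\binom{\beta^{(1)}}{\beta^{(2)}}\cdots\binom{\beta^{(d-1)}}{\beta^{(d)}}\,w_1^{|\beta^{(1)}|}\cdots w_d^{|\beta^{(d)}|},$$ where the sum on the left is over all partitions $\mu=(\mu_1\ge\dots\ge\mu_d\ge0)$ with at most $d$ parts, $\mathbf w^{\sum\mu}=w_1^{\mu_1+\dots+\mu_d}\,w_2^{\mu_2+\dots+\mu_d}\cdots w_d^{\mu_d}$, and the sum on the right is over all $d$-tuples of integer partitions (the empty partition is allowed).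
   Context: Partitions are written in exponential notation: $\alpha=1^{a_1}2^{a_2}\cdots$, where $a_i$ is the number of parts equal to $i$; $|\alpha|$ is the size and $l(\alpha)$ the number of parts. For $\alpha=1^{a_1}2^{a_2}\cdots$ and $\beta=1^{b_1}2^{b_2}\cdots$, put $\binom{\alpha}{\beta}=\prod_{i\ge1}\binom{a_i}{b_i}$ (zero if some $b_i>a_i$), and for variables $\mathbf x=(x_1,x_2,\dots)$ put $\binom{\mathbf x}{\beta}=\prod_{i\ge1}\binom{x_i}{b_i}\in\mathbb{C}[x_1,x_2,\dots]$. Specht polynomial: for a partition $\mu$ and $n\ge|\mu|+\mu_1$ let $\mu[n]=(n-|\mu|,\mu_1,\mu_2,\dots)\vdash n$. Then $q_\mu\in\mathbb{C}[x_1,x_2,\dots]$ is the unique polynomial such that for all $n\ge|\mu|+\mu_1$ and all $\sigma\in S_n$, the irreducible character $\chi_{\mu[n]}$ of the Specht module $V_{\mu[n]}$ satisfies $\chi_{\mu[n]}(\sigma)=q_\mu(x_1(\sigma),x_2(\sigma),\dots)$, where $x_i(\sigma)$ is the number of $i$-cycles of $\sigma$. In particular $q_\emptyset=1$. The polynomials $P_d$ are defined recursively by $P_1(w_1)=1-w_1$ and $P_d(w_1,\dots,w_d)=(1-w_1)(1-w_1w_2)\cdots(1-w_1\cdots w_d)\,P_{d-1}(w_2,\dots,w_d)$.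
   Formalization: For d≥2 the printed identity fails at monomials not of the form w^{∑μ} (for d=2, w_2 has coefficient 0 on the left, −1 on the right); equality is therefore asserted only for the coefficients of monomials w^{∑μ}, with μ a partition with at most d parts. *)

theory Defs
  imports
    Complex_Main
    "HOL-Library.Multiset"
    "HOL-Library.More_List"
    "HOL-Library.Poly_Mapping"
    "HOL-Combinatorics.Permutations"
    "HOL-Combinatorics.Orbits"
begin

section \<open>Partitions\<close>

text \<open>
  A partition is the multiset of its parts, so \<^term>\<open>count \<alpha> i\<close> is the exponent \<open>a\<^sub>i\<close> in
  \<open>1^a\<^sub>1 2^a\<^sub>2 \<dots>\<close>, the size \<open>|\<alpha>|\<close> is \<^term>\<open>sum_mset \<alpha>\<close>, and the number of parts
  is \<^term>\<open>size \<alpha>\<close>.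
\<close>

definition is_partition :: "nat multiset \<Rightarrow> bool" where
  "is_partition \<alpha> \<longleftrightarrow> 0 \<notin># \<alpha>"

text \<open>The \<open>i\<close>-th largest part for \<open>i \<ge> 1\<close>, and 0 beyond the last part.\<close>

definition part :: "nat multiset \<Rightarrow> nat \<Rightarrow> nat" where
  "part \<mu> i = nth_default 0 (rev (sorted_list_of_multiset \<mu>)) (i - 1)"

text \<open>
  The padded partition \<open>\<mu>[n] = (n - |\<mu>|, \<mu>\<^sub>1, \<mu>\<^sub>2, \<dots>)\<close>. The filter only matters for
  \<open>n = |\<mu>|\<close>, where the part \<open>n - |\<mu>| = 0\<close> has to be dropped.
\<close>

definition pad_partition :: "nat multiset \<Rightarrow> nat \<Rightarrow> nat multiset" where
  "pad_partition \<mu> n = {# k \<in># add_mset (n - sum_mset \<mu>) \<mu>. 0 < k #}"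


section \<open>Specht modules over the complex numbers and their characters\<close>

text \<open>The free complex vector space on \<^typ>\<open>'a\<close> is \<^typ>\<open>'a \<Rightarrow>\<^sub>0 complex\<close>.\<close>

definition cscale :: "complex \<Rightarrow> ('a \<Rightarrow>\<^sub>0 complex) \<Rightarrow> ('a \<Rightarrow>\<^sub>0 complex)" where
  "cscale c v = Poly_Mapping.map ((*) c) v"

lemma lookup_cscale [simp]:
  "Poly_Mapping.lookup (cscale c v) x = c * Poly_Mapping.lookup v x"
  by (simp add: cscale_def Poly_Mapping.map.rep_eq when_def)

interpretation cvs: vector_space cscale
  by unfold_locales (auto intro!: poly_mapping_eqI simp: lookup_add algebra_simps)

text \<open>
  The trace of an endomorphism \<open>f\<close> of a finite-dimensional subspace \<open>V\<close>, computed in some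
  basis \<open>B\<close> of \<open>V\<close>; \<^term>\<open>cvs.representation B v b\<close> is the \<open>b\<close>-coordinate of \<open>v\<close>.
\<close>

definition trace_on ::
    "('a \<Rightarrow>\<^sub>0 complex) set \<Rightarrow> (('a \<Rightarrow>\<^sub>0 complex) \<Rightarrow> ('a \<Rightarrow>\<^sub>0 complex)) \<Rightarrow> complex" where
  "trace_on V f =
     (let B = (SOME B. cvs.independent B \<and> cvs.span B = V)
      in \<Sum>b\<in>B. cvs.representation B (f b) b)"

definition cells :: "nat multiset \<Rightarrow> (nat \<times> nat) set" where
  "cells \<nu> = {(i, j). 1 \<le> i \<and> 1 \<le> j \<and> j \<le> part \<nu> i}"

text \<open>A tableau fills the cells of the Young diagram bijectively with \<open>1, \<dots>, |\<nu>|\<close>.\<close>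

definition tableau :: "nat multiset \<Rightarrow> (nat \<times> nat \<Rightarrow> nat) \<Rightarrow> bool" where
  "tableau \<nu> T \<longleftrightarrow> bij_betw T (cells \<nu>) {1..sum_mset \<nu>}"

text \<open>
  The tabloid of \<open>T\<close>, i.e. its class modulo row equivalence, is given by the sequence of
  the sets of entries of its rows.
\<close>

definition tabloid :: "nat multiset \<Rightarrow> (nat \<times> nat \<Rightarrow> nat) \<Rightarrow> (nat \<Rightarrow> nat set)" where
  "tabloid \<nu> T = (\<lambda>i. {T (i, j) | j. (i, j) \<in> cells \<nu>})"

definition column_stabilizer ::
    "nat multiset \<Rightarrow> (nat \<times> nat \<Rightarrow> nat) \<Rightarrow> (nat \<Rightarrow> nat) set" where
  "column_stabilizer \<nu> T =
     {\<pi>. \<pi> permutes {1..sum_mset \<nu>} \<and>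
         (\<forall>j. \<pi> ` {T (i, j) | i. (i, j) \<in> cells \<nu>} = {T (i, j) | i. (i, j) \<in> cells \<nu>})}"

definition polytabloid ::
    "nat multiset \<Rightarrow> (nat \<times> nat \<Rightarrow> nat) \<Rightarrow> ((nat \<Rightarrow> nat set) \<Rightarrow>\<^sub>0 complex)" where
  "polytabloid \<nu> T =
     (\<Sum>\<pi>\<in>column_stabilizer \<nu> T.
        Poly_Mapping.single (tabloid \<nu> (\<pi> \<circ> T)) (of_int (sign \<pi>)))"

definition specht_module :: "nat multiset \<Rightarrow> ((nat \<Rightarrow> nat set) \<Rightarrow>\<^sub>0 complex) set" where
  "specht_module \<nu> = cvs.span {polytabloid \<nu> T | T. tableau \<nu> T}"

text \<open>The linear extension of the action of \<open>\<sigma>\<close> on the entries of tabloids.\<close>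

definition perm_action ::
    "(nat \<Rightarrow> nat) \<Rightarrow> ((nat \<Rightarrow> nat set) \<Rightarrow>\<^sub>0 complex) \<Rightarrow> ((nat \<Rightarrow> nat set) \<Rightarrow>\<^sub>0 complex)" where
  "perm_action \<sigma> v =
     (\<Sum>t\<in>Poly_Mapping.keys v. Poly_Mapping.single (\<lambda>i. \<sigma> ` t i) (Poly_Mapping.lookup v t))"

definition specht_character :: "nat multiset \<Rightarrow> (nat \<Rightarrow> nat) \<Rightarrow> complex" where
  "specht_character \<nu> \<sigma> = trace_on (specht_module \<nu>) (perm_action \<sigma>)"

text \<open>The number of \<open>i\<close>-cycles of a permutation of \<open>{1..n}\<close>; fixed points are 1-cycles.\<close>

definition cycle_count :: "nat \<Rightarrow> (nat \<Rightarrow> nat) \<Rightarrow> nat \<Rightarrow> nat" where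
  "cycle_count n \<sigma> i = card {C \<in> orbit \<sigma> ` {1..n}. card C = i}"


section \<open>Polynomials and Specht polynomials\<close>

text \<open>
  A polynomial maps monomials, i.e. finitely supported exponent vectors, to coefficients;
  multiplication is the convolution product of \<^theory>\<open>HOL-Library.Poly_Mapping\<close>.
\<close>

type_synonym 'a mpoly = "(nat \<Rightarrow>\<^sub>0 nat) \<Rightarrow>\<^sub>0 'a"

definition mconst :: "'a::zero \<Rightarrow> 'a mpoly" where
  "mconst c = Poly_Mapping.single 0 c"

definition mvar :: "nat \<Rightarrow> 'a::zero_neq_one mpoly" where
  "mvar i = Poly_Mapping.single (Poly_Mapping.single i 1) 1"

definition meval :: "'a::comm_semiring_1 mpoly \<Rightarrow> (nat \<Rightarrow> 'a) \<Rightarrow> 'a" where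
  "meval p a =
     (\<Sum>m\<in>Poly_Mapping.keys p.
        Poly_Mapping.lookup p m * (\<Prod>i\<in>Poly_Mapping.keys m. a i ^ Poly_Mapping.lookup m i))"

text \<open>
  The variables are \<open>x\<^sub>1, x\<^sub>2, \<dots>\<close>: the index 0 must not occur, as otherwise the polynomial in
  \<open>specht_poly\<close> would not be unique.
\<close>

definition x_polys :: "complex mpoly set" where
  "x_polys = {p. \<forall>m\<in>Poly_Mapping.keys p. 0 \<notin> Poly_Mapping.keys m}"

definition specht_poly :: "nat multiset \<Rightarrow> complex mpoly" where
  "specht_poly \<mu> =
     (THE q. q \<in> x_polys \<and>
        (\<forall>n \<sigma>. sum_mset \<mu> + part \<mu> 1 \<le> n \<longrightarrow> \<sigma> permutes {1..n} \<longrightarrow>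
           specht_character (pad_partition \<mu> n) \<sigma> = meval q (\<lambda>i. of_nat (cycle_count n \<sigma> i))))"


section \<open>Binomial coefficients of partitions\<close>

text \<open>The factors with \<open>b\<^sub>i = 0\<close> are 1, so that the products range over the parts of \<open>\<beta>\<close>.\<close>

definition partition_binom :: "nat multiset \<Rightarrow> nat multiset \<Rightarrow> nat" where
  "partition_binom \<alpha> \<beta> = (\<Prod>i\<in>set_mset \<beta>. count \<alpha> i choose count \<beta> i)"

definition poly_binom :: "complex mpoly \<Rightarrow> nat \<Rightarrow> complex mpoly" where
  "poly_binom p b = mconst (1 / fact b) * (\<Prod>k<b. p - of_nat k)"

definition x_binom :: "nat multiset \<Rightarrow> complex mpoly" where
  "x_binom \<beta> = (\<Prod>i\<in>set_mset \<beta>. poly_binom (mvar i) (count \<beta> i))"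


section \<open>Formal power series in the variables \<open>w\<close>\<close>

type_synonym 'a mseries = "(nat \<Rightarrow>\<^sub>0 nat) \<Rightarrow> 'a"

definition series_of_poly :: "'a::zero mpoly \<Rightarrow> 'a mseries" where
  "series_of_poly p = Poly_Mapping.lookup p"

definition series_mult :: "'a::comm_ring_1 mseries \<Rightarrow> 'a mseries \<Rightarrow> 'a mseries" where
  "series_mult f g = (\<lambda>k. \<Sum>(a, b)\<in>{(a, b). a + b = k}. f a * g b)"

text \<open>
  The formal sum of \<open>c s \<cdot> w^(e s)\<close> over \<open>s \<in> S\<close>. It is meaningful if every monomial occurs
  only finitely often; see \<open>finite_left_terms\<close> and \<open>finite_right_terms\<close> below.
\<close>

definition formal_sum ::
    "'s set \<Rightarrow> ('s \<Rightarrow> 'a::comm_ring_1) \<Rightarrow> ('s \<Rightarrow> (nat \<Rightarrow>\<^sub>0 nat)) \<Rightarrow> 'a mseries" where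
  "formal_sum S c e = (\<lambda>k. \<Sum>s\<in>{s \<in> S. e s = k}. c s)"

text \<open>
  The polynomials \<open>P\<^sub>d(w\<^sub>1, \<dots>, w\<^sub>d)\<close> as functions of the list of their arguments. The empty
  product for \<open>d = 0\<close> yields \<open>P\<^sub>1(w\<^sub>1) = 1 - w\<^sub>1\<close>.
\<close>

fun P_poly :: "'a::comm_ring_1 list \<Rightarrow> 'a" where
  "P_poly [] = 1"
| "P_poly (w # ws) =
     (\<Prod>j = 1..length (w # ws). 1 - prod_list (take j (w # ws))) * P_poly ws"

lemma P_poly_1: "P_poly [w] = 1 - w"
  by simp

text \<open>The exponent vector of \<open>w^(\<Sum>\<mu>)\<close>: the exponent of \<open>w\<^sub>j\<close> is \<open>\<mu>\<^sub>j + \<dots> + \<mu>\<^sub>d\<close>.\<close>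

definition tail_sums :: "nat \<Rightarrow> nat multiset \<Rightarrow> (nat \<Rightarrow>\<^sub>0 nat)" where
  "tail_sums d \<mu> = (\<Sum>j = 1..d. Poly_Mapping.single j (\<Sum>i = j..d. part \<mu> i))"

definition partitions_le :: "nat \<Rightarrow> nat multiset set" where
  "partitions_le d = {\<mu>. is_partition \<mu> \<and> size \<mu> \<le> d}"

definition partition_tuples :: "nat \<Rightarrow> nat multiset list set" where
  "partition_tuples d = {\<beta>s. length \<beta>s = d \<and> (\<forall>\<beta>\<in>set \<beta>s. is_partition \<beta>)}"

text \<open>Here \<open>\<beta>s = [\<beta>\<^sup>1, \<dots>, \<beta>\<^sup>d]\<close> is indexed from 0.\<close>

definition tuple_coeff :: "nat \<Rightarrow> nat multiset list \<Rightarrow> complex mpoly" where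
  "tuple_coeff d \<beta>s =
     x_binom (\<beta>s ! 0) * (\<Prod>j<d - 1. of_nat (partition_binom (\<beta>s ! j) (\<beta>s ! Suc j)))"

definition tuple_exponent :: "nat \<Rightarrow> nat multiset list \<Rightarrow> (nat \<Rightarrow>\<^sub>0 nat)" where
  "tuple_exponent d \<beta>s = (\<Sum>j<d. Poly_Mapping.single (Suc j) (sum_mset (\<beta>s ! j)))"

text \<open>
  The part of a series supported on the monomials \<open>w^(\<Sum>\<mu>)\<close>, where \<open>\<mu>\<close> is a partition with
  at most \<open>d\<close> parts.
\<close>

definition partition_terms :: "nat \<Rightarrow> 'a::zero mseries \<Rightarrow> 'a mseries" where
  "partition_terms d f = (\<lambda>k. if k \<in> tail_sums d ` partitions_le d then f k else 0)"


subsection \<open>All sums are finite\<close>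

lemma finite_partitions_bounded: "finite {\<mu>. is_partition \<mu> \<and> sum_mset \<mu> \<le> N}"
proof (rule finite_subset)
  show "{\<mu>. is_partition \<mu> \<and> sum_mset \<mu> \<le> N} \<subseteq>
          (\<Union>n\<in>{..N}. {\<mu>. set_mset \<mu> \<subseteq> {..N} \<and> size \<mu> = n})"
  proof safe
    fix \<mu> :: "nat multiset"
    assume p: "is_partition \<mu>" and s: "sum_mset \<mu> \<le> N"
    have "x \<le> N" if "x \<in># \<mu>" for x
      using s sum_mset.remove[OF that] by linarith
    moreover have "size \<mu> \<le> sum_mset \<mu>"
      using p by (induction \<mu>) (auto simp: is_partition_def)
    ultimately show "\<mu> \<in> (\<Union>n\<in>{..N}. {\<mu>. set_mset \<mu> \<subseteq> {..N} \<and> size \<mu> = n})"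
      using s by auto
  qed
  show "finite (\<Union>n\<in>{..N}. {\<mu>. set_mset \<mu> \<subseteq> {..N} \<and> size \<mu> = n})"
    using finite_multisets_of_size[of "{..N}"] by (simp add: multisets_of_size_def)
qed

lemma finite_factorisations: "finite {(a, b). a + b = (k :: nat \<Rightarrow>\<^sub>0 nat)}"
proof -
  define K where "K = Poly_Mapping.keys k"
  define F where
    "F = {f. (\<forall>i. f i \<in> insert 0 {..Max (Poly_Mapping.lookup k ` insert 0 K)}) \<and>
             (\<forall>i. i \<notin> K \<longrightarrow> f i = (0::nat))}"
  have finK: "finite K" by (simp add: K_def)
  have "finite F"
  proof -
    have "F \<subseteq> {f. \<forall>i. (i \<in> K \<longrightarrow> f i \<in> insert 0 {..Max (Poly_Mapping.lookup k ` insert 0 K)}) \<and>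
                    (i \<notin> K \<longrightarrow> f i = 0)}"
      by (auto simp: F_def)
    then show ?thesis
      using finite_set_of_finite_funs[OF finK, of "insert 0 {..Max (Poly_Mapping.lookup k ` insert 0 K)}" "0::nat"]
      by (meson finite_subset finite_insert finite_atMost)
  qed
  have mem: "Poly_Mapping.lookup a \<in> F" if "a + b = k" for a b
  proof -
    have le: "Poly_Mapping.lookup a i \<le> Poly_Mapping.lookup k i" for i
      using that by (auto simp: lookup_add)
    have "Poly_Mapping.lookup a i \<le> Max (Poly_Mapping.lookup k ` insert 0 K)" if "i \<in> K" for i
      using le[of i] finK that by (intro order.trans[OF le Max_ge]) auto
    moreover have "Poly_Mapping.lookup a i = 0" if "i \<notin> K" for i
      using le[of i] that by (simp add: K_def in_keys_iff)
    ultimately show ?thesis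
      unfolding F_def mem_Collect_eq insert_iff atMost_iff by (metis (lifting))
  qed
  have "inj_on (\<lambda>(a, b). Poly_Mapping.lookup a) {(a, b). a + b = k}"
  proof (rule inj_onI, clarify)
    fix a b a' b' :: "nat \<Rightarrow>\<^sub>0 nat"
    assume "k = a + b" "a' + b' = a + b"
      and "Poly_Mapping.lookup a = Poly_Mapping.lookup a'"
    then show "a = a' \<and> b = b'" by (metis add_left_cancel lookup_inject)
  qed
  moreover have "(\<lambda>(a, b). Poly_Mapping.lookup a) ` {(a, b). a + b = k} \<subseteq> F"
    using mem by auto
  ultimately show ?thesis
    using \<open>finite F\<close> by (metis (no_types, lifting) finite_imageD finite_subset)
qed

lemma lookup_sum_single:
  assumes "finite A"
  shows "Poly_Mapping.lookup (\<Sum>j\<in>A. Poly_Mapping.single j (g j)) i = (if i \<in> A then g i else 0)"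
proof -
  have "Poly_Mapping.lookup (\<Sum>j\<in>A. Poly_Mapping.single j (g j)) i = (\<Sum>j\<in>A. if j = i then g j else 0)"
    by (simp add: lookup_sum lookup_single when_def)
  then show ?thesis using assms by simp
qed

lemma lookup_tail_sums:
  "Poly_Mapping.lookup (tail_sums d \<mu>) j = (if j \<in> {1..d} then \<Sum>i = j..d. part \<mu> i else 0)"
  unfolding tail_sums_def by (rule lookup_sum_single) simp

lemma lookup_tuple_exponent:
  "Poly_Mapping.lookup (tuple_exponent d \<beta>s) j =
     (if j \<in> {1..d} then sum_mset (\<beta>s ! (j - 1)) else 0)"
proof -
  have "tuple_exponent d \<beta>s = (\<Sum>j\<in>{1..d}. Poly_Mapping.single j (sum_mset (\<beta>s ! (j - 1))))"
    unfolding tuple_exponent_def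
    by (rule sum.reindex_bij_witness[of _ "\<lambda>j. j - 1" Suc]) auto
  then show ?thesis by (simp add: lookup_sum_single)
qed

lemma sum_part:
  assumes "size \<mu> \<le> d"
  shows "(\<Sum>i = 1..d. part \<mu> i) = sum_mset \<mu>"
proof -
  define xs where "xs = rev (sorted_list_of_multiset \<mu>)"
  have m: "mset xs = \<mu>" by (simp add: xs_def)
  have len: "length xs \<le> d" using assms by (simp flip: m)
  have "(\<Sum>i = 1..d. part \<mu> i) = (\<Sum>i<d. nth_default 0 xs i)"
    unfolding part_def xs_def[symmetric]
    by (rule sum.reindex_bij_witness[of _ Suc "\<lambda>j. j - 1"]) auto
  also have "\<dots> = (\<Sum>i<length xs. nth_default 0 xs i)"
    using len by (intro sum.mono_neutral_right) (auto simp: nth_default_def)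
  also have "\<dots> = sum_list xs"
    by (simp add: sum_list_sum_nth atLeast0LessThan nth_default_def)
  finally show ?thesis by (metis m sum_mset_sum_list)
qed

lemma finite_left_terms:
  assumes "d \<ge> 1"
  shows "finite {\<mu> \<in> partitions_le d. tail_sums d \<mu> = k}"
proof (rule finite_subset[OF _ finite_partitions_bounded[of "Poly_Mapping.lookup k 1"]])
  show "{\<mu> \<in> partitions_le d. tail_sums d \<mu> = k} \<subseteq>
          {\<mu>. is_partition \<mu> \<and> sum_mset \<mu> \<le> Poly_Mapping.lookup k 1}"
    using assms sum_part by (auto simp: partitions_le_def lookup_tail_sums)
qed

lemma finite_right_terms: "finite {\<beta>s \<in> partition_tuples d. tuple_exponent d \<beta>s = k}"
proof -
  define N where "N = (\<Sum>j\<in>{1..d}. Poly_Mapping.lookup k j)"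
  have "sum_mset \<beta> \<le> N"
    if "\<beta>s \<in> partition_tuples d" "tuple_exponent d \<beta>s = k" "\<beta> \<in> set \<beta>s" for \<beta>s \<beta>
  proof -
    from that obtain j where j: "j < d" "\<beta> = \<beta>s ! j"
      by (auto simp: partition_tuples_def in_set_conv_nth)
    have "sum_mset \<beta> = Poly_Mapping.lookup k (Suc j)"
      using that(2) j by (auto simp: lookup_tuple_exponent)
    also have "\<dots> \<le> N"
      unfolding N_def using j by (intro member_le_sum) auto
    finally show ?thesis .
  qed
  then have "{\<beta>s \<in> partition_tuples d. tuple_exponent d \<beta>s = k} \<subseteq>
      {\<beta>s. set \<beta>s \<subseteq> {\<mu>. is_partition \<mu> \<and> sum_mset \<mu> \<le> N} \<and> length \<beta>s = d}"
    by (auto simp: partition_tuples_def)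
  then show ?thesis
    by (rule finite_subset) (intro finite_lists_length_eq finite_partitions_bounded)
qed


subsection \<open>Monomials not coming from partitions\<close>

text \<open>
  The product of \<open>P\<^sub>d\<close> with the sum over tuples of partitions also contains monomials that are
  not of the form \<open>w^(\<Sum>\<mu>)\<close>. For \<open>d = 2\<close> the term \<open>- w\<^sub>2\<close> is one of them. They have no
  counterpart in the generating function of the Specht polynomials, so the two series can only be
  compared after applying \<^const>\<open>partition_terms\<close>.
\<close>

lemma left_coeff_w2:
  "formal_sum (partitions_le 2) specht_poly (tail_sums 2) (Poly_Mapping.single 2 1) = 0"
proof -
  have "tail_sums 2 \<mu> \<noteq> Poly_Mapping.single 2 1" for \<mu>
  proof
    assume eq: "tail_sums 2 \<mu> = Poly_Mapping.single 2 1"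
    have "Poly_Mapping.lookup (tail_sums 2 \<mu>) 1 = 0" "Poly_Mapping.lookup (tail_sums 2 \<mu>) 2 = 1"
      unfolding eq by (simp_all add: lookup_single)
    then show False by (simp add: lookup_tail_sums)
  qed
  then show ?thesis by (simp add: formal_sum_def)
qed

lemma sum_mset_eq_0_partition: "is_partition \<alpha> \<Longrightarrow> sum_mset \<alpha> = 0 \<Longrightarrow> \<alpha> = {#}"
  by (cases \<alpha>) (auto simp: is_partition_def)

lemma tuples_of_exponent_0:
  "{\<beta>s \<in> partition_tuples 2. tuple_exponent 2 \<beta>s = 0} = {[{#}, {#}]}"
proof (intro equalityI subsetI)
  fix \<beta>s assume "\<beta>s \<in> {\<beta>s \<in> partition_tuples 2. tuple_exponent 2 \<beta>s = 0}"
  then have a: "length \<beta>s = 2" "\<forall>\<beta>\<in>set \<beta>s. is_partition \<beta>" and e: "tuple_exponent 2 \<beta>s = 0"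
    by (auto simp: partition_tuples_def)
  from a(1) obtain \<alpha> \<beta> where l: "\<beta>s = [\<alpha>, \<beta>]"
    by (auto simp: numeral_2_eq_2 length_Suc_conv)
  have "sum_mset \<alpha> = 0" "sum_mset \<beta> = 0"
    using lookup_tuple_exponent[of 2 \<beta>s 1] lookup_tuple_exponent[of 2 \<beta>s 2] l e by auto
  then show "\<beta>s \<in> {[{#}, {#}]}" using a(2) l sum_mset_eq_0_partition by auto
qed (auto simp: partition_tuples_def is_partition_def tuple_exponent_def numeral_2_eq_2)

lemma tuple_coeff_exponent_w2:
  assumes "\<beta>s \<in> partition_tuples 2" "tuple_exponent 2 \<beta>s = Poly_Mapping.single 2 1"
  shows "tuple_coeff 2 \<beta>s = 0"
proof -
  from assms obtain \<alpha> \<beta> where l: "\<beta>s = [\<alpha>, \<beta>]" and p: "is_partition \<alpha>" "is_partition \<beta>"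
    by (auto simp: partition_tuples_def numeral_2_eq_2 length_Suc_conv)
  have "sum_mset \<alpha> = 0" "sum_mset \<beta> = 1"
    using lookup_tuple_exponent[of 2 \<beta>s 1] lookup_tuple_exponent[of 2 \<beta>s 2] l assms(2)
    by (auto simp: lookup_single)
  then have "\<alpha> = {#}" "\<beta> \<noteq> {#}" using p sum_mset_eq_0_partition by auto
  then have "partition_binom \<alpha> \<beta> = 0"
    by (auto simp: partition_binom_def not_in_iff[symmetric] count_eq_zero_iff binomial_eq_0_iff)
  then show ?thesis by (simp add: tuple_coeff_def l numeral_2_eq_2)
qed

lemma right_coeff_w2:
  "series_mult (series_of_poly (P_poly (map mvar [1..<Suc 2])))
     (formal_sum (partition_tuples 2) (tuple_coeff 2) (tuple_exponent 2))
     (Poly_Mapping.single 2 1) = - 1"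
proof -
  define e :: "nat \<Rightarrow>\<^sub>0 nat" where "e = Poly_Mapping.single 2 1"
  define S where "S = formal_sum (partition_tuples 2) (tuple_coeff 2) (tuple_exponent 2)"
  define P :: "complex mpoly mpoly" where "P = P_poly (map mvar [1..<Suc 2])"
  have S0: "S 0 = 1"
    by (simp add: S_def formal_sum_def tuples_of_exponent_0 tuple_coeff_def x_binom_def
        partition_binom_def)
  have Se: "S e = 0"
    using tuple_coeff_exponent_w2 by (auto simp: S_def formal_sum_def e_def intro!: sum.neutral)
  have split: "{(a, b). a + b = e} = {(e, 0), (0, e)}"
  proof (intro equalityI subsetI)
    fix p assume "p \<in> {(a, b). a + b = e}"
    then obtain a b where p: "p = (a, b)" and ab: "a + b = e" by auto
    have l: "Poly_Mapping.lookup a i + Poly_Mapping.lookup b i = (if i = 2 then 1 else 0)" for i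
      using arg_cong[OF ab, of "\<lambda>m. Poly_Mapping.lookup m i"]
      by (simp add: e_def lookup_single lookup_add when_def)
    show "p \<in> {(e, 0), (0, e)}"
    proof (cases "Poly_Mapping.lookup b 2 = 0")
      case True
      have "Poly_Mapping.lookup b i = 0" for i
        using l[of i] True by (cases "i = 2") auto
      then have "b = 0" by (intro poly_mapping_eqI) simp
      then show ?thesis using p ab by simp
    next
      case False
      have "Poly_Mapping.lookup a i = 0" for i
        using l[of i] l[of 2] False by (cases "i = 2") auto
      then have "a = 0" by (intro poly_mapping_eqI) simp
      then show ?thesis using p ab by simp
    qed
  qed auto
  have "e \<noteq> 0" by (metis e_def lookup_single_eq lookup_zero zero_neq_one)
  have l12: "map mvar [1..<Suc 2] = [mvar 1, mvar 2 :: complex mpoly mpoly]"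
    by (simp add: upt_rec numeral_2_eq_2)
  have "P = (1 - mvar 1) * (1 - mvar 1 * mvar 2) * (1 - mvar 2)"
    by (simp add: P_def l12 numeral_2_eq_2)
  also have "\<dots> = 1 - mvar 1 - mvar 2 + mvar 1 * mvar 1 * mvar 2 + mvar 1 * mvar 2 * mvar 2
      - mvar 1 * mvar 1 * mvar 2 * mvar 2"
    by (simp add: algebra_simps)
  finally have P: "P = \<dots>" .
  have ne: "Poly_Mapping.single 1 1 + m \<noteq> e" for m
  proof
    assume "Poly_Mapping.single 1 1 + m = e"
    then have "Poly_Mapping.lookup (Poly_Mapping.single 1 1 + m) 1 = Poly_Mapping.lookup e 1"
      by (rule arg_cong)
    then show False by (simp add: e_def lookup_add lookup_single)
  qed
  have mv: "Poly_Mapping.lookup (mvar 1 * Poly_Mapping.single m 1 :: complex mpoly mpoly) e = 0" for m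
    using ne[of m] by (simp add: mvar_def mult_single lookup_single when_def)
  have "Poly_Mapping.lookup P e = - 1"
    using mv[of 0] mv[of "Poly_Mapping.single 1 1 + Poly_Mapping.single 2 1"]
      mv[of "Poly_Mapping.single 2 1 + Poly_Mapping.single 2 1"]
      mv[of "Poly_Mapping.single 1 1 + Poly_Mapping.single 2 1 + Poly_Mapping.single 2 1"] \<open>e \<noteq> 0\<close>
    unfolding P
    by (simp add: lookup_add lookup_minus lookup_one mvar_def mult_single when_def add.assoc
        flip: single_one) (simp add: e_def lookup_one)
  moreover have "(e, 0) \<noteq> (0, e)" using \<open>e \<noteq> 0\<close> by simp
  ultimately have "series_mult (series_of_poly P) S e = - 1"
    using \<open>e \<noteq> 0\<close> by (simp add: series_mult_def split series_of_poly_def S0 Se)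
  then show ?thesis by (simp only: e_def S_def P_def)
qed

end

theory Submission
  imports Defs "Jordan_Normal_Form.Determinant"
begin

text \<open>
  Number the rows of \<open>\<nu> = \<mu>[n]\<close> by \<open>0, \<dots>, d\<close>, put \<open>y\<^sub>i = w\<^sub>1 \<dots> w\<^sub>i\<close>, and let \<open>\<psi>\<^sub>\<alpha>\<close> be the permutation
  character on the words of content \<open>\<alpha>\<close> in the letters \<open>0, \<dots>, d\<close>. A word fixed by \<open>\<sigma>\<close> is a chain of
  \<open>d\<close> unions of cycles, so the sum over tuples of partitions is the generating function of the
  \<open>\<psi>\<^sub>\<alpha>\<close> in the \<open>y\<^sub>i\<close>. As \<open>P\<^sub>d\<close> is the Vandermonde product of the \<open>1 - y\<^sub>j / y\<^sub>i\<close> with \<open>i < j\<close>, the claim is the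
  determinantal formula \<open>\<chi>\<^sub>\<nu> = f\<close>, where \<open>f\<close> is the alternating sum over \<open>w\<close> of the \<open>\<psi>\<^sub>\<alpha>\<close> with
  \<open>\<alpha>\<^sub>i = \<nu>\<^sub>i + w i - i\<close>.

  It suffices that \<open>\<langle>\<chi>\<^sub>\<nu>, \<chi>\<^sub>\<nu>\<rangle> = \<langle>\<chi>\<^sub>\<nu>, f\<rangle> = \<langle>f, f\<rangle> = 1\<close>, for then \<open>\<chi>\<^sub>\<nu> - f\<close> has norm 0. The first value is Schur
  orthogonality: an equivariant endomorphism of the Specht module is a scalar, because the signed
  column sum has rank one on it. For the second, \<open>\<psi>\<^sub>\<nu>\<close> contributes 1, and the other \<open>\<alpha>\<close> are not
  dominated by \<open>\<nu>\<close>, so that by the pigeonhole principle on the columns of a tableau they contribute 0.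
  For the third, \<open>\<langle>\<psi>\<^sub>\<alpha>, \<psi>\<^sub>\<beta>\<rangle>\<close> counts matrices with row sums \<open>\<alpha>\<close> and column sums \<open>\<beta>\<close>; removing the columns
  one at a time, Pieri's rule leaves the sequences of interlacing partitions.
\<close>

(* frees inv for the inverse of a function *)
no_notation m_inv (\<open>(\<open>open_block notation=\<open>prefix inv\<close>\<close>inv\<index> _)\<close> [81] 80)

(* keeps the lower bound of {1..n} from being rewritten to Suc 0 *)
declare One_nat_def [simp del]

\<comment> \<open>\<open>specht_poly\<close> is one polynomial for all \<open>n\<close>, and
  \<open>n\<close> enters \<open>\<mu>[n]\<close> only through its first row. The letter 0 stands
  for that row and \<open>y\<^sub>0 = 1\<close> gives it no variable: its multiplicity is what the
  other letters leave of \<open>n\<close>. So a coefficient in the variables \<open>w\<close> does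
  not see \<open>n\<close>, and the same permutations of \<open>0, \<dots>, d\<close> serve every
  \<open>n\<close>. That values at cycle types pin down a polynomial justifies the definite
  description in \<open>specht_poly\<close>.

  The pairings are sums without complex conjugation. Schur orthogonality gives the sum of
  \<open>chi \<sigma> * chi (inv \<sigma>)\<close>, and a difference of norm 0 must vanish only if
  the norm is a sum of real squares. Hence a separate argument that \<open>chi\<close> is real and
  invariant under inversion: the signed column sum, having rank one, expresses \<open>chi\<close> by
  matrix coefficients with both properties. The mixed value 1 is what ties \<open>f\<close> to
  \<open>chi\<close>; the two norms alone would not.\<close>
alias lookup = Poly_Mapping.lookup
alias keys = Poly_Mapping.keys
alias single = Poly_Mapping.single

abbreviation Sym :: "nat \<Rightarrow> (nat \<Rightarrow> nat) set" where
  "Sym n \<equiv> {\<sigma>. \<sigma> permutes {1..n}}"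

section \<open>The linear action of permutations on combinations of tabloids\<close>

lemma perm_action_alt:
  assumes "finite K" "keys v \<subseteq> K"
  shows "perm_action \<sigma> v = (\<Sum>t\<in>K. single (\<lambda>i. \<sigma> ` t i) (lookup v t))"
  unfolding perm_action_def using assms
  by (intro sum.mono_neutral_left) (auto simp: in_keys_iff)

lemma perm_action_add: "perm_action \<sigma> (v + w) = perm_action \<sigma> v + perm_action \<sigma> w"
proof -
  let ?K = "keys v \<union> keys w"
  have "keys (v + w) \<subseteq> ?K" by (rule keys_add)
  then show ?thesis
    by (simp add: perm_action_alt[of ?K] lookup_add single_add sum.distrib)
qed

lemma cscale_single [simp]: "cscale c (single t x) = single t (c * x)"
  by (intro poly_mapping_eqI) (simp add: lookup_single when_def)

lemma perm_action_scale: "perm_action \<sigma> (cscale c v) = cscale c (perm_action \<sigma> v)"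
proof -
  have "keys (cscale c v) \<subseteq> keys v"
    by (auto simp: in_keys_iff)
  then show ?thesis
    by (simp add: perm_action_alt[of "keys v"] cvs.scale_sum_right)
qed

lemma perm_action_0 [simp]: "perm_action \<sigma> 0 = 0"
  by (simp add: perm_action_def)

lemma perm_action_sum: "perm_action \<sigma> (sum f I) = (\<Sum>i\<in>I. perm_action \<sigma> (f i))"
  by (induction I rule: infinite_finite_induct) (auto simp: perm_action_add)

lemma perm_action_single:
  "perm_action \<sigma> (single t c) = single (\<lambda>i. \<sigma> ` t i) c"
  by (cases "c = 0") (simp_all add: perm_action_def)

lemma perm_action_comp: "perm_action (\<sigma> \<circ> \<tau>) v = perm_action \<sigma> (perm_action \<tau> v)"
proof -
  have "perm_action (\<sigma> \<circ> \<tau>) v = (\<Sum>t\<in>keys v.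
      perm_action \<sigma> (single (\<lambda>i. \<tau> ` t i) (lookup v t)))"
    unfolding perm_action_single by (simp add: perm_action_def image_image)
  also have "\<dots> = perm_action \<sigma> (perm_action \<tau> v)"
    by (simp only: perm_action_sum[symmetric] perm_action_def[of \<tau> v])
  finally show ?thesis .
qed

lemma poly_mapping_sum_single: "(\<Sum>t\<in>keys v. single t (lookup v t)) = v"
  by (intro poly_mapping_eqI)
    (simp add: lookup_sum lookup_single when_def in_keys_iff[symmetric] not_in_keys_iff_lookup_eq_zero)

lemma permutes_inv_comp:
  assumes "\<sigma> permutes S" "\<tau> permutes S"
  shows "inv (\<sigma> \<circ> \<tau>) = inv \<tau> \<circ> inv \<sigma>"
  by (rule o_inv_distrib[OF permutes_bij[OF assms(1)] permutes_bij[OF assms(2)]])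

lemma perm_action_id [simp]: "perm_action id v = v"
  by (simp add: perm_action_def poly_mapping_sum_single)

lemma perm_action_inv:
  assumes "\<sigma> permutes S"
  shows "perm_action (inv \<sigma>) (perm_action \<sigma> v) = v" "perm_action \<sigma> (perm_action (inv \<sigma>) v) = v"
  using permutes_inv_o[OF assms] by (simp_all flip: perm_action_comp)

section \<open>Traces\<close>

text \<open>Linearity is asked on \<open>V\<close> only: coordinates with respect to a basis of
  \<open>V\<close> are 0 off \<open>V\<close>, so operators built from them need not be linear on
  the whole space.\<close>

definition lin_on :: "('a \<Rightarrow>\<^sub>0 complex) set \<Rightarrow> (('a \<Rightarrow>\<^sub>0 complex) \<Rightarrow> ('b \<Rightarrow>\<^sub>0 complex)) \<Rightarrow> bool" where
  "lin_on V A \<longleftrightarrow> (\<forall>x\<in>V. \<forall>y\<in>V. A (x + y) = A x + A y) \<and> (\<forall>c. \<forall>x\<in>V. A (cscale c x) = cscale c (A x))"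

definition functional_on :: "('a \<Rightarrow>\<^sub>0 complex) set \<Rightarrow> (('a \<Rightarrow>\<^sub>0 complex) \<Rightarrow> complex) \<Rightarrow> bool" where
  "functional_on V l \<longleftrightarrow> (\<forall>x\<in>V. \<forall>y\<in>V. l (x + y) = l x + l y) \<and> (\<forall>c. \<forall>x\<in>V. l (cscale c x) = c * l x)"

locale findim_subspace =
  fixes V :: "('a \<Rightarrow>\<^sub>0 complex) set"
  assumes fin: "\<exists>S. finite S \<and> V = cvs.span S"
begin

text \<open>The same choice term as in \<open>trace_on\<close>, so that \<open>trace_on\<close> is a
  sum over \<open>bas\<close> by unfolding.\<close>

definition bas :: "('a \<Rightarrow>\<^sub>0 complex) set" where
  "bas = (SOME B. cvs.independent B \<and> cvs.span B = V)"

lemma bas: "cvs.independent bas" "cvs.span bas = V" "finite bas"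
proof -
  obtain S where S: "finite S" "V = cvs.span S" using fin by blast
  have "\<exists>B. cvs.independent B \<and> cvs.span B = V"
    using cvs.maximal_independent_subset[of S] S(2)
    by (metis cvs.span_eq cvs.span_superset subset_trans)
  from someI_ex[OF this] show b: "cvs.independent bas" "cvs.span bas = V" by (simp_all add: bas_def)
  show "finite bas"
    using cvs.independent_span_bound[OF S(1) b(1)] b(2) S(2) cvs.span_superset by blast
qed

lemma bas_V: "b \<in> bas \<Longrightarrow> b \<in> V"
  using bas(2) cvs.span_base by blast

lemma subspace_V: "cvs.subspace V"
  using bas(2) cvs.subspace_span by metis

lemmas V_closed = cvs.subspace_0[OF subspace_V] cvs.subspace_add[OF subspace_V]
  cvs.subspace_scale[OF subspace_V] cvs.subspace_sum[OF subspace_V] cvs.subspace_diff[OF subspace_V]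

definition coord :: "('a \<Rightarrow>\<^sub>0 complex) \<Rightarrow> ('a \<Rightarrow>\<^sub>0 complex) \<Rightarrow> complex" where
  "coord = cvs.representation bas"

lemma coord_expand: "v \<in> V \<Longrightarrow> (\<Sum>b\<in>bas. cscale (coord v b) b) = v"
  using cvs.sum_representation_eq[of bas v bas] bas by (auto simp: coord_def)

lemma coord_add: "x \<in> V \<Longrightarrow> y \<in> V \<Longrightarrow> coord (x + y) b = coord x b + coord y b"
  using cvs.representation_add[of bas y x] bas by (simp add: coord_def)

lemma coord_scale: "x \<in> V \<Longrightarrow> coord (cscale c x) b = c * coord x b"
  using cvs.representation_scale[of bas x c] bas by (simp add: coord_def)

lemma coord_bas: "b \<in> bas \<Longrightarrow> coord b b' = (if b' = b then 1 else 0)"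
  using cvs.representation_basis[of bas b] bas by (simp add: coord_def)

lemma coord_0 [simp]: "coord 0 b = 0"
  using cvs.representation_zero[of bas] by (simp add: coord_def)

lemma coord_sum: "(\<And>i. i \<in> I \<Longrightarrow> f i \<in> V) \<Longrightarrow> coord (sum f I) b = (\<Sum>i\<in>I. coord (f i) b)"
  using cvs.representation_sum[of bas I f] bas by (simp add: coord_def)

lemma functional_sum:
  assumes "functional_on V l" "\<And>i. i \<in> I \<Longrightarrow> f i \<in> V"
  shows "l (sum f I) = (\<Sum>i\<in>I. l (f i))"
proof -
  have z: "l 0 = 0"
  proof -
    have "l (cscale 0 0) = 0 * l 0" using assms(1) V_closed(1) unfolding functional_on_def by blast
    then show ?thesis by simp
  qed
  from assms(2) show ?thesis
  proof (induction I rule: infinite_finite_induct)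
    case (insert i I)
    then show ?case using assms(1) V_closed(4)[of I f] by (simp add: functional_on_def)
  qed (auto simp: z)
qed

lemma functional_expand:
  assumes "functional_on V l" "v \<in> V"
  shows "(\<Sum>b\<in>bas. coord v b * l b) = l v"
proof -
  have "l v = l (\<Sum>b\<in>bas. cscale (coord v b) b)" using coord_expand[OF assms(2)] by simp
  also have "\<dots> = (\<Sum>b\<in>bas. l (cscale (coord v b) b))"
    using bas_V V_closed by (intro functional_sum assms) auto
  also have "\<dots> = (\<Sum>b\<in>bas. coord v b * l b)"
    using assms(1) bas_V by (intro sum.cong) (auto simp: functional_on_def)
  finally show ?thesis by simp
qed

lemma trace_on_coord: "trace_on V f = (\<Sum>b\<in>bas. coord (f b) b)"
  by (simp add: trace_on_def bas_def coord_def Let_def)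

lemma trace_on_cong: "(\<And>v. v \<in> V \<Longrightarrow> f v = g v) \<Longrightarrow> trace_on V f = trace_on V g"
  using bas_V by (simp add: trace_on_coord)

lemma trace_on_scale: "trace_on V (cscale z) = z * of_nat (card bas)"
  using bas_V by (simp add: trace_on_coord coord_scale coord_bas mult.commute)

lemma trace_on_sum:
  assumes "\<And>i v. i \<in> I \<Longrightarrow> v \<in> V \<Longrightarrow> A i v \<in> V"
  shows "trace_on V (\<lambda>v. \<Sum>i\<in>I. cscale (c i) (A i v)) = (\<Sum>i\<in>I. c i * trace_on V (A i))"
proof -
  have "trace_on V (\<lambda>v. \<Sum>i\<in>I. cscale (c i) (A i v)) = (\<Sum>b\<in>bas. \<Sum>i\<in>I. c i * coord (A i b) b)"
    unfolding trace_on_coord using assms bas_V V_closed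
    by (intro sum.cong refl) (simp add: coord_sum coord_scale)
  also have "\<dots> = (\<Sum>i\<in>I. c i * trace_on V (A i))"
    by (subst sum.swap) (simp add: trace_on_coord sum_distrib_left)
  finally show ?thesis .
qed

text \<open>The diagonal entries are \<open>coord u b * l b\<close>, and their sum is
  \<open>l\<close> applied to the basis expansion of \<open>u\<close>.\<close>

lemma trace_on_rank_one:
  assumes "functional_on V l" "u \<in> V" "\<And>v. v \<in> V \<Longrightarrow> A v = cscale (l v) u"
  shows "trace_on V A = l u"
proof -
  have "trace_on V A = (\<Sum>b\<in>bas. coord u b * l b)"
    unfolding trace_on_coord using assms bas_V by (intro sum.cong refl) (simp add: coord_scale)
  then show ?thesis using functional_expand[OF assms(1,2)] by simp
qed

lemma card_bas_pos:
  assumes "v \<in> V" "v \<noteq> 0"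
  shows "card bas > 0"
  using assms coord_expand[OF assms(1)] bas(3) by (auto simp: card_gt_0_iff)

end

section \<open>First orthogonality relation\<close>

locale perm_rep = findim_subspace V for V :: "((nat \<Rightarrow> nat set) \<Rightarrow>\<^sub>0 complex) set" +
  fixes n :: nat
  assumes stable: "\<sigma> permutes {1..n} \<Longrightarrow> v \<in> V \<Longrightarrow> perm_action \<sigma> v \<in> V"
begin

abbreviation "chi \<equiv> \<lambda>\<sigma>. trace_on V (perm_action \<sigma>)"

lemma stable': "\<sigma> \<in> Sym n \<Longrightarrow> v \<in> V \<Longrightarrow> perm_action \<sigma> v \<in> V"
  using stable by simp

text \<open>Conjugating by the whole group makes any operator equivariant.\<close>

lemma average_equivariant:
  assumes "lin_on V E" "\<And>v. v \<in> V \<Longrightarrow> E v \<in> V" "v \<in> V" "\<tau> permutes {1..n}"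
  shows "(\<Sum>\<sigma>\<in>Sym n. perm_action (inv \<sigma>) (E (perm_action \<sigma> (perm_action \<tau> v)))) =
    perm_action \<tau> (\<Sum>\<sigma>\<in>Sym n. perm_action (inv \<sigma>) (E (perm_action \<sigma> v)))"
proof -
  have "perm_action (inv \<sigma>) (E (perm_action \<sigma> (perm_action \<tau> v))) =
      perm_action \<tau> (perm_action (inv (\<sigma> \<circ> \<tau>)) (E (perm_action (\<sigma> \<circ> \<tau>) v)))"
    if "\<sigma> permutes {1..n}" for \<sigma>
  proof -
    have "inv (\<sigma> \<circ> \<tau>) = inv \<tau> \<circ> inv \<sigma>"
      using that assms(4) by (rule permutes_inv_comp)
    then show ?thesis by (simp add: perm_action_comp perm_action_inv[OF assms(4)])
  qed
  then have "(\<Sum>\<sigma>\<in>Sym n. perm_action (inv \<sigma>) (E (perm_action \<sigma> (perm_action \<tau> v)))) =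
     (\<Sum>\<sigma>\<in>Sym n. perm_action \<tau> (perm_action (inv (\<sigma> \<circ> \<tau>)) (E (perm_action (\<sigma> \<circ> \<tau>) v))))"
    by simp
  also have "\<dots> = (\<Sum>\<sigma>\<in>Sym n. perm_action \<tau> (perm_action (inv \<sigma>) (E (perm_action \<sigma> v))))"
    by (rule sum_permutations_compose_right[OF assms(4), symmetric])
  finally show ?thesis by (simp add: perm_action_sum)
qed

end

text \<open>The conclusion of Schur's lemma is the assumption here; for the polytabloid module it
  comes from the rank-one operator \<open>kappa\<close>.\<close>

locale schur_rep = perm_rep +
  assumes nonzero: "\<exists>v\<in>V. v \<noteq> 0"
    and schur: "\<And>A. lin_on V A \<Longrightarrow> (\<And>v. v \<in> V \<Longrightarrow> A v \<in> V) \<Longrightarrow>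
      (\<And>\<sigma> v. \<sigma> permutes {1..n} \<Longrightarrow> v \<in> V \<Longrightarrow> A (perm_action \<sigma> v) = perm_action \<sigma> (A v)) \<Longrightarrow>
      \<exists>z. \<forall>v\<in>V. A v = cscale z v"
begin

text \<open>The average commutes with the group, so it is a scalar \<open>z\<close>; comparing
  traces determines \<open>z\<close>.\<close>

lemma average_scalar:
  assumes "lin_on V E" "\<And>v. v \<in> V \<Longrightarrow> E v \<in> V"
  shows "\<exists>z. (\<forall>v\<in>V.
      (\<Sum>\<sigma>\<in>Sym n. perm_action (inv \<sigma>) (E (perm_action \<sigma> v))) = cscale z v) \<and>
    z * of_nat (card bas) =
      (\<Sum>\<sigma>\<in>Sym n. trace_on V (\<lambda>v. perm_action (inv \<sigma>) (E (perm_action \<sigma> v))))"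
proof -
  let ?A = "\<lambda>v. \<Sum>\<sigma>\<in>Sym n. perm_action (inv \<sigma>) (E (perm_action \<sigma> v))"
  have st: "perm_action (inv \<sigma>) (E (perm_action \<sigma> v)) \<in> V" if "\<sigma> permutes {1..n}" "v \<in> V" for \<sigma> v
    using that by (intro stable assms permutes_inv)
  have "lin_on V ?A"
    using assms(1) unfolding lin_on_def
    by (auto simp: perm_action_add perm_action_scale stable' sum.distrib cvs.scale_sum_right)
  moreover have "?A v \<in> V" if "v \<in> V" for v
    using st that by (intro V_closed) auto
  ultimately have "\<exists>z. \<forall>v\<in>V. ?A v = cscale z v"
    using average_equivariant[OF assms] by (intro schur)
  then obtain z where z: "\<And>v. v \<in> V \<Longrightarrow> ?A v = cscale z v"
    by blast
  have "z * of_nat (card bas) = trace_on V ?A"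
    by (subst trace_on_cong[OF z]) (simp_all add: trace_on_scale)
  also have "\<dots> = (\<Sum>\<sigma>\<in>Sym n. trace_on V (\<lambda>v. perm_action (inv \<sigma>) (E (perm_action \<sigma> v))))"
    using trace_on_sum[of "Sym n" "\<lambda>\<sigma> v. perm_action (inv \<sigma>) (E (perm_action \<sigma> v))" "\<lambda>_. 1"] st by simp
  finally show ?thesis using z by blast
qed

lemma card_bas_nz: "of_nat (card bas) \<noteq> (0::complex)"
  using card_bas_pos nonzero by force

text \<open>Schur orthogonality of diagonal matrix coefficients: the sum is the entry at
  \<open>b\<close>, \<open>b0\<close> of the average of the matrix unit \<open>E\<close>, and the
  average is the scalar with the same total trace.\<close>

lemma matrix_unit_average:
  assumes "b \<in> bas" "b0 \<in> bas"
  shows "(\<Sum>\<sigma>\<in>Sym n. coord (perm_action \<sigma> b) b * coord (perm_action (inv \<sigma>) b0) b0) =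
    (if b = b0 then fact n / of_nat (card bas) else 0)"
proof -
  define E where "E = (\<lambda>v. cscale (coord v b) b0)"
  have V: "b \<in> V" "b0 \<in> V" using assms bas_V by auto
  have E: "lin_on V E" "\<And>v. v \<in> V \<Longrightarrow> E v \<in> V"
    using V by (auto simp: lin_on_def E_def coord_add coord_scale cvs.scale_left_distrib V_closed)
  obtain z where z: "\<And>v. v \<in> V \<Longrightarrow>
      (\<Sum>\<sigma>\<in>Sym n. perm_action (inv \<sigma>) (E (perm_action \<sigma> v))) = cscale z v"
    and tz: "z * of_nat (card bas) =
      (\<Sum>\<sigma>\<in>Sym n. trace_on V (\<lambda>v. perm_action (inv \<sigma>) (E (perm_action \<sigma> v))))"
    using average_scalar[OF E] by blast
  \<comment> \<open>The operator has rank one with functional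
    \<open>coord (perm_action \<sigma> v) b\<close>; the conjugation cancels in its trace.\<close>
  have "trace_on V (\<lambda>v. perm_action (inv \<sigma>) (E (perm_action \<sigma> v))) = (if b = b0 then 1 else 0)"
    if s: "\<sigma> permutes {1..n}" for \<sigma>
  proof -
    have "trace_on V (\<lambda>v. perm_action (inv \<sigma>) (E (perm_action \<sigma> v))) =
      coord (perm_action \<sigma> (perm_action (inv \<sigma>) b0)) b"
      using s V by (intro trace_on_rank_one)
        (auto simp: functional_on_def coord_add coord_scale perm_action_add perm_action_scale stable E_def permutes_inv)
    also have "\<dots> = (if b = b0 then 1 else 0)"
      using assms(2) by (simp add: perm_action_inv[OF s] coord_bas)
    finally show ?thesis .
  qed
  then have "z * of_nat (card bas) = (if b = b0 then fact n else 0)"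
    by (simp add: tz card_permutations)
  then have z': "z = (if b = b0 then fact n / of_nat (card bas) else 0)"
    using card_bas_nz by (auto simp: field_simps split: if_splits)
  have "(\<Sum>\<sigma>\<in>Sym n. coord (perm_action \<sigma> b) b * coord (perm_action (inv \<sigma>) b0) b0) =
    coord (\<Sum>\<sigma>\<in>Sym n. perm_action (inv \<sigma>) (E (perm_action \<sigma> b))) b0"
    unfolding E_def perm_action_scale using V
    by (subst coord_sum) (auto intro!: V_closed sum.cong stable permutes_inv simp: coord_scale[OF
      stable[OF permutes_inv]])
  also have "\<dots> = z * coord b b0" using z V by (simp add: coord_scale)
  also have "\<dots> = (if b = b0 then fact n / of_nat (card bas) else 0)"
    using assms by (simp add: coord_bas z')
  finally show ?thesis .
qed

text \<open>Only the pairs with \<open>b = b0\<close> survive; there are \<open>card bas\<close> of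
  them, each contributing \<open>fact n / card bas\<close>.\<close>

lemma character_norm: "(\<Sum>\<sigma>\<in>Sym n. chi \<sigma> * chi (inv \<sigma>)) = fact n"
proof -
  have "(\<Sum>\<sigma>\<in>Sym n. chi \<sigma> * chi (inv \<sigma>)) =
    (\<Sum>\<sigma>\<in>Sym n. \<Sum>b\<in>bas. \<Sum>b0\<in>bas. coord (perm_action \<sigma> b) b * coord (perm_action (inv \<sigma>) b0) b0)"
    by (simp add: trace_on_coord sum_product)
  also have "\<dots> = (\<Sum>b\<in>bas. \<Sum>b0\<in>bas. \<Sum>\<sigma>\<in>Sym n. coord (perm_action \<sigma> b) b * coord (perm_action (inv \<sigma>) b0) b0)"
    by (subst sum.swap) (intro sum.cong refl sum.swap)
  also have "\<dots> = (\<Sum>b\<in>bas. \<Sum>b0\<in>bas. if b = b0 then fact n / of_nat (card bas) else 0)"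
    by (intro sum.cong refl matrix_unit_average)
  also have "\<dots> = fact n" using card_bas_nz bas(3) by simp
  finally show ?thesis .
qed

end

section \<open>The module generated by a polytabloid\<close>

definition act :: "(nat \<Rightarrow> nat) \<Rightarrow> (nat \<Rightarrow> nat set) \<Rightarrow> (nat \<Rightarrow> nat set)" where
  "act \<sigma> t = (\<lambda>i. \<sigma> ` t i)"

lemma act_comp: "act (\<sigma> \<circ> \<tau>) t = act \<sigma> (act \<tau> t)"
  by (simp add: act_def image_comp)

lemma act_id [simp]: "act id t = t"
  by (simp add: act_def)

lemma act_inv:
  assumes "\<sigma> permutes S"
  shows "act (inv \<sigma>) (act \<sigma> t) = t" "act \<sigma> (act (inv \<sigma>) t) = t"
  using permutes_inv_o[OF assms] by (simp_all flip: act_comp)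

lemma act_eq_iff: "\<sigma> permutes S \<Longrightarrow> act \<sigma> s = act \<sigma> t \<longleftrightarrow> s = t"
  by (metis act_inv(1))

lemma perm_action_single_act: "perm_action \<sigma> (single t c) = single (act \<sigma> t) c"
  by (simp add: act_def perm_action_single)

lemma lookup_perm_action_act:
  assumes "\<sigma> permutes S"
  shows "lookup (perm_action \<sigma> v) (act \<sigma> t) = lookup v t"
proof -
  have "lookup (perm_action \<sigma> v) (act \<sigma> t) =
     (\<Sum>s\<in>keys v. if s = t then lookup v s else 0)"
    unfolding perm_action_def act_def[symmetric]
    by (simp add: lookup_sum lookup_single when_def act_eq_iff[OF assms])
  then show ?thesis by (simp add: in_keys_iff)
qed

lemma sign_inv_permutes: "finite S \<Longrightarrow> \<sigma> permutes S \<Longrightarrow> sign (inv \<sigma>) = sign \<sigma>"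
  by (intro sign_inverse permutes_imp_permutation)

lemma sign_comp_permutes:
  "finite S \<Longrightarrow> \<sigma> permutes S \<Longrightarrow> \<tau> permutes S \<Longrightarrow> sign (\<sigma> \<circ> \<tau>) = sign \<sigma> * sign \<tau>"
  by (intro sign_compose permutes_imp_permutation)

text \<open>\<open>t0\<close> is the tabloid of a tableau and \<open>C\<close> its column group.
  \<open>C_stab\<close>: a column permutation that fixes the rows is the identity.
  \<open>dichotomy\<close>: a tabloid either has two entries of one column in a common row, or
  arises from \<open>t0\<close> by a column permutation. Beyond the group laws, these two facts
  carry all the combinatorics of the diagram that the module theory uses.\<close>

locale tabloid_rep =
  fixes n :: nat and t0 :: "nat \<Rightarrow> nat set" and C :: "(nat \<Rightarrow> nat) set"
  assumes C_permutes: "c \<in> C \<Longrightarrow> c permutes {1..n}"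
    and C_id: "id \<in> C"
    and C_comp: "c \<in> C \<Longrightarrow> c' \<in> C \<Longrightarrow> c \<circ> c' \<in> C"
    and C_inv: "c \<in> C \<Longrightarrow> inv c \<in> C"
    and C_stab: "c \<in> C \<Longrightarrow> act c t0 = t0 \<Longrightarrow> c = id"
    and dichotomy: "\<pi> permutes {1..n} \<Longrightarrow>
      (\<exists>a b. a \<noteq> b \<and> transpose a b \<in> C \<and> act (transpose a b) (act \<pi> t0) = act \<pi> t0) \<or>
      (\<exists>c\<in>C. act c t0 = act \<pi> t0)"
begin

definition sgn_act :: "(nat \<Rightarrow> nat) \<Rightarrow> complex" where
  "sgn_act c = of_int (sign c)"

text \<open>Young's column antisymmetrizer.\<close>

definition kappa :: "((nat \<Rightarrow> nat set) \<Rightarrow>\<^sub>0 complex) \<Rightarrow> ((nat \<Rightarrow> nat set) \<Rightarrow>\<^sub>0 complex)" where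
  "kappa v = (\<Sum>c\<in>C. cscale (sgn_act c) (perm_action c v))"

definition e0 :: "(nat \<Rightarrow> nat set) \<Rightarrow>\<^sub>0 complex" where
  "e0 = kappa (single t0 1)"

text \<open>\<open>specht_module_eq\<close> identifies this cyclic module with the Specht module; a
  single generator makes Schur's lemma a computation at \<open>e0\<close>.\<close>

definition W :: "((nat \<Rightarrow> nat set) \<Rightarrow>\<^sub>0 complex) set" where
  "W = cvs.span ((\<lambda>g. perm_action g e0) ` Sym n)"

lemma finite_C: "finite C"
  by (rule finite_subset[OF _ finite_permutations[of "{1..n}"]]) (auto dest: C_permutes)

lemma card_C: "card C > 0"
  using finite_C C_id by (auto simp: card_gt_0_iff)

lemma sgn_act_sq [simp]: "sgn_act c * sgn_act c = 1"
  by (simp add: sgn_act_def flip: of_int_mult)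

lemma kappa_lin: "kappa (v + w) = kappa v + kappa w" "kappa (cscale z v) = cscale z (kappa v)"
  by (simp_all add: kappa_def perm_action_add perm_action_scale cvs.scale_right_distrib sum.distrib
      cvs.scale_sum_right mult.commute)

lemma kappa_0 [simp]: "kappa 0 = 0"
  by (simp add: kappa_def)

lemma bij_C_right: "c \<in> C \<Longrightarrow> bij_betw (\<lambda>x. x \<circ> c) C C"
  by (rule bij_betw_byWitness[of _ "\<lambda>x. x \<circ> inv c"])
    (auto simp: C_comp C_inv o_assoc[symmetric] permutes_inv_o[OF C_permutes])

lemma bij_C_left: "c \<in> C \<Longrightarrow> bij_betw (\<lambda>x. c \<circ> x) C C"
  by (rule bij_betw_byWitness[of _ "\<lambda>x. inv c \<circ> x"])
    (auto simp: C_comp C_inv o_assoc permutes_inv_o[OF C_permutes])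

lemma sgn_act_comp: "c \<in> C \<Longrightarrow> c' \<in> C \<Longrightarrow> sgn_act (c \<circ> c') = sgn_act c * sgn_act c'"
  by (simp add: sgn_act_def sign_comp_permutes[OF finite_atLeastAtMost C_permutes C_permutes])

text \<open>Multiplication by \<open>c\<close> permutes \<open>C\<close>, and the sign is
  multiplicative with values of square 1.\<close>

lemma kappa_perm_action:
  assumes "c \<in> C"
  shows "kappa (perm_action c v) = cscale (sgn_act c) (kappa v)"
    "perm_action c (kappa v) = cscale (sgn_act c) (kappa v)"
proof -
  have s: "sgn_act c * (sgn_act c * x) = x" for x
    by (simp flip: mult.assoc)
  have "cscale (sgn_act c) (kappa v) =
      (\<Sum>x\<in>C. cscale (sgn_act c) (cscale (sgn_act (x \<circ> c)) (perm_action (x \<circ> c) v)))"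
    unfolding kappa_def cvs.scale_sum_right
    by (subst sum.reindex_bij_betw[OF bij_C_right[OF assms], symmetric]) simp
  also have "\<dots> = kappa (perm_action c v)"
    unfolding kappa_def using assms
    by (intro sum.cong refl) (simp add: sgn_act_comp perm_action_comp s mult.commute)
  finally show "kappa (perm_action c v) = cscale (sgn_act c) (kappa v)" ..
  have "cscale (sgn_act c) (kappa v) =
      (\<Sum>x\<in>C. cscale (sgn_act c) (cscale (sgn_act (c \<circ> x)) (perm_action (c \<circ> x) v)))"
    unfolding kappa_def cvs.scale_sum_right
    by (subst sum.reindex_bij_betw[OF bij_C_left[OF assms], symmetric]) simp
  also have "\<dots> = perm_action c (kappa v)"
    unfolding kappa_def perm_action_sum using assms
    by (intro sum.cong refl) (simp add: sgn_act_comp perm_action_comp perm_action_scale s)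
  finally show "perm_action c (kappa v) = cscale (sgn_act c) (kappa v)" ..
qed

lemma kappa_kappa: "kappa (kappa v) = cscale (of_nat (card C)) (kappa v)"
proof -
  have "kappa (kappa v) = (\<Sum>c\<in>C. kappa v)"
    unfolding kappa_def[of "kappa v"] by (intro sum.cong refl) (simp add: kappa_perm_action)
  also have "\<dots> = cscale (of_nat (card C)) (kappa v)"
    by (intro poly_mapping_eqI) (simp add: lookup_sum)
  finally show ?thesis .
qed

lemma e0_perm_action: "c \<in> C \<Longrightarrow> perm_action c e0 = cscale (sgn_act c) e0"
  unfolding e0_def by (rule kappa_perm_action)

text \<open>If a transposition in \<open>C\<close> fixes the tabloid, its image under
  \<open>kappa\<close> equals its own negative; otherwise the tabloid lies in the
  \<open>C\<close>-orbit of \<open>t0\<close> and the image is \<open>e0\<close> up to sign.\<close>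

lemma kappa_single:
  assumes "\<pi> permutes {1..n}"
  shows "\<exists>z. kappa (single (act \<pi> t0) 1) = cscale z e0"
  using dichotomy[OF assms]
proof (elim disjE exE bexE conjE)
  fix a b assume ab: "a \<noteq> b" "transpose a b \<in> C" "act (transpose a b) (act \<pi> t0) = act \<pi> t0"
  let ?v = "kappa (single (act \<pi> t0) 1)"
  have "?v = kappa (perm_action (transpose a b) (single (act \<pi> t0) 1))"
    by (simp only: perm_action_single_act ab)
  also have "\<dots> = cscale (- 1) ?v"
    using ab by (simp only: kappa_perm_action) (simp add: sgn_act_def sign_swap_id)
  finally have "lookup ?v x = - lookup ?v x" for x
    by (metis lookup_cscale mult_minus1)
  then have "?v = cscale 0 e0" by (intro poly_mapping_eqI) simp
  then show ?thesis ..
next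
  fix c assume c: "c \<in> C" "act c t0 = act \<pi> t0"
  then have "kappa (single (act \<pi> t0) 1) = kappa (perm_action c (single t0 1))"
    by (simp only: perm_action_single_act)
  then show ?thesis using kappa_perm_action(1)[OF c(1)] e0_def by metis
qed

text \<open>Only the identity of \<open>C\<close> fixes \<open>t0\<close>. So \<open>e0\<close> is
  nonzero, and a multiple of \<open>e0\<close> is known from its coefficient at
  \<open>t0\<close>.\<close>

lemma lookup_e0: "lookup e0 t0 = 1"
proof -
  have "lookup e0 t0 = (\<Sum>c\<in>C. if c = id then 1 else 0)"
    unfolding e0_def kappa_def perm_action_single_act lookup_sum
    by (intro sum.cong refl) (auto simp: lookup_single when_def sgn_act_def sign_id dest: C_stab)
  then show ?thesis using finite_C C_id by simp
qed

lemma kappa_sum: "kappa (sum f I) = (\<Sum>i\<in>I. kappa (f i))"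
  by (induction I rule: infinite_finite_induct) (auto simp: kappa_lin)

lemma kappa_e0: "kappa e0 = cscale (of_nat (card C)) e0"
  unfolding e0_def by (rule kappa_kappa)

lemma sum_cscale_multiple:
  assumes "finite I" "\<And>i. i \<in> I \<Longrightarrow> \<exists>z. f i = cscale z u"
  shows "\<exists>z. sum f I = cscale z u"
  using assms
proof (induction I)
  case empty
  show ?case by (rule exI[of _ 0]) simp
next
  case (insert i I)
  then obtain y z where "f i = cscale y u" "sum f I = cscale z u" by blast
  then have "sum f (insert i I) = cscale (y + z) u" using insert by (simp add: cvs.scale_left_distrib)
  then show ?case ..
qed

lemma kappa_generator:
  assumes "g permutes {1..n}"
  shows "\<exists>z. kappa (perm_action g e0) = cscale z e0"
proof -
  have "kappa (perm_action g e0) =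
      (\<Sum>c\<in>C. cscale (sgn_act c) (kappa (single (act (g \<circ> c) t0) 1)))"
    unfolding e0_def kappa_def[of "single t0 1"] perm_action_sum perm_action_scale
      perm_action_single_act kappa_sum kappa_lin act_comp ..
  also have "\<exists>z. \<dots> = cscale z e0"
  proof (rule sum_cscale_multiple[OF finite_C])
    fix c assume "c \<in> C"
    then have "g \<circ> c permutes {1..n}" using assms C_permutes permutes_compose by blast
    from kappa_single[OF this]
    show "\<exists>z. cscale (sgn_act c) (kappa (single (act (g \<circ> c) t0) 1)) = cscale z e0"
      by (metis cvs.scale_scale)
  qed
  finally show ?thesis .
qed

lemma W_generator: "g permutes {1..n} \<Longrightarrow> perm_action g e0 \<in> W"
  unfolding W_def by (rule cvs.span_base) simp

lemma e0_W: "e0 \<in> W"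
  using W_generator[OF permutes_id] by simp

lemma W_induct [consumes 1, case_names zero step]:
  assumes "v \<in> W" "P 0"
    "\<And>z g v. g permutes {1..n} \<Longrightarrow> v \<in> W \<Longrightarrow> P v \<Longrightarrow> P (cscale z (perm_action g e0) + v)"
  shows "P v"
proof -
  have "v \<in> W \<and> P v"
    using assms(1) unfolding W_def
  proof (induction rule: cvs.span_induct_alt)
    case base
    then show ?case using assms(2) cvs.span_zero by auto
  next
    case (step c x y)
    then show ?case using assms(3) unfolding W_def
      by (auto intro!: cvs.span_add cvs.span_scale intro: cvs.span_base)
  qed
  then show ?thesis ..
qed

text \<open>For \<open>v\<close> in \<open>W\<close> this is the factor in
  \<open>kappa v = cscale (ell v) e0\<close>, read off at \<open>t0\<close>.\<close>

definition ell :: "((nat \<Rightarrow> nat set) \<Rightarrow>\<^sub>0 complex) \<Rightarrow> complex" where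
  "ell v = lookup (kappa v) t0"

lemma kappa_W:
  assumes "v \<in> W"
  shows "kappa v = cscale (ell v) e0"
proof -
  have "\<exists>z. kappa v = cscale z e0"
    using assms
  proof (induction rule: W_induct)
    case zero
    show ?case by (rule exI[of _ 0]) simp
  next
    case (step z g v)
    then obtain x y where "kappa (perm_action g e0) = cscale x e0" "kappa v = cscale y e0"
      using kappa_generator by blast
    then have "kappa (cscale z (perm_action g e0) + v) = cscale (z * x + y) e0"
      by (simp add: kappa_lin cvs.scale_left_distrib)
    then show ?case ..
  qed
  then show ?thesis by (auto simp: ell_def lookup_e0)
qed

lemma ell_functional: "functional_on S ell"
  by (simp add: functional_on_def ell_def kappa_lin lookup_add)

lemma ell_e0: "ell e0 = of_nat (card C)"
  by (simp add: ell_def kappa_e0 lookup_e0)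

lemma W_stable:
  assumes "\<sigma> permutes {1..n}" "v \<in> W"
  shows "perm_action \<sigma> v \<in> W"
  using assms(2)
proof (induction rule: W_induct)
  case (step z g v)
  have "perm_action (\<sigma> \<circ> g) e0 \<in> W" by (intro W_generator permutes_compose step assms)
  then show ?case using step unfolding perm_action_add perm_action_scale perm_action_comp W_def
    by (intro cvs.span_add cvs.span_scale)
qed (simp add: W_def cvs.span_zero)

sublocale findim_subspace W
  by unfold_locales (auto simp: W_def intro!: exI[of _ "(\<lambda>g. perm_action g e0) ` Sym n"] finite_permutations)

text \<open>An equivariant \<open>A\<close> commutes with \<open>kappa\<close>, so
  \<open>card C\<close> times \<open>A e0\<close> is \<open>kappa (A e0)\<close>, a multiple of
  \<open>e0\<close>. As \<open>e0\<close> generates \<open>W\<close>, \<open>A\<close> is the same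
  multiple everywhere.\<close>

sublocale schur_rep W n
proof
  show "perm_action \<sigma> v \<in> W" if "\<sigma> permutes {1..n}" "v \<in> W" for \<sigma> v
    using W_stable that .
  have "e0 \<noteq> 0" using lookup_e0 by auto
  then show "\<exists>v\<in>W. v \<noteq> 0" using e0_W by blast
next
  fix A
  assume lin: "lin_on W A" and st: "\<And>v. v \<in> W \<Longrightarrow> A v \<in> W"
    and eq: "\<And>\<sigma> v. \<sigma> permutes {1..n} \<Longrightarrow> v \<in> W \<Longrightarrow> A (perm_action \<sigma> v) = perm_action \<sigma> (A v)"
  have A_add: "A (x + y) = A x + A y" if "x \<in> W" "y \<in> W" for x y
    using lin that by (auto simp: lin_on_def)
  have A_scale: "A (cscale c x) = cscale c (A x)" if "x \<in> W" for x c
    using lin that by (auto simp: lin_on_def)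
  have A0: "A 0 = 0" using A_scale[of 0 0] V_closed(1) by simp
  have A_sum: "A (sum f I) = (\<Sum>i\<in>I. A (f i))" if "\<And>i. i \<in> I \<Longrightarrow> f i \<in> W"
    for f and I :: "(nat \<Rightarrow> nat) set"
    using that
  proof (induction I rule: infinite_finite_induct)
    case (insert i I)
    then show ?case using V_closed(4)[of I f] by (simp add: A_add)
  qed (auto simp: A0)
  have "cscale (of_nat (card C)) (A e0) = A (kappa e0)"
    using e0_W by (simp add: kappa_e0 A_scale)
  also have "\<dots> = kappa (A e0)"
    unfolding kappa_def using e0_W
    by (subst A_sum) (auto intro!: V_closed W_stable sum.cong C_permutes simp: A_scale W_stable C_permutes eq)
  also have "\<dots> = cscale (ell (A e0)) e0"
    by (intro kappa_W st e0_W)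
  finally have "cscale (of_nat (card C)) (A e0) = cscale (ell (A e0)) e0" .
  then have "cscale (1 / of_nat (card C)) (cscale (of_nat (card C)) (A e0)) =
      cscale (1 / of_nat (card C)) (cscale (ell (A e0)) e0)" by simp
  then have z: "A e0 = cscale (ell (A e0) / of_nat (card C)) e0" (is "_ = cscale ?z _")
    using card_C by simp
  have "A v = cscale ?z v" if "v \<in> W" for v
    using that
  proof (induction rule: W_induct)
    case (step x g v)
    have g: "perm_action g e0 \<in> W" using step W_generator by simp
    have "A (perm_action g e0) = cscale ?z (perm_action g e0)"
      using eq[OF step(1) e0_W] z by (metis perm_action_scale)
    then show ?case using step g
      by (simp add: A_add A_scale V_closed cvs.scale_right_distrib mult.commute)
  qed (simp add: A0)
  then show "\<exists>z. \<forall>v\<in>W. A v = cscale z v" by blast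
qed

section \<open>The character is real and invariant under inversion\<close>

text \<open>The matrix coefficient of \<open>\<rho>\<close> at \<open>t0\<close> between two copies
  of \<open>kappa\<close>, written over the reals.\<close>

definition Lform :: "(nat \<Rightarrow> nat) \<Rightarrow> real" where
  "Lform \<rho> = (\<Sum>c\<in>C. \<Sum>c'\<in>C. of_int (sign c) * of_int (sign c') * (if act (c \<circ> \<rho> \<circ> c') t0 = t0 then 1 else 0))"

lemma ell_Lform: "ell (perm_action \<rho> e0) = of_real (Lform \<rho>)"
proof -
  have "ell (perm_action \<rho> e0) = (\<Sum>c\<in>C. \<Sum>c'\<in>C. sgn_act c * (sgn_act c' *
      (if act (c \<circ> \<rho> \<circ> c') t0 = t0 then 1 else 0)))"
    unfolding ell_def e0_def kappa_def perm_action_sum perm_action_scale perm_action_single_act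
        lookup_sum lookup_cscale sum_distrib_left act_comp
    by (simp add: lookup_single when_def)
  then show ?thesis by (simp add: Lform_def sgn_act_def mult.assoc if_distrib cong: if_cong)
qed

text \<open>The inverse of \<open>c \<circ> \<rho> \<circ> c'\<close> fixes \<open>t0\<close>
  exactly when \<open>c \<circ> \<rho> \<circ> c'\<close> does, and inversion maps \<open>C\<close>
  to itself without changing signs.\<close>

lemma Lform_inv:
  assumes "\<rho> permutes {1..n}"
  shows "Lform (inv \<rho>) = Lform \<rho>"
proof -
  have "act (inv c' \<circ> inv \<rho> \<circ> inv c) t0 = t0 \<longleftrightarrow> act (c \<circ> \<rho> \<circ> c') t0 = t0" if "c \<in> C" "c' \<in> C" for c c'
    using act_inv[OF assms] act_inv[OF C_permutes[OF that(1)]] act_inv[OF C_permutes[OF that(2)]]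
    by (metis act_comp)
  then have "Lform \<rho> = (\<Sum>c\<in>C. \<Sum>c'\<in>C. of_int (sign (inv c)) * of_int (sign (inv c')) *
      (if act (inv c' \<circ> inv \<rho> \<circ> inv c) t0 = t0 then 1 else 0))"
    unfolding Lform_def by (intro sum.cong refl)
      (simp add: sign_inv_permutes[OF finite_atLeastAtMost C_permutes])
  also have "\<dots> = (\<Sum>c\<in>C. \<Sum>c'\<in>C. of_int (sign c) * of_int (sign c') *
      (if act (c' \<circ> inv \<rho> \<circ> c) t0 = t0 then 1 else 0))"
  proof -
    have b: "bij_betw inv C C"
      by (rule bij_betw_byWitness[of _ inv]) (auto simp: C_inv permutes_inv_inv[OF C_permutes])
    show ?thesis
      by (subst sum.reindex_bij_betw[OF b, symmetric], subst (2) sum.reindex_bij_betw[OF b, symmetric]) simp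
  qed
  also have "\<dots> = Lform (inv \<rho>)"
    unfolding Lform_def by (subst sum.swap) (simp add: mult.commute)
  finally show ?thesis ..
qed

text \<open>
  The average of the conjugates of \<open>kappa\<close> is a scalar with positive real value, since the trace of
  \<open>kappa\<close> is \<open>card C\<close>. As \<open>kappa\<close> has rank one, this expresses the character by the matrix coefficients
  \<open>Lform\<close>, which are real and invariant under inversion.
\<close>

lemma chi_Lform:
  "\<exists>s. \<forall>\<tau>\<in>Sym n. chi \<tau> = of_real (s * (\<Sum>\<sigma>\<in>Sym n. Lform (\<sigma> \<circ> \<tau> \<circ> inv \<sigma>)))"
proof -
  have lin: "lin_on W kappa" by (simp add: lin_on_def kappa_lin)
  have st: "kappa v \<in> W" if "v \<in> W" for v
    using kappa_W[OF that] e0_W by (simp add: V_closed)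
  have tr: "trace_on W (\<lambda>v. perm_action \<tau> (perm_action (inv \<sigma>) (kappa (perm_action \<sigma> v)))) =
      of_real (Lform (\<sigma> \<circ> \<tau> \<circ> inv \<sigma>))" if "\<tau> permutes {1..n}" "\<sigma> permutes {1..n}" for \<sigma> \<tau>
  proof -
    have "trace_on W (\<lambda>v. perm_action \<tau> (perm_action (inv \<sigma>) (kappa (perm_action \<sigma> v)))) =
       ell (perm_action \<sigma> (perm_action \<tau> (perm_action (inv \<sigma>) e0)))"
    proof (rule trace_on_rank_one[where l = "\<lambda>v. ell (perm_action \<sigma> v)"])
      show "functional_on W (\<lambda>v. ell (perm_action \<sigma> v))"
        using ell_functional[of UNIV] by (simp add: functional_on_def perm_action_add perm_action_scale)
      show "perm_action \<tau> (perm_action (inv \<sigma>) e0) \<in> W"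
        using that by (intro W_stable e0_W permutes_inv)
      show "perm_action \<tau> (perm_action (inv \<sigma>) (kappa (perm_action \<sigma> v))) =
         cscale (ell (perm_action \<sigma> v)) (perm_action \<tau> (perm_action (inv \<sigma>) e0))" if "v \<in> W" for v
        using \<open>\<sigma> permutes {1..n}\<close> that by (simp add: kappa_W W_stable perm_action_scale)
    qed
    then show ?thesis by (simp only: ell_Lform perm_action_comp[symmetric] o_assoc)
  qed
  obtain z where z: "\<And>v. v \<in> W \<Longrightarrow>
      (\<Sum>\<sigma>\<in>Sym n. perm_action (inv \<sigma>) (kappa (perm_action \<sigma> v))) = cscale z v"
    and tz: "z * of_nat (card bas) =
      (\<Sum>\<sigma>\<in>Sym n. trace_on W (\<lambda>v. perm_action (inv \<sigma>) (kappa (perm_action \<sigma> v))))"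
    using average_scalar[OF lin st] by blast
  \<comment> \<open>The case \<open>\<tau> = id\<close> of \<open>tr\<close>, where the conjugation
    by \<open>\<sigma>\<close> cancels.\<close>
  have "z * of_nat (card bas) = (\<Sum>\<sigma>\<in>Sym n. of_real (Lform id))"
    unfolding tz using tr[OF permutes_id] by (intro sum.cong refl) (simp add: permutes_inv_o)
  also have "of_real (Lform id) = (of_nat (card C) :: complex)"
    using ell_Lform[of id] ell_e0 by simp
  finally have zC: "z * of_nat (card bas) = of_nat (fact n * card C)"
    by (simp add: card_permutations)
  then have z0: "z \<noteq> 0" using card_C by auto
  have zr: "z = of_real (fact n * card C / card bas)"
    using zC card_bas_nz by (simp add: field_simps)
  have "z * chi \<tau> = of_real (\<Sum>\<sigma>\<in>Sym n. Lform (\<sigma> \<circ> \<tau> \<circ> inv \<sigma>))" if t: "\<tau> permutes {1..n}" for \<tau>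
  proof -
    have "z * chi \<tau> = trace_on W (\<lambda>v. cscale z (perm_action \<tau> v))"
      using trace_on_sum[of "{()}" "\<lambda>_. perm_action \<tau>" "\<lambda>_. z"] W_stable[OF t] by simp
    also have "\<dots> = trace_on W (\<lambda>v. \<Sum>\<sigma>\<in>Sym n.
        cscale 1 (perm_action \<tau> (perm_action (inv \<sigma>) (kappa (perm_action \<sigma> v)))))"
    proof (rule trace_on_cong)
      fix v assume "v \<in> W"
      then show "cscale z (perm_action \<tau> v) = (\<Sum>\<sigma>\<in>Sym n.
        cscale 1 (perm_action \<tau> (perm_action (inv \<sigma>) (kappa (perm_action \<sigma> v)))))"
        by (simp flip: perm_action_sum add: z perm_action_scale)
    qed
    also have "\<dots> = (\<Sum>\<sigma>\<in>Sym n. 1 * trace_on W (\<lambda>v. perm_action \<tau> (perm_action (inv \<sigma>)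
      (kappa (perm_action \<sigma> v)))))"
      using t by (intro trace_on_sum) (auto intro!: W_stable st permutes_inv)
    finally show ?thesis by (simp add: tr t)
  qed
  then have "chi \<tau> = of_real ((1 / (fact n * card C / card bas)) * (\<Sum>\<sigma>\<in>Sym n. Lform (\<sigma> \<circ> \<tau> \<circ> inv \<sigma>)))"
    if t: "\<tau> permutes {1..n}" for \<tau>
    using t z0 unfolding of_real_mult of_real_divide of_real_1 zr[unfolded of_real_divide, symmetric]
    by (metis (no_types, lifting) nonzero_mult_div_cancel_left times_divide_eq_left mult_1)
  then show ?thesis by blast
qed

text \<open>In \<open>chi_Lform\<close> the right side is real, and the conjugates of
  \<open>inv \<tau>\<close> are the inverses of those of \<open>\<tau>\<close>.\<close>

lemma chi_inv: "\<tau> permutes {1..n} \<Longrightarrow> chi (inv \<tau>) = chi \<tau>"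
  and chi_real: "\<tau> permutes {1..n} \<Longrightarrow> chi \<tau> \<in> \<real>"
proof -
  assume t: "\<tau> permutes {1..n}"
  obtain s where s: "\<And>\<tau>. \<tau> permutes {1..n} \<Longrightarrow> chi \<tau> = of_real (s * (\<Sum>\<sigma>\<in>Sym n. Lform (\<sigma> \<circ> \<tau> \<circ> inv \<sigma>)))"
    using chi_Lform by blast
  show "chi \<tau> \<in> \<real>" by (simp only: s[OF t] Reals_of_real)
  have "Lform (\<sigma> \<circ> inv \<tau> \<circ> inv \<sigma>) = Lform (\<sigma> \<circ> \<tau> \<circ> inv \<sigma>)" if "\<sigma> permutes {1..n}" for \<sigma>
  proof -
    have "inv (\<sigma> \<circ> \<tau> \<circ> inv \<sigma>) = \<sigma> \<circ> inv \<tau> \<circ> inv \<sigma>"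
      using t that by (simp add: permutes_inv_comp[of _ "{1..n}"]
        permutes_compose permutes_inv o_assoc permutes_inv_inv[OF that])
    then show ?thesis using Lform_inv[of "\<sigma> \<circ> \<tau> \<circ> inv \<sigma>"] t that
      by (simp add: permutes_compose permutes_inv)
  qed
  then show "chi (inv \<tau>) = chi \<tau>" by (simp only: s[OF t] s[OF permutes_inv[OF t]]) simp
qed

section \<open>Multiplicities of permutation characters\<close>

text \<open>Some transposition in \<open>K\<close> acts on \<open>perm_action g e0\<close> by the
  factor -1 but is absorbed by the sum over \<open>K\<close>. So this sum kills all generators and
  has trace 0 on \<open>W\<close>: the trivial character of \<open>K\<close> does not occur.\<close>

lemma sum_chi_zero:
  assumes K: "K \<subseteq> Sym n" "\<And>\<sigma> \<tau>. \<sigma> \<in> K \<Longrightarrow> \<tau> \<in> K \<Longrightarrow> \<sigma> \<circ> \<tau> \<in> K"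
    and ex: "\<And>g. g permutes {1..n} \<Longrightarrow>
      \<exists>a b. a \<noteq> b \<and> transpose a b \<in> K \<and> inv g \<circ> transpose a b \<circ> g \<in> C"
  shows "(\<Sum>\<sigma>\<in>K. chi \<sigma>) = 0"
proof -
  define R where "R v = (\<Sum>\<sigma>\<in>K. perm_action \<sigma> v)" for v
  have R_lin: "R (v + w) = R v + R w" "R (cscale z v) = cscale z (R v)" "R 0 = 0" for v w z
    by (simp_all add: R_def perm_action_add perm_action_scale sum.distrib cvs.scale_sum_right)
  have "R (perm_action g e0) = 0" if g: "g permutes {1..n}" for g
  proof -
    obtain a b where ab: "a \<noteq> b" "transpose a b \<in> K" "inv g \<circ> transpose a b \<circ> g \<in> C"
      using ex[OF g] by blast
    let ?t = "transpose a b" and ?c = "inv g \<circ> transpose a b \<circ> g"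
    have tp: "?t permutes {1..n}" using ab K by blast
    have "sign ?c = - 1"
      using ab(1) sign_idempotent[of g]
      by (simp add: sign_comp_permutes[OF finite_atLeastAtMost permutes_compose[OF tp permutes_inv[OF g]] g]
          sign_comp_permutes[OF finite_atLeastAtMost permutes_inv[OF g] tp]
            sign_inv_permutes[OF finite_atLeastAtMost g] sign_swap_id mult.commute)
    then have "perm_action ?c e0 = cscale (- 1) e0"
      using e0_perm_action[OF ab(3)] by (simp add: sgn_act_def)
    then have "perm_action ?t (perm_action g e0) = cscale (- 1) (perm_action g e0)"
      by (metis perm_action_comp perm_action_inv(2)[OF g] perm_action_scale)
    then have "cscale (- 1) (R (perm_action g e0)) = R (perm_action ?t (perm_action g e0))"
      by (simp only: R_lin)
    also have "\<dots> = (\<Sum>\<sigma>\<in>K. perm_action (\<sigma> \<circ> ?t) (perm_action g e0))"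
      by (simp add: R_def perm_action_comp)
    also have "\<dots> = R (perm_action g e0)"
      unfolding R_def using K(2) ab(2)
      by (intro sum.reindex_bij_witness[of _ "\<lambda>\<sigma>. \<sigma> \<circ> ?t" "\<lambda>\<sigma>. \<sigma> \<circ> ?t"]) (auto simp: o_assoc[symmetric])
    finally have "- lookup (R (perm_action g e0)) x = lookup (R (perm_action g e0)) x" for x
      by (metis lookup_cscale mult_minus1)
    then show ?thesis by (intro poly_mapping_eqI) (simp add: neg_equal_zero)
  qed
  note gen = this
  have "R v = 0" if "v \<in> W" for v
    using that by (induction rule: W_induct) (simp_all add: R_lin gen)
  then have "trace_on W (\<lambda>v. \<Sum>\<sigma>\<in>K. cscale 1 (perm_action \<sigma> v)) = 0"
    using bas_V by (simp add: trace_on_coord flip: R_def)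
  moreover have "trace_on W (\<lambda>v. \<Sum>\<sigma>\<in>K. cscale 1 (perm_action \<sigma> v)) = (\<Sum>\<sigma>\<in>K. 1 * chi \<sigma>)"
    using K(1) by (intro trace_on_sum W_stable) auto
  ultimately show ?thesis by simp
qed

text \<open>The sum \<open>R\<close> over the stabilizer \<open>K\<close> of a tabloid has rank one
  on \<open>W\<close>: by \<open>dichotomy\<close> it sends every generator to a multiple of
  \<open>u = R (perm_action g e0)\<close>. As \<open>R u\<close> is \<open>card K\<close> times
  \<open>u\<close>, the trace is \<open>card K\<close>: the trivial character of \<open>K\<close>
  occurs once.\<close>

lemma sum_chi_row_stabilizer:
  assumes g: "g permutes {1..n}" and K: "K = {\<sigma>. \<sigma> permutes {1..n} \<and> act \<sigma> (act g t0) = act g t0}"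
  shows "(\<Sum>\<sigma>\<in>K. chi \<sigma>) = of_nat (card K)"
proof -
  define R where "R v = (\<Sum>\<sigma>\<in>K. perm_action \<sigma> v)" for v
  have finK: "finite K" unfolding K by (rule finite_subset[OF _ finite_permutations[of "{1..n}"]]) auto
  have K_comp: "\<sigma> \<circ> \<tau> \<in> K" if "\<sigma> \<in> K" "\<tau> \<in> K" for \<sigma> \<tau>
    using that by (auto simp: K act_comp permutes_compose)
  have K_inv: "inv \<sigma> \<in> K" if "\<sigma> \<in> K" for \<sigma>
  proof -
    have s: "\<sigma> permutes {1..n}" "act \<sigma> (act g t0) = act g t0" using that by (auto simp: K)
    have "act (inv \<sigma>) (act g t0) = act g t0" using act_inv(1)[OF s(1), of "act g t0"] s(2) by simp
    then show ?thesis using permutes_inv[OF s(1)] by (simp add: K)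
  qed
  have idK: "id \<in> K" by (simp add: K permutes_id)
  then have cK: "card K > 0" using finK by (auto simp: card_gt_0_iff)
  have R_lin: "R (v + w) = R v + R w" "R (cscale z v) = cscale z (R v)" "R 0 = 0" for v w z
    by (simp_all add: R_def perm_action_add perm_action_scale sum.distrib cvs.scale_sum_right)
  have R_K: "R (perm_action \<tau> v) = R v" "perm_action \<tau> (R v) = R v" if "\<tau> \<in> K" for \<tau> v
  proof -
    have o: "\<tau> \<circ> inv \<tau> = id" "inv \<tau> \<circ> \<tau> = id" using that permutes_inv_o unfolding K by blast+
    have "R (perm_action \<tau> v) = (\<Sum>\<sigma>\<in>K. perm_action (\<sigma> \<circ> \<tau>) v)"
      by (simp add: R_def perm_action_comp)
    also have "\<dots> = R v"
      unfolding R_def using K_comp that K_inv o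
      by (intro sum.reindex_bij_witness[of _ "\<lambda>\<sigma>. \<sigma> \<circ> inv \<tau>" "\<lambda>\<sigma>. \<sigma> \<circ> \<tau>"])
        (auto simp: o_assoc[symmetric])
    finally show "R (perm_action \<tau> v) = R v" .
    have "perm_action \<tau> (R v) = (\<Sum>\<sigma>\<in>K. perm_action (\<tau> \<circ> \<sigma>) v)"
      by (simp add: R_def perm_action_comp perm_action_sum)
    also have "\<dots> = R v"
      unfolding R_def using K_comp that K_inv o
      by (intro sum.reindex_bij_witness[of _ "\<lambda>\<sigma>. inv \<tau> \<circ> \<sigma>" "\<lambda>\<sigma>. \<tau> \<circ> \<sigma>"]) (auto simp: o_assoc)
    finally show "perm_action \<tau> (R v) = R v" .
  qed
  define u where "u = R (perm_action g e0)"
  have uW: "u \<in> W"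
    unfolding u_def R_def by (intro V_closed W_stable W_generator g) (auto simp: K)
  have Ru: "R u = cscale (of_nat (card K)) u"
  proof -
    have "R u = (\<Sum>\<sigma>\<in>K. u)" unfolding R_def[of u] by (intro sum.cong refl) (simp add: u_def R_K)
    then show ?thesis by (intro poly_mapping_eqI) (simp add: lookup_sum)
  qed
  \<comment> \<open>Each element of \<open>K\<close> fixes \<open>act g t0\<close>, so every summand
    has coefficient 1 there; in particular \<open>u\<close> is nonzero.\<close>
  have lu: "lookup u (act g t0) = of_nat (card K)"
  proof -
    have "lookup (perm_action \<sigma> (perm_action g e0)) (act g t0) = 1" if "\<sigma> \<in> K" for \<sigma>
    proof -
      have "\<sigma> permutes {1..n}" "act \<sigma> (act g t0) = act g t0" using that by (auto simp: K)
      then show ?thesis using lookup_perm_action_act[of \<sigma> "{1..n}" "perm_action g e0" "act g t0"]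
          lookup_perm_action_act[OF g, of e0 t0] lookup_e0 by simp
    qed
    then show ?thesis by (simp add: u_def R_def lookup_sum)
  qed
  have gen: "\<exists>z. R (perm_action h e0) = cscale z u" if h: "h permutes {1..n}" for h
  proof -
    \<comment> \<open>The dichotomy for \<open>inv h \<circ> g\<close> compares the columns of the
      tableau moved by \<open>h\<close> with the rows of the one moved by \<open>g\<close>.\<close>
    have "inv h \<circ> g permutes {1..n}" by (intro permutes_compose permutes_inv g h)
    from dichotomy[OF this] show ?thesis
    proof (elim disjE exE bexE conjE)
      fix a b assume ab: "a \<noteq> b" "transpose a b \<in> C"
        "act (transpose a b) (act (inv h \<circ> g) t0) = act (inv h \<circ> g) t0"
      let ?\<tau> = "h \<circ> transpose a b \<circ> inv h"
      have "act ?\<tau> (act g t0) = act g t0"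
        using ab(3) act_inv[OF h] by (metis act_comp)
      then have \<tau>: "?\<tau> \<in> K" using h C_permutes[OF ab(2)]
        by (auto simp: K intro!: permutes_compose permutes_inv)
      have "perm_action ?\<tau> (perm_action h e0) = perm_action h (perm_action (transpose a b) e0)"
        by (simp add: perm_action_comp perm_action_inv[OF h])
      also have "\<dots> = cscale (- 1) (perm_action h e0)"
        using ab(1) unfolding e0_perm_action[OF ab(2)] perm_action_scale
          by (simp add: sgn_act_def sign_swap_id)
      finally have "R (perm_action h e0) = cscale (- 1) (R (perm_action h e0))"
        by (metis R_K(1)[OF \<tau>] R_lin(2))
      then have "lookup (R (perm_action h e0)) x = - lookup (R (perm_action h e0)) x" for x
        by (metis lookup_cscale mult_minus1)
      then have "R (perm_action h e0) = cscale 0 u" by (intro poly_mapping_eqI) simp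
      then show ?thesis ..
    next
      fix c assume c: "c \<in> C" "act c t0 = act (inv h \<circ> g) t0"
      let ?\<tau> = "h \<circ> c \<circ> inv g"
      have "act ?\<tau> (act g t0) = act g t0"
        using c(2) act_inv[OF h] act_inv[OF g] by (metis act_comp)
      then have \<tau>: "?\<tau> \<in> K" using h g C_permutes[OF c(1)]
        by (auto simp: K intro!: permutes_compose permutes_inv)
      have "perm_action ?\<tau> (perm_action g (perm_action (inv c) e0)) = perm_action h e0"
        by (simp add: perm_action_comp perm_action_inv[OF g] perm_action_inv[OF C_permutes[OF c(1)]])
      then have "R (perm_action h e0) = R (perm_action g (perm_action (inv c) e0))"
        using R_K(1)[OF \<tau>] by metis
      also have "\<dots> = cscale (sgn_act (inv c)) u"
        by (simp add: e0_perm_action[OF C_inv[OF c(1)]] perm_action_scale R_lin u_def)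
      finally show ?thesis ..
    qed
  qed
  define l where "l v = lookup (R v) (act g t0) / of_nat (card K)" for v
  have RW: "R v = cscale (l v) u" if "v \<in> W" for v
  proof -
    have "\<exists>z. R v = cscale z u" using that
    proof (induction rule: W_induct)
      case zero
      show ?case by (rule exI[of _ 0]) (simp add: R_lin)
    next
      case (step z h v)
      then obtain x y where "R (perm_action h e0) = cscale x u" "R v = cscale y u" using gen by blast
      then have "R (cscale z (perm_action h e0) + v) = cscale (z * x + y) u"
        by (simp add: R_lin cvs.scale_left_distrib)
      then show ?case ..
    qed
    then show ?thesis using cK by (auto simp: l_def lu)
  qed
  have "trace_on W R = l u"
    using RW uW by (intro trace_on_rank_one)
      (auto simp: functional_on_def l_def R_lin lookup_add add_divide_distrib)
  also have "\<dots> = of_nat (card K)" using cK by (simp add: l_def Ru lu)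
  finally have "trace_on W (\<lambda>v. \<Sum>\<sigma>\<in>K. cscale 1 (perm_action \<sigma> v)) = of_nat (card K)"
    by (simp flip: R_def)
  moreover have "trace_on W (\<lambda>v. \<Sum>\<sigma>\<in>K. cscale 1 (perm_action \<sigma> v)) = (\<Sum>\<sigma>\<in>K. 1 * chi \<sigma>)"
    by (intro trace_on_sum W_stable) (auto simp: K)
  ultimately show ?thesis by simp
qed

end

section \<open>Young diagrams and tableaux\<close>

lemma part_antimono:
  assumes "1 \<le> i" "i \<le> j"
  shows "part \<nu> j \<le> part \<nu> i"
proof -
  let ?xs = "sorted_list_of_multiset \<nu>"
  show ?thesis
  proof (cases "j - 1 < length (rev ?xs)")
    case True
    then show ?thesis
      using sorted_rev_nth_mono[of "rev ?xs" "i - 1" "j - 1"] assms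
      by (simp add: part_def nth_default_def)
  next
    case False
    then show ?thesis by (simp add: part_def nth_default_def)
  qed
qed

lemma part_eq_0: "size \<nu> < i \<Longrightarrow> part \<nu> i = 0"
proof -
  assume "size \<nu> < i"
  moreover have "length (sorted_list_of_multiset \<nu>) = size \<nu>"
    by (metis mset_sorted_list_of_multiset size_mset)
  ultimately show ?thesis by (simp add: part_def nth_default_def)
qed

lemma cells_Sigma: "cells \<nu> = Sigma {1..size \<nu>} (\<lambda>i. {1..part \<nu> i})"
  using part_eq_0[of \<nu>] by (fastforce simp: cells_def not_less[symmetric])

lemma finite_cells: "finite (cells \<nu>)"
  by (simp add: cells_Sigma)

lemma card_cells: "card (cells \<nu>) = sum_mset \<nu>"
  using sum_part[of \<nu> "size \<nu>"] by (simp add: cells_Sigma)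

lemma tableau_exists: "\<exists>T. tableau \<nu> T"
  using finite_same_card_bij[OF finite_cells, of "{1..sum_mset \<nu>}" \<nu>]
    by (simp add: card_cells tableau_def)

lemma cells_down: "(i, j) \<in> cells \<nu> \<Longrightarrow> 1 \<le> i' \<Longrightarrow> i' \<le> i \<Longrightarrow> (i', j) \<in> cells \<nu>"
  using part_antimono[of i' i \<nu>] by (simp add: cells_def atLeastAtMost_iff)

locale young_tableau =
  fixes \<nu> :: "nat multiset" and T :: "nat \<times> nat \<Rightarrow> nat" and n :: nat
  assumes tab: "tableau \<nu> T" and n_def: "n = sum_mset \<nu>"
begin

text \<open>Facts such as \<open>cell\<close> and \<open>T_cell\<close> have the premise
  \<open>a \<in> {1..n}\<close>, which must not be rewritten into inequalities.\<close>

declare atLeastAtMost_iff [simp del]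

definition rw :: "nat \<Rightarrow> nat" where "rw a = fst (the_inv_into (cells \<nu>) T a)"
definition cl :: "nat \<Rightarrow> nat" where "cl a = snd (the_inv_into (cells \<nu>) T a)"

lemma bijT: "bij_betw T (cells \<nu>) {1..n}"
  using tab by (simp add: tableau_def n_def)

lemma cell: "a \<in> {1..n} \<Longrightarrow> (rw a, cl a) \<in> cells \<nu>"
  using bijT the_inv_into_into[of T "cells \<nu>" a "cells \<nu>"] by (simp add: rw_def cl_def bij_betw_def)

lemma T_cell: "a \<in> {1..n} \<Longrightarrow> T (rw a, cl a) = a"
  using bijT f_the_inv_into_f[of T "cells \<nu>" a] by (simp add: rw_def cl_def bij_betw_def)

lemma T_in: "x \<in> cells \<nu> \<Longrightarrow> T x \<in> {1..n}"
  using bijT bij_betwE by blast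

lemma rw_T [simp]: "(i, j) \<in> cells \<nu> \<Longrightarrow> rw (T (i, j)) = i"
  and cl_T [simp]: "(i, j) \<in> cells \<nu> \<Longrightarrow> cl (T (i, j)) = j"
  using bijT by (simp_all add: rw_def cl_def bij_betw_def the_inv_into_f_f)

lemma rw_cl_inj: "a \<in> {1..n} \<Longrightarrow> b \<in> {1..n} \<Longrightarrow> rw a = rw b \<Longrightarrow> cl a = cl b \<Longrightarrow> a = b"
  using T_cell by metis

lemma row_eq: "{T (i, j) | j. (i, j) \<in> cells \<nu>} = {a \<in> {1..n}. rw a = i}"
  using T_in by (auto) (metis cell T_cell)

lemma column_eq: "{T (i, j) | i. (i, j) \<in> cells \<nu>} = {a \<in> {1..n}. cl a = j}"
  using T_in by (auto) (metis cell T_cell)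

definition t0 :: "nat \<Rightarrow> nat set" where "t0 = tabloid \<nu> T"

lemma t0: "t0 i = {a \<in> {1..n}. rw a = i}"
  unfolding t0_def tabloid_def by (rule row_eq)

lemma act_t0:
  assumes "\<sigma> permutes {1..n}"
  shows "act \<sigma> t0 i = {a \<in> {1..n}. rw (inv \<sigma> a) = i}"
proof -
  have "a \<in> \<sigma> ` {b \<in> {1..n}. rw b = i} \<longleftrightarrow> a \<in> {1..n} \<and> rw (inv \<sigma> a) = i" for a
  proof
    assume "a \<in> {1..n} \<and> rw (inv \<sigma> a) = i"
    then show "a \<in> \<sigma> ` {b \<in> {1..n}. rw b = i}"
      using permutes_in_image[OF permutes_inv[OF assms]]
      by (intro image_eqI[of _ _ "inv \<sigma> a"]) (auto simp: permutes_inverses[OF assms])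
  qed (use permutes_in_image[OF assms] in \<open>auto simp: permutes_inverses[OF assms]\<close>)
  then show ?thesis by (auto simp: act_def t0)
qed

definition C :: "(nat \<Rightarrow> nat) set" where "C = column_stabilizer \<nu> T"

text \<open>A permutation that maps a finite column into itself maps it onto itself, so the setwise
  condition on columns is a condition on single entries.\<close>

lemma C_iff: "c \<in> C \<longleftrightarrow> c permutes {1..n} \<and> (\<forall>a\<in>{1..n}. cl (c a) = cl a)"
proof
  assume c: "c \<in> C"
  have p: "c permutes {1..n}" using c by (simp add: C_def column_stabilizer_def n_def)
  have "cl (c a) = cl a" if "a \<in> {1..n}" for a
  proof -
    have "c ` {b \<in> {1..n}. cl b = cl a} = {b \<in> {1..n}. cl b = cl a}"
      using c unfolding C_def column_stabilizer_def column_eq by blast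
    then show ?thesis using that by blast
  qed
  with p show "c permutes {1..n} \<and> (\<forall>a\<in>{1..n}. cl (c a) = cl a)" by blast
next
  assume c: "c permutes {1..n} \<and> (\<forall>a\<in>{1..n}. cl (c a) = cl a)"
  have "c ` {b \<in> {1..n}. cl b = j} = {b \<in> {1..n}. cl b = j}" for j
  proof (rule card_subset_eq)
    show "c ` {b \<in> {1..n}. cl b = j} \<subseteq> {b \<in> {1..n}. cl b = j}"
      using c permutes_in_image[of c "{1..n}"] by auto
    show "card (c ` {b \<in> {1..n}. cl b = j}) = card {b \<in> {1..n}. cl b = j}"
      using c by (intro card_image) (metis inj_on_subset permutes_inj subset_UNIV)
  qed auto
  then show "c \<in> C" using c unfolding C_def column_stabilizer_def column_eq n_def[symmetric] by blast
qed

subsection \<open>The pigeonhole principle on the columns\<close>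

text \<open>Row lengths weakly decrease downwards, so a column is an initial segment of the rows; an
  empty column has \<open>h = 0\<close>.\<close>

lemma column_height:
  obtains h where "{i. (i, j) \<in> cells \<nu>} = {1..h}"
proof -
  let ?S = "{i. (i, j) \<in> cells \<nu>}"
  have fin: "finite ?S"
    by (rule finite_subset[of _ "{1..size \<nu>}"]) (auto simp: cells_Sigma)
  show ?thesis
  proof (cases "?S = {}")
    case True
    then show ?thesis using that[of 0] by auto
  next
    case False
    define M where "M = Max ?S"
    have M: "(M, j) \<in> cells \<nu>" "\<And>i. (i, j) \<in> cells \<nu> \<Longrightarrow> i \<le> M"
      using Max_in[OF fin False] Max_ge[OF fin] by (auto simp: M_def)
    have "?S = {1..M}"
    proof (intro equalityI subsetI)
      fix i assume "i \<in> {1..M}"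
      then show "i \<in> ?S" using cells_down[OF M(1)] by (simp add: atLeastAtMost_iff)
    next
      fix i assume "i \<in> ?S"
      then show "i \<in> {1..M}" using M(2) by (simp add: cells_def atLeastAtMost_iff)
    qed
    then show ?thesis using that by blast
  qed
qed

lemma card_rows_le: "card {a \<in> {1..n}. rw a \<le> k} = (\<Sum>i = 1..k. part \<nu> i)"
proof -
  have "bij_betw T (Sigma {1..k} (\<lambda>i. {1..part \<nu> i})) {a \<in> {1..n}. rw a \<le> k}"
  proof (rule bij_betw_byWitness[of _ "\<lambda>a. (rw a, cl a)"])
    have S: "Sigma {1..k} (\<lambda>i. {1..part \<nu> i}) = {x \<in> cells \<nu>. fst x \<le> k}"
      by (auto simp: cells_def atLeastAtMost_iff)
    show "T ` Sigma {1..k} (\<lambda>i. {1..part \<nu> i}) \<subseteq> {a \<in> {1..n}. rw a \<le> k}"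
      unfolding S using T_in by (auto)
    show "(\<lambda>a. (rw a, cl a)) ` {a \<in> {1..n}. rw a \<le> k} \<subseteq> Sigma {1..k} (\<lambda>i. {1..part \<nu> i})"
      unfolding S using cell by (auto)
    show "\<forall>x\<in>Sigma {1..k} (\<lambda>i. {1..part \<nu> i}). (rw (T x), cl (T x)) = x"
      unfolding S by auto
  qed (auto simp: T_cell)
  from bij_betw_same_card[OF this] show ?thesis by simp
qed

text \<open>\<open>z a\<close> is the row of \<open>a\<close> in a second filling that has no two
  entries of a column of \<open>T\<close> in one row.\<close>

context
  fixes z :: "nat \<Rightarrow> nat"
  assumes z_pos: "\<And>a. a \<in> {1..n} \<Longrightarrow> 1 \<le> z a"
    and z_inj: "\<And>a b. a \<in> {1..n} \<Longrightarrow> b \<in> {1..n} \<Longrightarrow> cl a = cl b \<Longrightarrow> z a = z b \<Longrightarrow> a = b"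
begin

text \<open>Among the first \<open>k\<close> rows a column of height \<open>h\<close> has
  \<open>min h k\<close> entries, and a positive function injective on the column cannot take more
  values up to \<open>k\<close>.\<close>

lemma card_column_le:
  "card {a \<in> {1..n}. cl a = j \<and> z a \<le> k} \<le> card {a \<in> {1..n}. cl a = j \<and> rw a \<le> k}"
proof -
  obtain h where h: "{i. (i, j) \<in> cells \<nu>} = {1..h}" using column_height .
  let ?col = "{a \<in> {1..n}. cl a = j}"
  have rwcol: "bij_betw rw ?col {1..h}"
    unfolding h[symmetric] by (rule bij_betw_byWitness[of _ "\<lambda>i. T (i, j)"])
      (use T_cell T_in cell in auto)
  have B: "card {a \<in> {1..n}. cl a = j \<and> rw a \<le> k} = min h k"
  proof -
    have "bij_betw rw {a \<in> {1..n}. cl a = j \<and> rw a \<le> k} {1..min h k}"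
    proof (rule bij_betw_subset[OF rwcol, THEN bij_betw_cong[THEN iffD1, rotated]])
      have "{1..min h k} = {1..h} \<inter> {..k}" by auto
      also have "\<dots> = rw ` ?col \<inter> {..k}" using rwcol by (simp add: bij_betw_def)
      finally show "rw ` {a \<in> {1..n}. cl a = j \<and> rw a \<le> k} = {1..min h k}" by auto
    qed auto
    from bij_betw_same_card[OF this] show ?thesis by simp
  qed
  have "card {a \<in> {1..n}. cl a = j \<and> z a \<le> k} \<le> card ?col"
    by (intro card_mono) auto
  also have "\<dots> = h" using bij_betw_same_card[OF rwcol] by simp
  finally have 1: "card {a \<in> {1..n}. cl a = j \<and> z a \<le> k} \<le> h" .
  have "card {a \<in> {1..n}. cl a = j \<and> z a \<le> k} \<le> card {1..k}"
    by (rule card_inj_on_le[of z]) (auto simp: inj_on_def z_pos atLeastAtMost_iff intro: z_inj)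
  then have "card {a \<in> {1..n}. cl a = j \<and> z a \<le> k} \<le> k" by simp
  with 1 show ?thesis unfolding B by (rule min.boundedI)
qed

lemma card_by_columns:
  "card {a \<in> {1..n}. P a} = (\<Sum>j\<in>cl ` {1..n}. card {a \<in> {1..n}. cl a = j \<and> P a})"
proof -
  have "{a \<in> {1..n}. P a} = (\<Union>j\<in>cl ` {1..n}. {a \<in> {1..n}. cl a = j \<and> P a})" by auto
  also have "card \<dots> = (\<Sum>j\<in>cl ` {1..n}. card {a \<in> {1..n}. cl a = j \<and> P a})"
    by (rule card_UN_disjoint) auto
  finally show ?thesis .
qed

text \<open>Summed over the columns: the content of \<open>z\<close> is dominated by
  \<open>\<nu>\<close>.\<close>

lemma pigeonhole: "card {a \<in> {1..n}. z a \<le> k} \<le> (\<Sum>i = 1..k. part \<nu> i)"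
  unfolding card_rows_le[symmetric] card_by_columns[of "\<lambda>a. z a \<le> k"] card_by_columns[of "\<lambda>a. rw a \<le> k"]
  by (intro sum_mono card_column_le)

text \<open>Equal totals force equality in every column. Taking for \<open>k\<close> the height of
  the column of \<open>a\<close> shows that \<open>z\<close> stays within this column.\<close>

lemma pigeonhole_tight:
  assumes eq: "\<And>k. card {a \<in> {1..n}. z a \<le> k} = (\<Sum>i = 1..k. part \<nu> i)" and a: "a \<in> {1..n}"
  shows "(z a, cl a) \<in> cells \<nu>"
proof -
  let ?j = "cl a"
  obtain h where h: "{i. (i, ?j) \<in> cells \<nu>} = {1..h}" using column_height .
  let ?A = "\<lambda>j. {a \<in> {1..n}. cl a = j \<and> z a \<le> h}" and ?B = "\<lambda>j. {a \<in> {1..n}. cl a = j \<and> rw a \<le> h}"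
  have "(\<Sum>j\<in>cl ` {1..n}. card (?A j)) = (\<Sum>j\<in>cl ` {1..n}. card (?B j))"
    using eq[of h] unfolding card_rows_le[symmetric] card_by_columns[of "\<lambda>a.
      z a \<le> h"] card_by_columns[of "\<lambda>a. rw a \<le> h"] .
  then have "card (?A ?j) = card (?B ?j)"
    using sum_mono_inv[of "\<lambda>j. card (?A j)" "cl ` {1..n}" "\<lambda>j. card (?B j)" ?j] card_column_le a by auto
  also have "?B ?j = {a' \<in> {1..n}. cl a' = ?j}"
  proof -
    have "rw a' \<le> h" if "a' \<in> {1..n}" "cl a' = ?j" for a'
      using cell[OF that(1)] h that(2) by (metis (no_types, lifting) mem_Collect_eq atLeastAtMost_iff)
    then show ?thesis by auto
  qed
  finally have "?A ?j = {a' \<in> {1..n}. cl a' = ?j}"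
    by (intro card_subset_eq) auto
  then have "z a \<le> h" using a by blast
  then have "z a \<in> {i. (i, ?j) \<in> cells \<nu>}"
    unfolding h using z_pos[OF a] by (simp add: atLeastAtMost_iff)
  then show ?thesis by simp
qed

end

subsection \<open>The polytabloid module\<close>

lemma transpose_C:
  "a \<in> {1..n} \<Longrightarrow> b \<in> {1..n} \<Longrightarrow> cl a = cl b \<Longrightarrow> transpose a b \<in> C"
  by (auto simp: C_iff permutes_swap_id transpose_def)

sublocale tabloid_rep n t0 C
proof
  show "c permutes {1..n}" if "c \<in> C" for c using that by (simp add: C_iff)
  show "id \<in> C" by (simp add: C_iff permutes_id)
  show "c \<circ> c' \<in> C" if "c \<in> C" "c' \<in> C" for c c'
    using that permutes_in_image[of c' "{1..n}"] by (auto simp: C_iff permutes_compose)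
  show "inv c \<in> C" if "c \<in> C" for c
  proof -
    have p: "c permutes {1..n}" "inv c permutes {1..n}" using that permutes_inv by (auto simp: C_iff)
    have "cl (inv c a) = cl a" if "a \<in> {1..n}" for a
      using \<open>c \<in> C\<close> that permutes_in_image[OF p(2), of a] permutes_inverses(1)[OF p(1), of a]
        unfolding C_iff by metis
    then show ?thesis using p by (simp add: C_iff)
  qed
  show "c = id" if c: "c \<in> C" and "act c t0 = t0" for c
  proof
    fix a
    have p: "c permutes {1..n}" using c by (simp add: C_iff)
    show "c a = id a"
    proof (cases "a \<in> {1..n}")
      case True
      then have ca: "c a \<in> {1..n}" using permutes_in_image[OF p] by blast
      have "c a \<in> act c t0 (rw a)" using True by (auto simp: act_def t0)
      then have "rw (c a) = rw a" using that(2) by (simp add: t0)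
      moreover have "cl (c a) = cl a" using c True by (simp add: C_iff)
      ultimately show ?thesis using rw_cl_inj[OF ca True] by simp
    next
      case False
      then show ?thesis using p by (simp add: permutes_not_in)
    qed
  qed
  show "(\<exists>a b. a \<noteq> b \<and> transpose a b \<in> C \<and> act (transpose a b) (act \<pi> t0) = act \<pi> t0) \<or>
      (\<exists>c\<in>C. act c t0 = act \<pi> t0)" if pi: "\<pi> permutes {1..n}" for \<pi>
  proof (cases "\<exists>a\<in>{1..n}. \<exists>b\<in>{1..n}. a \<noteq> b \<and> cl a = cl b \<and> rw (inv \<pi> a) = rw (inv \<pi> b)")
    case True
    then obtain a b where ab: "a \<in> {1..n}" "b \<in> {1..n}" "a \<noteq> b" "cl a = cl b" "rw (inv \<pi> a) = rw (inv \<pi> b)"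
      by blast
    have "act (transpose a b) (act \<pi> t0) = act \<pi> t0"
    proof
      fix i
      have "rw (inv \<pi> (transpose a b x)) = rw (inv \<pi> x)" for x using ab(5) by (simp add: transpose_def)
      then show "act (transpose a b) (act \<pi> t0) i = act \<pi> t0 i"
        unfolding act_comp[symmetric] act_t0[OF pi] act_t0[OF permutes_compose[OF pi permutes_swap_id[OF ab(1,2)]]]
          permutes_inv_comp[OF permutes_swap_id[OF ab(1,2)] pi]
        by simp
    qed
    then show ?thesis using ab transpose_C by blast
  next
    case False
    define z where "z a = rw (inv \<pi> a)" for a
    have ip: "inv \<pi> permutes {1..n}" using pi by (rule permutes_inv)
    have zpos: "1 \<le> z a" if "a \<in> {1..n}" for a
      using cell[of "inv \<pi> a"] permutes_in_image[OF ip] that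
        by (simp add: z_def cells_def atLeastAtMost_iff)
    have zinj: "a = b" if "a \<in> {1..n}" "b \<in> {1..n}" "cl a = cl b" "z a = z b" for a b
      using False that unfolding z_def by blast
    \<comment> \<open>\<open>inv \<pi>\<close> matches these entries with those in the first
      \<open>k\<close> rows of \<open>T\<close>, so \<open>pigeonhole_tight\<close> applies.\<close>
    have eq: "card {a \<in> {1..n}. z a \<le> k} = (\<Sum>i = 1..k. part \<nu> i)" for k
    proof -
      have "bij_betw (inv \<pi>) {a \<in> {1..n}. z a \<le> k} {a \<in> {1..n}. rw a \<le> k}"
        by (rule bij_betw_byWitness[of _ \<pi>])
          (use permutes_in_image[OF ip] permutes_in_image[OF pi] in
            \<open>auto simp: z_def permutes_inverses[OF pi]\<close>)
      from bij_betw_same_card[OF this] show ?thesis unfolding card_rows_le .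
    qed
    have zcell: "(z a, cl a) \<in> cells \<nu>" if "a \<in> {1..n}" for a
      using pigeonhole_tight[of z, OF zpos zinj eq that] .
    \<comment> \<open>Moves \<open>a\<close> inside its column to the row that \<open>a\<close>
      occupies in \<open>act \<pi> t0\<close>; hence \<open>inv c\<close> carries \<open>t0\<close>
      to \<open>act \<pi> t0\<close>.\<close>
    define c where "c a = (if a \<in> {1..n} then T (z a, cl a) else a)" for a
    have rwc: "rw (c a) = z a" "cl (c a) = cl a" if "a \<in> {1..n}" for a
      using zcell[OF that] that by (auto simp: c_def)
    have "c permutes {1..n}"
    proof (rule inj_imp_permutes)
      show "inj_on c {1..n}" using rwc zinj by (intro inj_onI) metis
      show "c a \<in> {1..n}" if "a \<in> {1..n}" for a using T_in[OF zcell[OF that]] that by (simp add: c_def)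
    qed (auto simp: c_def)
    then have cC: "c \<in> C" using rwc by (simp add: C_iff)
    have ic: "inv c permutes {1..n}" using \<open>c permutes {1..n}\<close> by (rule permutes_inv)
    have "act (inv c) t0 = act \<pi> t0"
      unfolding fun_eq_iff act_t0[OF ic] act_t0[OF pi]
      using rwc permutes_inv_inv[OF \<open>c permutes {1..n}\<close>] by (auto simp: z_def)
    moreover have "inv c \<in> C"
    proof -
      have "cl (inv c a) = cl a" if "a \<in> {1..n}" for a
        using rwc(2)[of "inv c a"] that permutes_in_image[OF ic, of a] permutes_inverses(1)[OF \<open>c permutes {1..n}\<close>, of a]
        by metis
      then show ?thesis using ic by (simp add: C_iff)
    qed
    ultimately show ?thesis by blast
  qed
qed

text \<open>Agreement is asked on the cells only, since a tableau is an arbitrary function off the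
  diagram.\<close>

lemma tabloid_image:
  assumes "\<And>x. x \<in> cells \<nu> \<Longrightarrow> T' x = g (T x)"
  shows "tabloid \<nu> T' = act g t0"
proof
  fix i
  show "tabloid \<nu> T' i = act g t0 i"
    unfolding tabloid_def act_def t0_def using assms by (auto simp: image_iff) metis
qed

lemma column_stabilizer_image:
  assumes g: "g permutes {1..n}" and T': "\<And>x. x \<in> cells \<nu> \<Longrightarrow> T' x = g (T x)"
  shows "column_stabilizer \<nu> T' = (\<lambda>c. g \<circ> c \<circ> inv g) ` C"
proof -
  have col: "{T' (i, j) | i. (i, j) \<in> cells \<nu>} = g ` {T (i, j) | i. (i, j) \<in> cells \<nu>}" for j
    using T' by (auto simp: image_iff) metis
  have gi: "inv g \<circ> g = id" "g \<circ> inv g = id" using permutes_inv_o[OF g] by auto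
  have "\<pi> \<in> column_stabilizer \<nu> T' \<longleftrightarrow> inv g \<circ> \<pi> \<circ> g \<in> C" for \<pi>
  proof -
    have "\<pi> permutes {1..n} \<longleftrightarrow> inv g \<circ> \<pi> \<circ> g permutes {1..n}"
    proof
      assume "\<pi> permutes {1..n}"
      then show "inv g \<circ> \<pi> \<circ> g permutes {1..n}"
        by (intro permutes_compose[OF g] permutes_compose[OF _ permutes_inv[OF g]])
    next
      assume "inv g \<circ> \<pi> \<circ> g permutes {1..n}"
      then have p: "g \<circ> (inv g \<circ> \<pi> \<circ> g) \<circ> inv g permutes {1..n}"
        by (intro permutes_compose[OF permutes_inv[OF g]] permutes_compose[OF _ g])
      have eq: "g \<circ> (inv g \<circ> \<pi> \<circ> g) \<circ> inv g = \<pi>"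
        by (simp add: fun_eq_iff permutes_inverses[OF g])
      show "\<pi> permutes {1..n}" using p unfolding eq .
    qed
    moreover have "\<pi> ` g ` S = g ` S \<longleftrightarrow> (inv g \<circ> \<pi> \<circ> g) ` S = S" for S
    proof -
      have "(inv g \<circ> \<pi> \<circ> g) ` S = inv g ` \<pi> ` g ` S" by (simp add: image_image)
      moreover have "inv g ` g ` S = S" "g ` inv g ` \<pi> ` g ` S = \<pi> ` g ` S"
        by (simp_all add: image_image permutes_inverses[OF g])
      ultimately show ?thesis by metis
    qed
    ultimately show ?thesis
      unfolding column_stabilizer_def C_def n_def[symmetric] col mem_Collect_eq by (simp only:)
  qed
  note iff = this
  show ?thesis
  proof (intro equalityI subsetI)
    fix \<pi> assume "\<pi> \<in> column_stabilizer \<nu> T'"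
    then have "inv g \<circ> \<pi> \<circ> g \<in> C" by (simp add: iff)
    moreover have "\<pi> = g \<circ> (inv g \<circ> \<pi> \<circ> g) \<circ> inv g"
      by (simp add: fun_eq_iff permutes_inverses[OF g])
    ultimately show "\<pi> \<in> (\<lambda>c. g \<circ> c \<circ> inv g) ` C" by blast
  next
    fix \<pi> assume "\<pi> \<in> (\<lambda>c. g \<circ> c \<circ> inv g) ` C"
    then obtain c where c: "c \<in> C" "\<pi> = g \<circ> c \<circ> inv g" by blast
    have "inv g \<circ> \<pi> \<circ> g = c"
      unfolding c(2) by (simp add: fun_eq_iff permutes_inverses[OF g])
    then show "\<pi> \<in> column_stabilizer \<nu> T'" using c iff by simp
  qed
qed

text \<open>Relabelling by \<open>g\<close> conjugates the column group by \<open>g\<close>, which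
  keeps signs.\<close>

lemma polytabloid_image:
  assumes g: "g permutes {1..n}" and T': "\<And>x. x \<in> cells \<nu> \<Longrightarrow> T' x = g (T x)"
  shows "polytabloid \<nu> T' = perm_action g e0"
proof -
  have gi: "inv g \<circ> g = id" using permutes_inv_o[OF g] by auto
  have inj: "inj_on (\<lambda>c. g \<circ> c \<circ> inv g) C"
  proof (rule inj_onI)
    fix c c' assume "g \<circ> c \<circ> inv g = g \<circ> c' \<circ> inv g"
    then have "inv g \<circ> (g \<circ> c \<circ> inv g) \<circ> g = inv g \<circ> (g \<circ> c' \<circ> inv g) \<circ> g" by simp
    moreover have "inv g \<circ> (g \<circ> x \<circ> inv g) \<circ> g = x" for x
      by (simp add: fun_eq_iff permutes_inverses[OF g])
    ultimately show "c = c'" by metis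
  qed
  have "polytabloid \<nu> T' = (\<Sum>c\<in>C. single (tabloid \<nu> (g \<circ> c \<circ> inv g \<circ> T'))
    (of_int (sign (g \<circ> c \<circ> inv g))))"
    unfolding polytabloid_def by (rule sum.reindex_cong[OF inj column_stabilizer_image[OF assms]]) simp_all
  also have "\<dots> = (\<Sum>c\<in>C. single (act (g \<circ> c) t0) (sgn_act c))"
  proof (intro sum.cong refl arg_cong2[of _ _ _ _ single])
    fix c assume c: "c \<in> C"
    show "tabloid \<nu> (g \<circ> c \<circ> inv g \<circ> T') = act (g \<circ> c) t0"
      using T' permutes_inverses[OF g] by (intro tabloid_image) simp
    have cp: "c permutes {1..n}" using c by (simp add: C_iff)
    have "sign (g \<circ> c \<circ> inv g) = sign g * sign c * sign g"
      by (simp add: sign_comp_permutes[OF finite_atLeastAtMost permutes_compose[OF cp g] permutes_inv[OF g]]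
          sign_comp_permutes[OF finite_atLeastAtMost g cp] sign_inv_permutes[OF finite_atLeastAtMost g])
    also have "\<dots> = sign c" using sign_idempotent[of g] by (simp add: mult.commute mult.left_commute)
    finally show "of_int (sign (g \<circ> c \<circ> inv g)) = sgn_act c" by (simp add: sgn_act_def)
  qed
  also have "\<dots> = perm_action g e0"
    by (simp add: e0_def kappa_def perm_action_sum perm_action_single_act act_comp)
  finally show ?thesis .
qed

text \<open>Any two tableaux differ by a permutation of the entries, so the polytabloids are the
  orbit of \<open>e0\<close>.\<close>

lemma specht_module_eq: "specht_module \<nu> = W"
proof -
  have "{polytabloid \<nu> T' | T'. tableau \<nu> T'} = (\<lambda>g. perm_action g e0) ` Sym n"
  proof (intro equalityI subsetI)
    fix v assume "v \<in> {polytabloid \<nu> T' | T'. tableau \<nu> T'}"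
    then obtain T' where T': "tableau \<nu> T'" and v: "v = polytabloid \<nu> T'" by blast
    define g where "g a = (if a \<in> {1..n} then T' (rw a, cl a) else a)" for a
    have b: "bij_betw T' (cells \<nu>) {1..n}" using T' by (simp add: tableau_def n_def)
    have "g permutes {1..n}"
    proof (rule inj_imp_permutes)
      show "inj_on g {1..n}"
      proof (rule inj_onI)
        fix a a' assume a: "a \<in> {1..n}" "a' \<in> {1..n}" "g a = g a'"
        then have "(rw a, cl a) = (rw a', cl a')"
          using inj_onD[OF bij_betw_imp_inj_on[OF b], of "(rw a, cl a)" "(rw a', cl a')"] cell
            by (simp add: g_def)
        then show "a = a'" using rw_cl_inj a by simp
      qed
      show "g a \<in> {1..n}" if "a \<in> {1..n}" for a
        using b cell[OF that] that bij_betwE[OF b] by (simp add: g_def)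
    qed (auto simp: g_def)
    moreover have "T' x = g (T x)" if "x \<in> cells \<nu>" for x
      using that T_in[OF that] by (cases x) (simp add: g_def)
    ultimately show "v \<in> (\<lambda>g. perm_action g e0) ` Sym n" using v polytabloid_image by blast
  next
    fix v assume "v \<in> (\<lambda>g. perm_action g e0) ` Sym n"
    then obtain g where g: "g permutes {1..n}" "v = perm_action g e0" by blast
    then have "v = polytabloid \<nu> (g \<circ> T)" using polytabloid_image[of g "g \<circ> T"] by simp
    moreover have "tableau \<nu> (g \<circ> T)"
      using bij_betw_trans[OF bijT permutes_imp_bij[OF g(1)]] by (simp add: tableau_def n_def)
    ultimately show "v \<in> {polytabloid \<nu> T' | T'. tableau \<nu> T'}" by blast
  qed
  then show ?thesis by (simp add: specht_module_def W_def)
qed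

lemma specht_character_eq: "specht_character \<nu> \<sigma> = chi \<sigma>"
  by (simp add: specht_character_def specht_module_eq)

subsection \<open>Words of a given content\<close>

text \<open>The letters of a word start at 0, the rows of a diagram at 1.\<close>

lemma sum_chi_word_zero:
  assumes "card {a \<in> {1..n}. z a < k} > (\<Sum>i = 1..k. part \<nu> i)"
  shows "(\<Sum>\<sigma> | \<sigma> permutes {1..n} \<and> z \<circ> \<sigma> = z. chi \<sigma>) = 0"
proof (rule sum_chi_zero)
  fix g assume g: "g permutes {1..n}"
  \<comment> \<open>Otherwise the letters, shifted to start at 1, would be injective on columns, and
    \<open>pigeonhole\<close> would bound the number of letters below \<open>k\<close> by the first
    \<open>k\<close> rows.\<close>
  have "\<exists>a\<in>{1..n}. \<exists>b\<in>{1..n}. a \<noteq> b \<and> cl a = cl b \<and> z (g a) = z (g b)"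
  proof (rule ccontr)
    assume neg: "\<not> ?thesis"
    have "card {a \<in> {1..n}. Suc (z (g a)) \<le> k} \<le> (\<Sum>i = 1..k. part \<nu> i)"
      by (rule pigeonhole) (use neg in auto)
    moreover have "bij_betw g {a \<in> {1..n}. Suc (z (g a)) \<le> k} {a \<in> {1..n}. z a < k}"
      by (rule bij_betw_byWitness[of _ "inv g"])
        (use permutes_in_image[OF permutes_inv[OF g]] permutes_in_image[OF g] in
            \<open>auto simp: permutes_inverses[OF g]\<close>)
    ultimately show False using assms bij_betw_same_card by force
  qed
  then obtain a b where ab: "a \<in> {1..n}" "b \<in> {1..n}" "a \<noteq> b" "cl a = cl b" "z (g a) = z (g b)"
    by blast
  have "g a \<noteq> g b" using ab(3) permutes_inj[OF g] by (meson injD)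
  moreover have "transpose (g a) (g b) permutes {1..n}"
    using ab permutes_in_image[OF g] by (intro permutes_swap_id) auto
  moreover have "z \<circ> transpose (g a) (g b) = z" using ab(5) by (auto simp: transpose_def)
  moreover have "inv g \<circ> transpose (g a) (g b) \<circ> g = transpose a b"
    by (auto simp: fun_eq_iff transpose_def permutes_inverses[OF g] dest: injD[OF permutes_inj[OF g]])
  ultimately show "\<exists>a b. a \<noteq> b \<and> transpose a b \<in> {\<sigma>. \<sigma> permutes {1..n} \<and> z \<circ> \<sigma> = z} \<and>
      inv g \<circ> transpose a b \<circ> g \<in> C"
    using transpose_C[OF ab(1,2,4)] by (intro exI[of _ "g a"] exI[of _ "g b"]) simp
qed (auto simp: permutes_compose o_assoc)

text \<open>A word of this content lists the rows of a tabloid \<open>act g t0\<close>, and it has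
  the same stabilizer.\<close>

lemma sum_chi_word_rows:
  assumes cont: "\<And>i. card {a \<in> {1..n}. z a = i} = part \<nu> (Suc i)"
  shows "(\<Sum>\<sigma> | \<sigma> permutes {1..n} \<and> z \<circ> \<sigma> = z. chi \<sigma>) = of_nat (card {\<sigma>. \<sigma> permutes {1..n} \<and> z \<circ> \<sigma> = z})"
proof -
  have "image_mset rw (mset_set {1..n}) = image_mset (\<lambda>a. Suc (z a)) (mset_set {1..n})"
  proof (rule multiset_eqI)
    fix i
    have 1: "card {a \<in> {1..n}. rw a = i} = (if i = 0 then 0 else part \<nu> i)"
    proof (cases i)
      case 0
      then show ?thesis using cell by (force simp: cells_def atLeastAtMost_iff)
    next
      case (Suc k)
      have un: "{a \<in> {1..n}. rw a \<le> Suc k} = {a \<in> {1..n}. rw a \<le> k} \<union> {a \<in> {1..n}. rw a = Suc k}" by auto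
      have "card {a \<in> {1..n}. rw a \<le> Suc k} = card {a \<in> {1..n}. rw a \<le> k} + card {a \<in> {1..n}. rw a = Suc k}"
        unfolding un by (rule card_Un_disjoint) auto
      then show ?thesis unfolding card_rows_le Suc by simp
    qed
    have "count (image_mset rw (mset_set {1..n})) i = card {a \<in> {1..n}. rw a = i}"
      by (simp add: count_image_mset_eq_card_vimage)
    also have "\<dots> = card {a \<in> {1..n}. Suc (z a) = i}"
      unfolding 1 by (cases i) (simp_all add: cont)
    also have "\<dots> = count (image_mset (\<lambda>a. Suc (z a)) (mset_set {1..n})) i"
      by (simp add: count_image_mset_eq_card_vimage)
    finally show "count (image_mset rw (mset_set {1..n})) i = count (image_mset (\<lambda>a. Suc (z a))
      (mset_set {1..n})) i" .
  qed
  from image_mset_eq_implies_permutes[OF finite_atLeastAtMost this]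
  obtain g where g: "g permutes {1..n}" and rg: "\<forall>x\<in>{1..n}. rw x = Suc (z (g x))" by blast
  have "{\<sigma>. \<sigma> permutes {1..n} \<and> z \<circ> \<sigma> = z} = {\<sigma>. \<sigma> permutes {1..n} \<and> act \<sigma> (act g t0) = act g t0}"
  proof (intro Collect_cong conj_cong refl)
    fix \<sigma> assume s: "\<sigma> permutes {1..n}"
    have gi: "rw (inv g a) = Suc (z a)" if "a \<in> {1..n}" for a
      using rg that permutes_in_image[OF permutes_inv[OF g], of a] permutes_inverses(1)[OF g] by metis
    have "act \<sigma> (act g t0) i = {a \<in> {1..n}. Suc (z (inv \<sigma> a)) = i}" for i
      unfolding act_comp[symmetric] act_t0[OF permutes_compose[OF g s]] permutes_inv_comp[OF s g] o_apply
      using gi permutes_in_image[OF permutes_inv[OF s]] by (auto)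
    moreover have "act g t0 i = {a \<in> {1..n}. Suc (z a) = i}" for i
      unfolding act_t0[OF g] using gi by (auto)
    ultimately have "act \<sigma> (act g t0) = act g t0 \<longleftrightarrow>
       (\<forall>i. {a \<in> {1..n}. Suc (z (inv \<sigma> a)) = i} = {a \<in> {1..n}. Suc (z a) = i})"
      by (simp add: fun_eq_iff)
    also have "\<dots> \<longleftrightarrow> (\<forall>a\<in>{1..n}. z (inv \<sigma> a) = z a)" by (fastforce)
    also have "\<dots> \<longleftrightarrow> (\<forall>a\<in>{1..n}. z (\<sigma> a) = z a)"
      using permutes_in_image[OF s] permutes_in_image[OF permutes_inv[OF s]] permutes_inverses[OF s]
        by metis
    also have "\<dots> \<longleftrightarrow> z \<circ> \<sigma> = z"
      using permutes_not_in[OF s] by (fastforce simp: fun_eq_iff)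
    finally show "z \<circ> \<sigma> = z \<longleftrightarrow> act \<sigma> (act g t0) = act g t0" ..
  qed
  from sum_chi_row_stabilizer[OF g this] show ?thesis .
qed

end

section \<open>Alternating sums of numbers of matrices\<close>

text \<open>\<open>\<alpha>\<close> lists the column sums. In a matrix \<open>M j i\<close> the
  column index \<open>j\<close> comes first, because whole columns are removed one at a
  time.\<close>

locale peel =
  fixes m :: nat and \<alpha> :: "nat \<Rightarrow> nat"
begin

text \<open>
  With \<open>\<delta> = (m - 1, \<dots>, 0)\<close> and \<open>\<gamma> = \<nu> + \<delta>\<close>, the row sums \<open>\<gamma> - w \<delta>\<close> are those of the shifted content
  \<open>\<nu>\<^sub>i + w i - i\<close>, and \<open>G\<close> becomes alternating in \<open>\<gamma>\<close>.
\<close>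

definition mats :: "nat \<Rightarrow> (nat \<Rightarrow> nat) \<Rightarrow> (nat \<Rightarrow> nat) \<Rightarrow> (nat \<Rightarrow> nat \<Rightarrow> nat) set" where
  "mats k w \<gamma> = {M. (\<forall>j i. k \<le> j \<or> m \<le> i \<longrightarrow> M j i = 0) \<and> (\<forall>j<k. (\<Sum>i<m. M j i) = \<alpha> j) \<and>
     (\<forall>i<m. (\<Sum>j<k. M j i) + (m - 1 - w i) = \<gamma> i)}"

text \<open>The coefficient of \<open>x^\<gamma>\<close> in the product of the alternant of
  \<open>\<delta>\<close> with the complete symmetric polynomials of degrees
  \<open>\<alpha> 0, \<dots>, \<alpha> (k - 1)\<close>. For strictly decreasing
  \<open>\<gamma>\<close> it is the Kostka number of the shape
  \<open>\<gamma> - \<delta>\<close>.\<close>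

definition G :: "nat \<Rightarrow> (nat \<Rightarrow> nat) \<Rightarrow> int" where
  "G k \<gamma> = (\<Sum>w | w permutes {..<m}. sign w * int (card (mats k w \<gamma>)))"

definition below :: "(nat \<Rightarrow> nat) \<Rightarrow> nat \<Rightarrow> (nat \<Rightarrow> nat) set" where
  "below \<gamma> s = {\<beta>. (\<forall>i\<ge>m. \<beta> i = 0) \<and> (\<forall>i<m. \<beta> i \<le> \<gamma> i) \<and> (\<Sum>i<m. \<beta> i) + s = (\<Sum>i<m. \<gamma> i)}"

lemma finite_bounded_vectors: "finite {\<beta>. (\<forall>i\<ge>m. \<beta> i = 0) \<and> (\<forall>i<m. \<beta> i \<le> (\<gamma> i :: nat))}"
proof (rule finite_subset)
  let ?K = "\<Sum>i<m. \<gamma> i"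
  have le: "\<gamma> i \<le> ?K" if "i < m" for i using that by (intro member_le_sum) auto
  show "{\<beta>. (\<forall>i\<ge>m. \<beta> i = 0) \<and> (\<forall>i<m. \<beta> i \<le> \<gamma> i)} \<subseteq>
      {\<beta>. \<forall>i. (i \<in> {..<m} \<longrightarrow> \<beta> i \<in> {..?K}) \<and> (i \<notin> {..<m} \<longrightarrow> \<beta> i = 0)}"
    using le by (auto simp: not_less intro: le_trans)
  show "finite {\<beta>. \<forall>i. (i \<in> {..<m} \<longrightarrow> \<beta> i \<in> {..?K}) \<and> (i \<notin> {..<m} \<longrightarrow> \<beta> i = 0)}"
    by (rule finite_set_of_finite_funs) auto
qed

lemma finite_below: "finite (below \<gamma> s)"
  by (rule finite_subset[OF _ finite_bounded_vectors[of \<gamma>]]) (auto simp: below_def)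

text \<open>The column taken out is \<open>\<gamma> - \<beta>\<close>, where \<open>\<beta>\<close>
  is the row data of the rest; the truncated subtraction is exact since \<open>\<beta>\<close> is
  below \<open>\<gamma>\<close>.\<close>

lemma mats_Suc:
  "bij_betw (\<lambda>(\<beta>, M). M(k := (\<lambda>i. if i < m then \<gamma> i - \<beta> i else 0))) (Sigma (below \<gamma> (\<alpha> k))
    (mats k w)) (mats (Suc k) w \<gamma>)"
proof -
  define put where "put = (\<lambda>(\<beta>, M). M(k := (\<lambda>i. if i < m then \<gamma> i - \<beta> i else 0 :: nat)))"
  define get where "get M = (\<lambda>i. if i < m then \<gamma> i - M k i else 0, M(k := (\<lambda>_. 0)))" for M :: "nat \<Rightarrow> nat \<Rightarrow> nat"
  have col: "(\<Sum>j<k. (M(k := c)) j i) = (\<Sum>j<k. M j i)" for M :: "nat \<Rightarrow> nat \<Rightarrow> nat" and c i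
    by (intro sum.cong) auto
  have put: "put (\<beta>, M) \<in> mats (Suc k) w \<gamma> \<and> get (put (\<beta>, M)) = (\<beta>, M)"
    if b: "\<beta> \<in> below \<gamma> (\<alpha> k)" and M: "M \<in> mats k w \<beta>" for \<beta> M
  proof -
    have "M k = (\<lambda>_. 0)" using M by (auto simp: mats_def)
    moreover have "(\<lambda>i. if i < m then \<gamma> i - (if i < m then \<gamma> i - \<beta> i else 0) else 0) = \<beta>"
      using b by (auto simp: below_def fun_eq_iff)
    ultimately have "get (put (\<beta>, M)) = (\<beta>, M)"
      by (simp only: get_def put_def prod.case fun_upd_same fun_upd_upd) (simp add: fun_upd_idem)
    moreover have "(\<Sum>i<m. \<gamma> i - \<beta> i) = (\<Sum>i<m. \<gamma> i) - (\<Sum>i<m. \<beta> i)"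
      using b by (intro sum_subtractf_nat) (auto simp: below_def)
    moreover have "(\<Sum>i<m. \<beta> i) + \<alpha> k = (\<Sum>i<m. \<gamma> i)" using b by (simp add: below_def)
    ultimately have "(\<Sum>i<m. \<gamma> i - \<beta> i) = \<alpha> k" by linarith
    note col_sum = this and get_put = \<open>get (put (\<beta>, M)) = (\<beta>, M)\<close>
    have "(\<Sum>j<k. M j i) + (\<gamma> i - \<beta> i) + (m - 1 - w i) = \<gamma> i" if "i < m" for i
    proof -
      have "(\<Sum>j<k. M j i) + (m - 1 - w i) = \<beta> i" "\<beta> i \<le> \<gamma> i"
        using b M that by (simp_all add: mats_def below_def)
      then show ?thesis by linarith
    qed
    then show ?thesis
      using M col_sum get_put by (auto simp: mats_def col less_Suc_eq put_def)
  qed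
  have get: "get M \<in> Sigma (below \<gamma> (\<alpha> k))
    (mats k w) \<and> put (get M) = M" if M: "M \<in> mats (Suc k) w \<gamma>" for M
  proof -
    have e: "(\<Sum>j<k. M j i) + M k i + (m - 1 - w i) = \<gamma> i" if "i < m" for i
      using M that by (simp add: mats_def)
    have le: "M k i \<le> \<gamma> i" if "i < m" for i using e[OF that] by linarith
    have "M k i = 0" if "\<not> i < m" for i using M that by (simp add: mats_def)
    with le have "(\<lambda>i. if i < m then \<gamma> i - (if i < m then \<gamma> i - M k i else 0) else 0) = M k"
      by (auto simp: fun_eq_iff)
    then have 1: "put (get M) = M" by (simp add: get_def put_def)
    have "(\<Sum>i<m. \<gamma> i - M k i) = (\<Sum>i<m. \<gamma> i) - (\<Sum>i<m. M k i)"
      using le by (intro sum_subtractf_nat) auto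
    moreover have "(\<Sum>i<m. M k i) \<le> (\<Sum>i<m. \<gamma> i)" using le by (intro sum_mono) auto
    moreover have "(\<Sum>i<m. M k i) = \<alpha> k" using M by (simp add: mats_def)
    ultimately have 2: "(\<lambda>i. if i < m then \<gamma> i - M k i else 0) \<in> below \<gamma> (\<alpha> k)"
      by (simp add: below_def)
    have "(\<Sum>j<k. M j i) + (m - 1 - w i) = \<gamma> i - M k i" if "i < m" for i
      using e[OF that] by linarith
    then have "M(k := (\<lambda>_. 0)) \<in> mats k w (\<lambda>i. if i < m then \<gamma> i - M k i else 0)"
      using M by (auto simp: mats_def col)
    then show ?thesis using 1 2 by (simp add: get_def)
  qed
  have "bij_betw put (Sigma (below \<gamma> (\<alpha> k)) (mats k w)) (mats (Suc k) w \<gamma>)"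
    by (rule bij_betw_byWitness[of _ get]) (use put get in blast)+
  then show ?thesis by (simp add: put_def)
qed

lemma mats_0: "mats 0 w \<gamma> = (if \<forall>i<m. m - 1 - w i = \<gamma> i then {\<lambda>_ _. 0} else {})"
  by (auto simp: mats_def fun_eq_iff)

lemma finite_mats: "finite (mats k w \<gamma>)"
proof (induction k arbitrary: \<gamma>)
  case (Suc k)
  then show ?case using bij_betw_finite[OF mats_Suc[of k \<gamma> w]] by (simp add: finite_below)
qed (simp add: mats_0)

lemma G_Suc: "G (Suc k) \<gamma> = (\<Sum>\<beta>\<in>below \<gamma> (\<alpha> k). G k \<beta>)"
proof -
  have "card (mats (Suc k) w \<gamma>) = (\<Sum>\<beta>\<in>below \<gamma> (\<alpha> k). card (mats k w \<beta>))" for w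
    unfolding bij_betw_same_card[OF mats_Suc, symmetric]
    by (rule card_SigmaI) (auto simp: finite_below finite_mats)
  then have "G (Suc k) \<gamma> = (\<Sum>w | w permutes {..<m}. \<Sum>\<beta>\<in>below \<gamma> (\<alpha> k). sign w * int (card (mats k w \<beta>)))"
    by (simp add: G_def sum_distrib_left)
  also have "\<dots> = (\<Sum>\<beta>\<in>below \<gamma> (\<alpha> k). G k \<beta>)"
    by (subst sum.swap) (simp add: G_def)
  finally show ?thesis .
qed

lemma G_0: "G 0 \<gamma> = (\<Sum>w | w permutes {..<m}. if \<forall>i<m. m - 1 - w i = \<gamma> i then sign w else 0)"
  by (auto simp: G_def mats_0 intro!: sum.cong)

lemma sum_swap_entries:
  assumes "Suc i < m"
  shows "(\<Sum>j<m. \<beta> (transpose i (Suc i) j)) = (\<Sum>j<m. \<beta> j :: nat)"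
  using assms by (intro sum.reindex_bij_witness[of _ "transpose i (Suc i)" "transpose i (Suc i)"])
    (auto simp: transpose_def)

text \<open>The alternant changes sign under a swap of neighbours, and \<open>below\<close> is
  compatible with the swap, so the sign passes through every removed column.\<close>

lemma G_swap:
  assumes i: "Suc i < m"
  shows "G k (\<gamma> \<circ> transpose i (Suc i)) = - G k \<gamma>"
proof (induction k arbitrary: \<gamma>)
  let ?t = "transpose i (Suc i)"
  case 0
  have t: "?t permutes {..<m}" using i by (intro permutes_swap_id) auto
  have "G 0 (\<gamma> \<circ> ?t) = (\<Sum>w | w permutes {..<m}. if \<forall>j<m. m - 1 - (w \<circ> ?t) j = (\<gamma> \<circ> ?t) j then sign (w \<circ> ?t) else 0)"
    unfolding G_0 by (rule sum_permutations_compose_right[OF t])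
  also have "\<dots> = (\<Sum>w | w permutes {..<m}. - (if \<forall>j<m. m - 1 - w j = \<gamma> j then sign w else 0))"
  proof (intro sum.cong refl)
    fix w assume "w \<in> {w. w permutes {..<m}}"
    then have s: "sign (w \<circ> ?t) = - sign w"
      using t by (simp add: sign_compose permutes_imp_permutation[of "{..<m}"] sign_swap_id)
    have "(\<forall>j<m. m - 1 - (w \<circ> ?t) j = (\<gamma> \<circ> ?t) j) \<longleftrightarrow> (\<forall>j<m. m - 1 - w j = \<gamma> j)"
    proof -
      have "(\<forall>j\<in>{..<m}. m - 1 - w (?t j) = \<gamma> (?t j)) \<longleftrightarrow> (\<forall>j\<in>?t ` {..<m}. m - 1 - w j = \<gamma> j)" by blast
      then show ?thesis unfolding permutes_image[OF t] by auto
    qed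
    then show "(if \<forall>j<m. m - 1 - (w \<circ> ?t) j = (\<gamma> \<circ> ?t) j then sign (w \<circ> ?t) else 0) =
        - (if \<forall>j<m. m - 1 - w j = \<gamma> j then sign w else 0)" by (simp add: s del: o_apply)
  qed
  also have "\<dots> = - G 0 \<gamma>" by (simp add: G_0 sum_negf)
  finally show ?case .
next
  let ?t = "transpose i (Suc i)"
  case (Suc k)
  have b: "\<beta> \<circ> ?t \<in> below (\<gamma> \<circ> ?t) s" if "\<beta> \<in> below \<gamma> s" for \<beta> \<gamma> s
    using that i sum_swap_entries[OF i] unfolding below_def by (auto simp: transpose_def)
  have "G (Suc k) (\<gamma> \<circ> ?t) = (\<Sum>\<beta>\<in>below (\<gamma> \<circ> ?t) (\<alpha> k). G k \<beta>)" by (rule G_Suc)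
  also have "\<dots> = (\<Sum>\<beta>\<in>below \<gamma> (\<alpha> k). G k (\<beta> \<circ> ?t))"
    using b[of _ \<gamma>] b[of _ "\<gamma> \<circ> ?t"]
    by (intro sum.reindex_bij_witness[of _ "\<lambda>\<beta>. \<beta> \<circ> ?t" "\<lambda>\<beta>. \<beta> \<circ> ?t"]) (auto simp: o_assoc[symmetric])
  also have "\<dots> = - G (Suc k) \<gamma>" by (simp add: Suc.IH sum_negf G_Suc)
  finally show ?case .
qed

definition sdec :: "(nat \<Rightarrow> nat) \<Rightarrow> bool" where
  "sdec \<gamma> \<longleftrightarrow> (\<forall>i. Suc i < m \<longrightarrow> \<gamma> (Suc i) < \<gamma> i)"

text \<open>For \<open>\<lambda> = \<gamma> - \<delta>\<close> and
  \<open>\<mu> = \<beta> - \<delta>\<close> this reads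
  \<open>\<lambda> (Suc i) \<le> \<mu> i \<le> \<lambda> i\<close>: the removed cells form a
  horizontal strip.\<close>

definition good :: "(nat \<Rightarrow> nat) \<Rightarrow> nat \<Rightarrow> (nat \<Rightarrow> nat) set" where
  "good \<gamma> s = {\<beta> \<in> below \<gamma> s. \<forall>i. Suc i < m \<longrightarrow> \<gamma> (Suc i) < \<beta> i}"

text \<open>Pieri's rule: swapping the entries at the first position that violates the interlacing
  condition is a sign-reversing involution.\<close>

lemma pieri:
  assumes "sdec \<gamma>"
  shows "G (Suc k) \<gamma> = (\<Sum>\<beta>\<in>good \<gamma> (\<alpha> k). G k \<beta>)"
proof -
  define bad where "bad = below \<gamma> (\<alpha> k) - good \<gamma> (\<alpha> k)"
  define P where "P \<beta> i \<longleftrightarrow> Suc i < m \<and> \<beta> i \<le> \<gamma> (Suc i)" for \<beta> i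
  define f where "f \<beta> = (LEAST i. P \<beta> i)" for \<beta>
  define \<phi> where "\<phi> \<beta> = \<beta> \<circ> transpose (f \<beta>) (Suc (f \<beta>))" for \<beta> :: "nat \<Rightarrow> nat"
  have Pf: "P \<beta> (f \<beta>)" if "\<beta> \<in> bad" for \<beta>
  proof -
    have "\<exists>i. P \<beta> i" using that by (auto simp: bad_def good_def P_def not_less)
    then show ?thesis unfolding f_def by (rule LeastI_ex)
  qed
  have main: "\<phi> \<beta> \<in> bad \<and> \<phi> (\<phi> \<beta>) = \<beta> \<and> G k (\<phi> \<beta>) = - G k \<beta>" if b: "\<beta> \<in> bad" for \<beta>
  proof -
    let ?i = "f \<beta>"
    let ?t = "transpose ?i (Suc ?i)"
    have i: "Suc ?i < m" "\<beta> ?i \<le> \<gamma> (Suc ?i)" using Pf[OF b] by (auto simp: P_def)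
    have bel: "\<beta> \<in> below \<gamma> (\<alpha> k)" using b by (simp add: bad_def)
    have dec: "\<gamma> (Suc ?i) < \<gamma> ?i" using assms i by (simp add: sdec_def)
    have le: "\<beta> (Suc ?i) \<le> \<gamma> (Suc ?i)" using bel i by (simp add: below_def)
    \<comment> \<open>Both entries to be swapped are at most \<open>\<gamma> (Suc ?i)\<close>, so
      either fits at either place.\<close>
    have bel': "\<phi> \<beta> \<in> below \<gamma> (\<alpha> k)"
      using bel i le dec sum_swap_entries[OF i(1), of \<beta>] unfolding below_def \<phi>_def
      by (auto simp: transpose_def)
    have Pi: "P (\<phi> \<beta>) ?i" using i le by (simp add: P_def \<phi>_def)
    \<comment> \<open>\<open>P\<close> at a position reads only that entry of
      \<open>\<beta>\<close>, so earlier positions are unaffected and \<open>?i\<close> remains the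
      first violation.\<close>
    have less: "\<not> P (\<phi> \<beta>) i" if "i < ?i" for i
      using not_less_Least[of i "P \<beta>"] that unfolding f_def[symmetric]
        by (simp add: P_def \<phi>_def transpose_def)
    have "f (\<phi> \<beta>) = ?i"
      unfolding f_def[of "\<phi> \<beta>"] using Pi less by (intro Least_equality) (auto simp: not_less[symmetric])
    then have "\<phi> (\<phi> \<beta>) = \<phi> \<beta> \<circ> ?t" unfolding \<phi>_def[of "\<phi> \<beta>"] by simp
    also have "\<dots> = \<beta>" by (simp add: \<phi>_def o_assoc[symmetric])
    finally have "\<phi> (\<phi> \<beta>) = \<beta>" .
    moreover have "\<phi> \<beta> \<in> bad"
      using bel' Pi by (auto simp: bad_def good_def P_def not_less[symmetric])
    moreover have "G k (\<phi> \<beta>) = - G k \<beta>" unfolding \<phi>_def by (rule G_swap[OF i(1)])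
    ultimately show ?thesis by blast
  qed
  have "(\<Sum>\<beta>\<in>bad. G k \<beta>) = (\<Sum>\<beta>\<in>bad. G k (\<phi> \<beta>))"
    using main by (intro sum.reindex_bij_witness[of _ \<phi> \<phi>]) auto
  also have "\<dots> = - (\<Sum>\<beta>\<in>bad. G k \<beta>)" using main by (simp add: sum_negf)
  finally have 0: "(\<Sum>\<beta>\<in>bad. G k \<beta>) = 0" by simp
  have "good \<gamma> (\<alpha> k) \<subseteq> below \<gamma> (\<alpha> k)" by (auto simp: good_def)
  from sum.subset_diff[OF this finite_below, of "G k"] show ?thesis
    unfolding G_Suc bad_def[symmetric] 0 by simp
qed

lemma good_sdec: "\<beta> \<in> good \<gamma> s \<Longrightarrow> sdec \<beta>"
  unfolding good_def below_def sdec_def by (auto intro: le_less_trans)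

lemma sdec_ge: "sdec \<gamma> \<Longrightarrow> i < m \<Longrightarrow> m - 1 - i \<le> \<gamma> i"
proof (induction "m - 1 - i" arbitrary: i)
  case (Suc x)
  then have "m - 1 - Suc i \<le> \<gamma> (Suc i)" by (intro Suc.hyps(1)) auto
  moreover have "\<gamma> (Suc i) < \<gamma> i" using Suc by (auto simp: sdec_def)
  ultimately show ?case by linarith
qed auto

text \<open>A horizontal strip adds at most one row, so after \<open>k\<close> columns the shape
  \<open>\<gamma> - \<delta>\<close> has at most \<open>k\<close> rows; its size is the sum of the
  columns.\<close>

lemma G_support:
  assumes "sdec \<gamma>" "G k \<gamma> \<noteq> 0"
  shows "(\<forall>i. k \<le> i \<longrightarrow> i < m \<longrightarrow> \<gamma> i = m - 1 - i) \<and>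
    (\<Sum>i<m. \<gamma> i) = (\<Sum>i<m. m - 1 - i) + (\<Sum>j<k. \<alpha> j)"
  using assms
proof (induction k arbitrary: \<gamma>)
  case 0
  have "\<exists>w. w permutes {..<m} \<and> (\<forall>i<m. m - 1 - w i = \<gamma> i)"
  proof (rule ccontr)
    assume "\<not> ?thesis"
    then have "G 0 \<gamma> = 0" unfolding G_0 by (intro sum.neutral) auto
    then show False using 0 by simp
  qed
  then obtain w where w: "w permutes {..<m}" "\<forall>i<m. m - 1 - w i = \<gamma> i" by blast
  have "(\<Sum>i<m. \<gamma> i) = (\<Sum>i<m. m - 1 - w i)" using w by simp
  also have "\<dots> = (\<Sum>i<m. m - 1 - i)"
    using sum.permute[OF w(1), of "\<lambda>i. m - 1 - i"] by (simp add: o_def)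
  finally have s: "(\<Sum>i<m. \<gamma> i) = (\<Sum>i<m. m - 1 - i)" .
  \<comment> \<open>A strictly decreasing vector is at least \<open>\<delta>\<close> entrywise, so
    equal sums force equality.\<close>
  have e: "m - 1 - i = \<gamma> i" if "i < m" for i
    by (rule sum_mono_inv[OF s[symmetric]]) (use sdec_ge[OF 0(1)] that in auto)
  show ?case by (intro conjI allI impI) (simp_all only: e s, simp)
next
  case (Suc k)
  from Suc.prems(2) obtain \<beta> where b: "\<beta> \<in> good \<gamma> (\<alpha> k)" "G k \<beta> \<noteq> 0"
    unfolding pieri[OF Suc.prems(1)] by (metis sum.neutral)
  from Suc.IH[OF good_sdec[OF b(1)] b(2)]
  have IH: "\<And>i. k \<le> i \<Longrightarrow> i < m \<Longrightarrow> \<beta> i = m - 1 - i"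
    "(\<Sum>i<m. \<beta> i) = (\<Sum>i<m. m - 1 - i) + (\<Sum>j<k. \<alpha> j)" by auto
  have "\<gamma> i = m - 1 - i" if i: "Suc k \<le> i" "i < m" for i
  proof -
    obtain j where j: "i = Suc j" using i by (cases i) auto
    have "\<gamma> (Suc j) < \<beta> j" using b(1) i by (simp add: good_def j)
    then have "\<gamma> i < m - i" using IH(1)[of j] i by (simp add: j)
    then show ?thesis using sdec_ge[OF Suc.prems(1), of i] i by linarith
  qed
  moreover have "(\<Sum>i<m. \<gamma> i) = (\<Sum>i<m. \<beta> i) + \<alpha> k" using b(1) by (simp add: good_def below_def)
  ultimately show ?case using IH(2) by simp
qed

text \<open>The shape dominates the content. For \<open>t = k\<close> all cells lie in the first
  \<open>k\<close> rows; for \<open>t < k\<close> removing the last column can only shorten the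
  first \<open>t\<close> rows.\<close>

lemma G_dominance:
  assumes "sdec \<gamma>" "G k \<gamma> \<noteq> 0" "t \<le> k" "t \<le> m"
  shows "(\<Sum>j<t. \<alpha> j) + (\<Sum>i<t. m - 1 - i) \<le> (\<Sum>i<t. \<gamma> i)"
  using assms
proof (induction k arbitrary: \<gamma>)
  case (Suc k)
  show ?case
  proof (cases "t = Suc k")
    case True
    from G_support[OF Suc.prems(1,2)]
    have s: "\<And>i. t \<le> i \<Longrightarrow> i < m \<Longrightarrow> \<gamma> i = m - 1 - i"
      "(\<Sum>i<m. \<gamma> i) = (\<Sum>i<m. m - 1 - i) + (\<Sum>j<t. \<alpha> j)" by (auto simp: True)
    have split: "(\<Sum>i<m. h i) = (\<Sum>i<t. h i) + (\<Sum>i = t..<m. h i)" for h :: "nat \<Rightarrow> nat"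
      using sum.atLeastLessThan_concat[of 0 t m h] Suc.prems(4) by (simp add: atLeast0LessThan)
    have "(\<Sum>i = t..<m. \<gamma> i) = (\<Sum>i = t..<m. m - 1 - i)" using s(1) by (intro sum.cong) auto
    then show ?thesis using s(2) unfolding split by simp
  next
    case False
    from Suc.prems(2) obtain \<beta> where b: "\<beta> \<in> good \<gamma> (\<alpha> k)" "G k \<beta> \<noteq> 0"
      unfolding pieri[OF Suc.prems(1)] by (metis sum.neutral)
    have "(\<Sum>j<t. \<alpha> j) + (\<Sum>i<t. m - 1 - i) \<le> (\<Sum>i<t. \<beta> i)"
      using Suc.prems False by (intro Suc.IH[OF good_sdec[OF b(1)] b(2)]) auto
    also have "\<dots> \<le> (\<Sum>i<t. \<gamma> i)"
      using b(1) Suc.prems(4) by (intro sum_mono) (auto simp: good_def below_def)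
    finally show ?thesis .
  qed
qed simp

text \<open>The Kostka number of a shape with itself as content: what is left after the last column
  has one row less, fits under the truncated shape in each row and has the same size, hence equals
  it.\<close>

lemma G_truncation:
  assumes anti: "\<And>i. Suc i < m \<Longrightarrow> \<alpha> (Suc i) \<le> \<alpha> i" and "k \<le> m"
  shows "G k (\<lambda>i. if i < m then (if i < k then \<alpha> i else 0) + (m - 1 - i) else 0) = 1"
  using assms(2)
proof (induction k)
  case 0
  have "w = id" if w: "w permutes {..<m}" and "\<forall>i<m. m - 1 - w i = m - 1 - i" for w
  proof
    fix i
    show "w i = id i"
    proof (cases "i < m")
      case True
      then have "w i < m" using permutes_in_image[OF w] by auto
      moreover have "m - 1 - w i = m - 1 - i" using that(2) True by blast
      ultimately show ?thesis using True by simp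
    next
      case False
      then show ?thesis using permutes_not_in[OF w] by auto
    qed
  qed
  then have "(if \<forall>i<m. m - 1 - w i = (if i < m then (if i < 0 then \<alpha> i else 0) + (m - 1 - i) else 0)
      then sign w else 0) = (if w = id then 1 else 0)" if "w permutes {..<m}" for w
    using that by (auto simp: sign_id)
  then show ?case unfolding G_0 by (simp add: permutes_id finite_permutations)
next
  case (Suc k)
  let ?\<gamma> = "\<lambda>k i. if i < m then (if i < k then \<alpha> i else 0) + (m - 1 - i) else 0"
  have sd: "sdec (?\<gamma> (Suc k))"
    unfolding sdec_def
  proof safe
    fix i assume i: "Suc i < m"
    then have "\<alpha> (Suc i) \<le> \<alpha> i" by (rule anti)
    then show "?\<gamma> (Suc k) (Suc i) < ?\<gamma> (Suc k) i" using i by auto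
  qed
  have sum: "(\<Sum>i<m. ?\<gamma> k i) + \<alpha> k = (\<Sum>i<m. ?\<gamma> (Suc k) i)"
  proof -
    have "(\<Sum>i<m. ?\<gamma> (Suc k) i) = (\<Sum>i<m. ?\<gamma> k i + (if i = k then \<alpha> k else 0))"
      by (intro sum.cong) auto
    also have "\<dots> = (\<Sum>i<m. ?\<gamma> k i) + \<alpha> k"
      by (subst sum.distrib) (use Suc.prems in simp)
    finally show ?thesis ..
  qed
  have "?\<gamma> k \<in> good (?\<gamma> (Suc k)) (\<alpha> k)"
  proof -
    have "?\<gamma> (Suc k) (Suc i) < ?\<gamma> k i" if i: "Suc i < m" for i
      using anti[OF i] i by auto
    then show ?thesis using sum by (auto simp: good_def below_def)
  qed
  moreover have "\<beta> = ?\<gamma> k" if b: "\<beta> \<in> good (?\<gamma> (Suc k)) (\<alpha> k)" "G k \<beta> \<noteq> 0" for \<beta>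
  proof -
    have le: "\<beta> i \<le> ?\<gamma> (Suc k) i" if "i < m" for i using b(1) that by (simp add: good_def below_def)
    have z: "\<beta> i = 0" if "\<not> i < m" for i using b(1) that by (simp add: good_def below_def)
    have bs: "\<beta> i = m - 1 - i" if "k \<le> i" "i < m" for i
      using G_support[OF good_sdec[OF b(1)] b(2)] that by blast
    have le': "\<beta> i \<le> ?\<gamma> k i" if "i < m" for i
      using le[OF that] bs[of i] that by (cases "i < k") auto
    have "(\<Sum>i<m. \<beta> i) + \<alpha> k = (\<Sum>i<m. ?\<gamma> (Suc k) i)" using b(1) by (simp add: good_def below_def)
    then have s: "(\<Sum>i<m. \<beta> i) = (\<Sum>i<m. ?\<gamma> k i)" using sum by linarith
    have "\<beta> i = ?\<gamma> k i" if "i < m" for i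
      by (rule sum_mono_inv[OF s]) (use le' that in auto)
    then show ?thesis using z by (auto simp: fun_eq_iff)
  qed
  ultimately have "(\<Sum>\<beta>\<in>good (?\<gamma> (Suc k)) (\<alpha> k). G k \<beta>) = (\<Sum>\<beta>\<in>{?\<gamma> k}. G k \<beta>)"
    by (intro sum.mono_neutral_right) (auto simp: good_def finite_below)
  then show ?case unfolding pieri[OF sd] using Suc by simp
qed

end

section \<open>Words and their contents\<close>

definition cnt :: "nat \<Rightarrow> (nat \<Rightarrow> 'a) \<Rightarrow> 'a \<Rightarrow> nat" where
  "cnt n z i = card {a \<in> {1..n}. z a = i}"

definition contents :: "nat \<Rightarrow> 'a set \<Rightarrow> ('a \<Rightarrow> nat) set" where
  "contents n A = {M. (\<forall>i. i \<notin> A \<longrightarrow> M i = 0) \<and> sum M A = n}"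

lemma finite_contents: "finite A \<Longrightarrow> finite (contents n A)"
proof (rule finite_subset)
  assume A: "finite A"
  show "contents n A \<subseteq> {M. \<forall>i. (i \<in> A \<longrightarrow> M i \<in> {..n}) \<and> (i \<notin> A \<longrightarrow> M i = 0)}"
    using A by (auto simp: contents_def intro: member_le_sum)
  show "finite {M. \<forall>i. (i \<in> A \<longrightarrow> M i \<in> {..n}) \<and> (i \<notin> A \<longrightarrow> M i = (0::nat))}"
    by (rule finite_set_of_finite_funs) (use A in auto)
qed

lemma cnt_contents:
  assumes "finite A" "z \<in> {1..n} \<rightarrow>\<^sub>E A"
  shows "cnt n z \<in> contents n A"
proof -
  have "(\<Sum>i\<in>A. cnt n z i) = card (\<Union>i\<in>A. {a \<in> {1..n}. z a = i})"
    unfolding cnt_def by (rule card_UN_disjoint[symmetric]) (use assms in auto)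
  also have "(\<Union>i\<in>A. {a \<in> {1..n}. z a = i}) = {1..n}" using assms(2) by (auto simp: PiE_def Pi_def)
  finally have "(\<Sum>i\<in>A. cnt n z i) = n" by simp
  moreover have "cnt n z i = 0" if "i \<notin> A" for i
    using assms(2) that by (auto simp: cnt_def PiE_def Pi_def)
  ultimately show ?thesis by (simp add: contents_def)
qed

lemma word_with_content:
  assumes "finite A" "M \<in> contents n A"
  shows "\<exists>z\<in>{1..n} \<rightarrow>\<^sub>E A. cnt n z = M"
proof -
  define X where "X = (\<Sum>i\<in>A. replicate_mset (M i) i)"
  have cX: "count X i = M i" for i
    using assms by (cases "i \<in> A") (auto simp: X_def count_sum contents_def)
  have "size (\<Sum>i\<in>A. replicate_mset (M i) i) = (\<Sum>i\<in>A. M i)"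
    by (induction A rule: infinite_finite_induct) auto
  then have "size X = n" using assms by (simp add: X_def contents_def)
  obtain xs where xs: "mset xs = X" using ex_mset by blast
  have len: "length xs = n" using \<open>size X = n\<close> by (simp flip: xs)
  define z where "z a = (if a \<in> {1..n} then xs ! (a - 1) else undefined)" for a
  have cz: "cnt n z i = M i" for i
  proof -
    have zS: "z (Suc j) = xs ! j" if "j < n" for j using that by (simp add: z_def)
    have "bij_betw Suc {j. j < length xs \<and> xs ! j = i} {a \<in> {1..n}. z a = i}"
    proof (rule bij_betw_byWitness[of _ "\<lambda>a. a - 1"])
      show "(\<lambda>a. a - 1) ` {a \<in> {1..n}. z a = i} \<subseteq> {j. j < length xs \<and> xs ! j = i}"
      proof safe
        fix a assume "a \<in> {1..n}" "i = z a"
        then obtain j where "a = Suc j" "j < n" by (cases a) auto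
        then show "a - 1 < length xs" "xs ! (a - 1) = z a" using zS len by auto
      qed
    qed (auto simp: len zS)
    from bij_betw_same_card[OF this] have "cnt n z i = count (mset xs) i"
      by (simp add: cnt_def count_mset count_list_eq_length_filter length_filter_conv_card eq_commute[of i])
    then show ?thesis by (simp add: xs cX)
  qed
  have "z \<in> {1..n} \<rightarrow>\<^sub>E A"
  proof -
    have "z a \<in> A" if "a \<in> {1..n}" for a
    proof (rule ccontr)
      assume "z a \<notin> A"
      then have "cnt n z (z a) = 0" using assms by (simp add: cz contents_def)
      then show False using that by (auto simp: cnt_def)
    qed
    then show ?thesis by (auto simp: z_def)
  qed
  then show ?thesis using cz by (auto simp: fun_eq_iff)
qed

lemma finite_Sym: "finite (Sym n)"
  by (simp add: finite_permutations)

lemma comp_word: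
  assumes "z \<in> {1..n} \<rightarrow>\<^sub>E A" "\<sigma> permutes {1..n}"
  shows "z \<circ> \<sigma> \<in> {1..n} \<rightarrow>\<^sub>E A" "cnt n (z \<circ> \<sigma>) = cnt n z"
proof -
  show "z \<circ> \<sigma> \<in> {1..n} \<rightarrow>\<^sub>E A"
    using assms permutes_in_image[OF assms(2)] permutes_not_in[OF assms(2)]
    by (fastforce simp: PiE_iff extensional_def)
  have "bij_betw \<sigma> {a \<in> {1..n}. (z \<circ> \<sigma>) a = i} {a \<in> {1..n}. z a = i}" for i
    by (rule bij_betw_byWitness[of _ "inv \<sigma>"])
      (use permutes_in_image[OF assms(2)] permutes_in_image[OF permutes_inv[OF assms(2)]] in
        \<open>auto simp: permutes_inverses[OF assms(2)] simp del: atLeastAtMost_iff\<close>)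
  then show "cnt n (z \<circ> \<sigma>) = cnt n z"
    by (auto simp: cnt_def fun_eq_iff dest: bij_betw_same_card)
qed

lemma same_content_permute:
  fixes z z' :: "nat \<Rightarrow> 'b"
  assumes z: "z \<in> {1..n} \<rightarrow>\<^sub>E A" "z' \<in> {1..n} \<rightarrow>\<^sub>E A" and eq: "cnt n z = cnt n z'"
  shows "\<exists>\<tau>\<in>Sym n. z' = z \<circ> \<tau>"
proof -
  have "image_mset z' (mset_set {1..n}) = image_mset z (mset_set {1..n})"
  proof (rule multiset_eqI)
    fix i
    have "count (image_mset f (mset_set {1..n})) i = cnt n f i" for f :: "nat \<Rightarrow> 'b"
      by (simp add: count_image_mset_eq_card_vimage cnt_def del: atLeastAtMost_iff)
    then show "count (image_mset z' (mset_set {1..n})) i = count (image_mset z (mset_set {1..n})) i"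
      by (simp add: eq)
  qed
  from image_mset_eq_implies_permutes[OF finite_atLeastAtMost this]
  obtain \<tau> where t: "\<tau> permutes {1..n}" "\<forall>a\<in>{1..n}. z' a = z (\<tau> a)" by blast
  have "z' = z \<circ> \<tau>"
  proof
    fix a
    show "z' a = (z \<circ> \<tau>) a"
    proof (cases "a \<in> {1..n}")
      case True
      then show ?thesis using t by simp
    next
      case False
      then show ?thesis using z permutes_not_in[OF t(1) False] by (simp add: PiE_iff extensional_def)
    qed
  qed
  then show ?thesis using t by blast
qed

lemma finite_words: "finite A \<Longrightarrow> finite ({1..n::nat} \<rightarrow>\<^sub>E A)"
  by (rule finite_PiE) auto

lemma sum_shift_Suc: "(\<Sum>i = 1..m. f i) = (\<Sum>i<m. f (Suc i))"
  by (rule sum.reindex_bij_witness[of _ Suc "\<lambda>i. i - 1"]) auto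

text \<open>The words of content \<open>M\<close> form one orbit. Each stabilizer has the size of
  the set of \<open>\<sigma>\<close> with \<open>z0 \<circ> \<sigma> = z\<close>, and these sets
  partition \<open>Sym n\<close>.\<close>

lemma sum_stabilizers:
  assumes A: "finite A" and M: "M \<in> contents n A"
  shows "(\<Sum>z | z \<in> {1..n} \<rightarrow>\<^sub>E A \<and> cnt n z = M. card {\<sigma> \<in> Sym n. z \<circ> \<sigma> = z}) = fact n"
proof -
  obtain z0 where z0: "z0 \<in> {1..n} \<rightarrow>\<^sub>E A" "cnt n z0 = M" using word_with_content[OF assms] by blast
  let ?Z = "{z \<in> {1..n} \<rightarrow>\<^sub>E A. cnt n z = M}"
  have finZ: "finite ?Z" using finite_words[OF A] by simp
  have "card {\<sigma> \<in> Sym n. z \<circ> \<sigma> = z} = card {\<sigma> \<in> Sym n. z0 \<circ> \<sigma> = z}" if z: "z \<in> ?Z" for z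
  proof -
    obtain \<tau> where t: "\<tau> permutes {1..n}" "z = z0 \<circ> \<tau>"
      using same_content_permute[of z0 n A z] z0 z by auto
    have i: "\<tau> \<circ> inv \<tau> = id" "inv \<tau> \<circ> \<tau> = id" using permutes_inv_o[OF t(1)] by auto
    have "bij_betw (\<lambda>\<sigma>. \<tau> \<circ> \<sigma>) {\<sigma> \<in> Sym n. z \<circ> \<sigma> = z} {\<sigma> \<in> Sym n. z0 \<circ> \<sigma> = z}"
      by (rule bij_betw_byWitness[of _ "\<lambda>\<sigma>. inv \<tau> \<circ> \<sigma>"])
        (use t permutes_inv[OF t(1)] in \<open>auto simp: o_assoc i permutes_compose\<close>,
          (simp add: fun_eq_iff permutes_inverses[OF t(1)])+)
    then show ?thesis by (rule bij_betw_same_card)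
  qed
  then have "(\<Sum>z\<in>?Z. card {\<sigma> \<in> Sym n. z \<circ> \<sigma> = z}) = (\<Sum>z\<in>?Z. card {\<sigma> \<in> Sym n. z0 \<circ> \<sigma> = z})"
    by (intro sum.cong) auto
  also have "\<dots> = card (\<Union>z\<in>?Z. {\<sigma> \<in> Sym n. z0 \<circ> \<sigma> = z})"
    by (rule card_UN_disjoint[symmetric]) (use finZ finite_Sym in auto)
  also have "(\<Union>z\<in>?Z. {\<sigma> \<in> Sym n. z0 \<circ> \<sigma> = z}) = Sym n"
    using comp_word[OF z0(1)] z0(2) by auto
  also have "card (Sym n) = fact n"
    using card_permutations[OF refl, of "{1..n}"] by simp
  finally show ?thesis .
qed

text \<open>Burnside's lemma: an orbit of words is determined by its content.\<close>

lemma sum_fixed_words: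
  assumes A: "finite A"
  shows "(\<Sum>\<sigma>\<in>Sym n. card {z \<in> {1..n} \<rightarrow>\<^sub>E A. z \<circ> \<sigma> = z \<and> R (cnt n z)}) =
    fact n * card {M \<in> contents n A. R M}"
proof -
  let ?E = "{1..n} \<rightarrow>\<^sub>E A"
  have finE: "finite ?E" by (rule finite_words[OF A])
  have "(\<Sum>\<sigma>\<in>Sym n. card {z \<in> ?E. z \<circ> \<sigma> = z \<and> R (cnt n z)}) =
     (\<Sum>\<sigma>\<in>Sym n. \<Sum>z | z \<in> {z \<in> ?E. R (cnt n z)} \<and> z \<circ> \<sigma> = z. 1)"
    unfolding card_eq_sum by (intro sum.cong refl) auto
  also have "\<dots> = (\<Sum>z | z \<in> ?E \<and> R (cnt n z). card {\<sigma> \<in> Sym n. z \<circ> \<sigma> = z})"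
    unfolding card_eq_sum by (rule sum.swap_restrict) (use finite_Sym finE in auto)
  also have "\<dots> = (\<Sum>M | M \<in> contents n A \<and> R M. \<Sum>z | z \<in> {z \<in> ?E. R (cnt n z)} \<and> cnt n z = M. card {\<sigma> \<in> Sym n. z \<circ> \<sigma> = z})"
    by (rule sum.group[symmetric]) (use finE finite_contents[OF A] cnt_contents[OF A] in auto)
  also have "\<dots> = (\<Sum>M | M \<in> contents n A \<and> R M. fact n)"
  proof (intro sum.cong refl)
    fix M assume M: "M \<in> {M \<in> contents n A. R M}"
    then have eq: "{z \<in> {z \<in> ?E. R (cnt n z)}. cnt n z = M} = {z \<in> ?E. cnt n z = M}" by auto
    have "M \<in> contents n A" using M by simp
    then show "(\<Sum>z | z \<in> {z \<in> ?E. R (cnt n z)} \<and> cnt n z = M. card {\<sigma> \<in> Sym n. z \<circ> \<sigma> = z}) = fact n"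
      unfolding eq by (rule sum_stabilizers[OF A])
  qed
  also have "\<dots> = fact n * card {M \<in> contents n A. R M}" by simp
  finally show ?thesis .
qed

section \<open>The determinantal class function\<close>

text \<open>The condition \<open>cnt n z i + i = \<nu> i + w i\<close> says that the content of \<open>z\<close> is
  \<open>\<nu>\<close> shifted by \<open>w i - i\<close>, without subtraction on the natural numbers.\<close>

definition has_content :: "nat \<Rightarrow> (nat \<Rightarrow> nat) \<Rightarrow> (nat \<Rightarrow> nat) \<Rightarrow> (nat \<Rightarrow> nat) \<Rightarrow> bool" where
  "has_content m \<nu> w M \<longleftrightarrow> (\<forall>i<m. M i + i = \<nu> i + w i)"

definition psi :: "nat \<Rightarrow> nat \<Rightarrow> (nat \<Rightarrow> nat) \<Rightarrow> (nat \<Rightarrow> nat) \<Rightarrow> (nat \<Rightarrow> nat) \<Rightarrow> nat" where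
  "psi n m \<nu> w \<sigma> = card {z \<in> {1..n} \<rightarrow>\<^sub>E {..<m}. z \<circ> \<sigma> = z \<and> has_content m \<nu> w (cnt n z)}"

text \<open>The Jacobi-Trudi determinant, expanded over permutations, with permutation characters on
  words in place of products of complete symmetric polynomials.\<close>

definition det_char :: "nat \<Rightarrow> nat \<Rightarrow> (nat \<Rightarrow> nat) \<Rightarrow> (nat \<Rightarrow> nat) \<Rightarrow> int" where
  "det_char n m \<nu> \<sigma> = (\<Sum>w | w permutes {..<m}. sign w * int (psi n m \<nu> w \<sigma>))"

text \<open>The least moved point goes up, all smaller values being taken. The prefix ending there
  witnesses the failure of dominance for the shifted content.\<close>

lemma permutes_first_moved:
  assumes "w permutes {..<m::nat}" "w \<noteq> id"
  obtains t where "t \<le> m" "(\<Sum>i<t. i) < (\<Sum>i<t. w i)"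
proof -
  define i where "i = (LEAST i. w i \<noteq> i)"
  have i: "w i \<noteq> i" unfolding i_def by (rule LeastI_ex) (use assms(2) in \<open>auto simp: fun_eq_iff\<close>)
  have fix1: "w j = j" if "j < i" for j
  proof (rule ccontr)
    assume "w j \<noteq> j"
    then have "i \<le> j" unfolding i_def by (rule Least_le)
    then show False using that by simp
  qed
  have "i \<in> {..<m}" using permutes_not_in[OF assms(1), of i] i by metis
  then have im: "i < m" by simp
  have "i < w i"
  proof (rule ccontr)
    assume "\<not> i < w i"
    then have "w (w i) = w i" using i fix1[of "w i"] by simp
    then show False using i permutes_inj[OF assms(1)] by (meson injD)
  qed
  then have "(\<Sum>j<Suc i. j) < (\<Sum>j<Suc i. w j)" using fix1 by simp
  with im show ?thesis using that[of "Suc i"] by simp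
qed

definition matrix_count :: "nat \<Rightarrow> nat \<Rightarrow> (nat \<Rightarrow> nat) \<Rightarrow> (nat \<Rightarrow> nat) \<Rightarrow> (nat \<Rightarrow> nat) \<Rightarrow> nat" where
  "matrix_count n m \<nu> w v = card {M \<in> contents n ({..<m} \<times> {..<m}).
     has_content m \<nu> w (\<lambda>i. \<Sum>j<m. M (i, j)) \<and> has_content m \<nu> v (\<lambda>j. \<Sum>i<m. M (i, j))}"

text \<open>Two fixed words are one fixed word over pairs of letters; its content is a matrix whose
  row and column sums are the two contents. Burnside's lemma then counts these matrices.\<close>

lemma psi_inner:
  "(\<Sum>\<sigma>\<in>Sym n. psi n m \<nu> w \<sigma> * psi n m \<nu> v \<sigma>) = fact n * matrix_count n m \<nu> w v"
proof -
  let ?A = "{..<m} \<times> {..<m}"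
  let ?E = "{1..n} \<rightarrow>\<^sub>E {..<m}"
  let ?R = "\<lambda>M. has_content m \<nu> w (\<lambda>i. \<Sum>j<m. M (i, j)) \<and> has_content m \<nu> v (\<lambda>j. \<Sum>i<m. M (i, j))"
  have "psi n m \<nu> w \<sigma> * psi n m \<nu> v \<sigma> = card {x \<in> {1..n} \<rightarrow>\<^sub>E ?A. x \<circ> \<sigma> = x \<and> ?R (cnt n x)}"
    if s: "\<sigma> permutes {1..n}" for \<sigma>
  proof -
    let ?P = "{z \<in> ?E. z \<circ> \<sigma> = z \<and> has_content m \<nu> w (cnt n z)} \<times> {z \<in> ?E. z \<circ> \<sigma> = z \<and> has_content m \<nu> v (cnt n z)}"
    define pr :: "(nat \<Rightarrow> nat) \<times> (nat \<Rightarrow> nat) \<Rightarrow> nat \<Rightarrow> nat \<times> nat"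
      where "pr = (\<lambda>(z, u). \<lambda>a\<in>{1..n}. (z a, u a))"
    define sp :: "(nat \<Rightarrow> nat \<times> nat) \<Rightarrow> (nat \<Rightarrow> nat) \<times> (nat \<Rightarrow> nat)"
      where "sp x = (\<lambda>a\<in>{1..n}. fst (x a), \<lambda>a\<in>{1..n}. snd (x a))" for x
    have fixes_iff: "y \<circ> \<sigma> = y \<longleftrightarrow> (\<forall>a\<in>{1..n}. y (\<sigma> a) = y a)" for y :: "nat \<Rightarrow> 'b"
      using permutes_not_in[OF s] by (fastforce simp: fun_eq_iff)
    have s_in: "\<sigma> a \<in> {1..n} \<longleftrightarrow> a \<in> {1..n}" for a using permutes_in_image[OF s] .
    have cnt1: "(\<Sum>j<m. cnt n x (i, j)) = cnt n (fst (sp x)) i" if "x \<in> {1..n} \<rightarrow>\<^sub>E ?A" for x i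
    proof -
      have "(\<Sum>j<m. cnt n x (i, j)) = card (\<Union>j\<in>{..<m}. {a \<in> {1..n}. x a = (i, j)})"
        unfolding cnt_def by (rule card_UN_disjoint[symmetric]) auto
      also have "(\<Union>j\<in>{..<m}. {a \<in> {1..n}. x a = (i, j)}) = {a \<in> {1..n}. fst (sp x) a = i}"
      proof -
        have "(\<exists>j<m. x a = (i, j)) \<longleftrightarrow> fst (x a) = i" if "a \<in> {1..n}" for a
          using PiE_mem[OF \<open>x \<in> {1..n} \<rightarrow>\<^sub>E ?A\<close> that] by (cases "x a") auto
        then show ?thesis by (auto simp: sp_def simp del: atLeastAtMost_iff)
      qed
      finally show ?thesis by (simp add: cnt_def)
    qed
    have cnt2: "(\<Sum>i<m. cnt n x (i, j)) = cnt n (snd (sp x)) j" if "x \<in> {1..n} \<rightarrow>\<^sub>E ?A" for x j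
    proof -
      have "(\<Sum>i<m. cnt n x (i, j)) = card (\<Union>i\<in>{..<m}. {a \<in> {1..n}. x a = (i, j)})"
        unfolding cnt_def by (rule card_UN_disjoint[symmetric]) auto
      also have "(\<Union>i\<in>{..<m}. {a \<in> {1..n}. x a = (i, j)}) = {a \<in> {1..n}. snd (sp x) a = j}"
      proof -
        have "(\<exists>i<m. x a = (i, j)) \<longleftrightarrow> snd (x a) = j" if "a \<in> {1..n}" for a
          using PiE_mem[OF \<open>x \<in> {1..n} \<rightarrow>\<^sub>E ?A\<close> that] by (cases "x a") auto
        then show ?thesis by (auto simp: sp_def simp del: atLeastAtMost_iff)
      qed
      finally show ?thesis by (simp add: cnt_def)
    qed
    have sppr: "sp (pr p) = p" if "p \<in> ?E \<times> ?E" for p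
      using that by (auto simp: sp_def pr_def PiE_iff extensional_def fun_eq_iff)
    have prsp: "pr (sp x) = x" if "x \<in> {1..n} \<rightarrow>\<^sub>E ?A" for x
      using that by (auto simp: sp_def pr_def PiE_iff extensional_def fun_eq_iff)
    have prE: "pr p \<in> {1..n} \<rightarrow>\<^sub>E ?A" if "p \<in> ?E \<times> ?E" for p
      using that by (auto simp: pr_def PiE_iff)
    have spE: "sp x \<in> ?E \<times> ?E" if "x \<in> {1..n} \<rightarrow>\<^sub>E ?A" for x
      using that by (fastforce simp: sp_def PiE_iff)
    have fx: "x \<circ> \<sigma> = x \<longleftrightarrow> fst (sp x) \<circ> \<sigma> = fst (sp x) \<and> snd (sp x) \<circ> \<sigma> = snd (sp x)" for x
      unfolding fixes_iff using s_in by (auto simp: sp_def prod_eq_iff simp del: atLeastAtMost_iff)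
    have sp_iff: "x \<circ> \<sigma> = x \<and> ?R (cnt n x) \<longleftrightarrow> sp x \<in> ?P" if "x \<in> {1..n} \<rightarrow>\<^sub>E ?A" for x
      using spE[OF that] fx[of x] cnt1[OF that] cnt2[OF that] by (auto simp: mem_Times_iff)
    have "bij_betw pr ?P {x \<in> {1..n} \<rightarrow>\<^sub>E ?A. x \<circ> \<sigma> = x \<and> ?R (cnt n x)}"
    proof (rule bij_betw_byWitness[of _ sp])
      show "\<forall>p\<in>?P. sp (pr p) = p" using sppr by blast
      show "\<forall>x\<in>{x \<in> {1..n} \<rightarrow>\<^sub>E ?A. x \<circ> \<sigma> = x \<and> ?R (cnt n x)}. pr (sp x) = x" using prsp by blast
      show "sp ` {x \<in> {1..n} \<rightarrow>\<^sub>E ?A. x \<circ> \<sigma> = x \<and> ?R (cnt n x)} \<subseteq> ?P" using sp_iff by blast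
      show "pr ` ?P \<subseteq> {x \<in> {1..n} \<rightarrow>\<^sub>E ?A. x \<circ> \<sigma> = x \<and> ?R (cnt n x)}"
      proof
        fix x assume "x \<in> pr ` ?P"
        then obtain p where p: "p \<in> ?P" "x = pr p" by blast
        then have pE: "p \<in> ?E \<times> ?E" by blast
        show "x \<in> {x \<in> {1..n} \<rightarrow>\<^sub>E ?A. x \<circ> \<sigma> = x \<and> ?R (cnt n x)}"
          using sp_iff[OF prE[OF pE]] sppr[OF pE] prE[OF pE] p by simp
      qed
    qed
    from bij_betw_same_card[OF this] show ?thesis by (simp add: psi_def card_cartesian_product)
  qed
  then have "(\<Sum>\<sigma>\<in>Sym n. psi n m \<nu> w \<sigma> * psi n m \<nu> v \<sigma>) =
      (\<Sum>\<sigma>\<in>Sym n. card {x \<in> {1..n} \<rightarrow>\<^sub>E ?A. x \<circ> \<sigma> = x \<and> ?R (cnt n x)})" by simp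
  also have "\<dots> = fact n * matrix_count n m \<nu> w v"
    unfolding matrix_count_def by (rule sum_fixed_words) simp
  finally show ?thesis .
qed

text \<open>With the column sums fixed by \<open>v\<close>, the sum over \<open>w\<close> is the
  Kostka number of \<open>\<nu>\<close> with this content: 1 for \<open>v = id\<close>, and
  otherwise 0, as the content exceeds \<open>\<nu>\<close> on a prefix.\<close>

lemma alternating_matrix_count:
  assumes anti: "\<And>i. Suc i < m \<Longrightarrow> \<nu> (Suc i) \<le> \<nu> i" and sum: "(\<Sum>i<m. \<nu> i) = n" and v: "v permutes {..<m}"
  shows "(\<Sum>w | w permutes {..<m}. sign w * int (matrix_count n m \<nu> w v)) = (if v = id then 1 else 0)"
proof (cases "\<forall>j<m. j \<le> \<nu> j + v j")
  case False
  \<comment> \<open>A column sum would be negative: no matrix exists, and \<open>v\<close> is not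
    the identity.\<close>
  then obtain j where j: "j < m" "\<nu> j + v j < j" by (auto simp: not_le)
  then have "matrix_count n m \<nu> w v = 0" for w
    unfolding matrix_count_def has_content_def by (auto simp: card_eq_0_iff)
  moreover have "v \<noteq> id" using j by auto
  ultimately show ?thesis by simp
next
  case True
  define \<alpha> where "\<alpha> j = \<nu> j + v j - j" for j
  define \<gamma> where "\<gamma> i = (if i < m then \<nu> i + (m - 1 - i) else 0)" for i
  interpret peel m \<alpha> .
  have mc: "matrix_count n m \<nu> w v = card (mats m w \<gamma>)" if w: "w permutes {..<m}" for w
  proof -
    have row: "x + i = \<nu> i + w i \<longleftrightarrow> x + (m - 1 - w i) = \<gamma> i" if "i < m" for x i
    proof -
      have "w i < m" using permutes_in_image[OF w, of i] that by simp
      then show ?thesis using that by (simp add: \<gamma>_def) linarith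
    qed
    have col: "x + j = \<nu> j + v j \<longleftrightarrow> x = \<alpha> j" if "j < m" for x j
      using True that by (auto simp: \<alpha>_def)
    have wsum: "(\<Sum>i<m. w i) = (\<Sum>i<m. i)"
      using sum.permute[OF w, of "\<lambda>i. i"] by (simp add: o_def)
    have total: "sum M ({..<m} \<times> {..<m}) = n" if "\<forall>i<m. (\<Sum>j<m. M (i, j)) + i = \<nu> i + w i" for M
    proof -
      have "(\<Sum>i<m. (\<Sum>j<m. M (i, j)) + i) = (\<Sum>i<m. \<nu> i + w i)" using that by simp
      then have "(\<Sum>i<m. \<Sum>j<m. M (i, j)) = n" unfolding sum.distrib wsum sum by simp
      then show ?thesis by (simp add: sum.cartesian_product)
    qed
    have "bij_betw (\<lambda>M j i. M (i, j)) {M \<in> contents n ({..<m} \<times> {..<m}).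
       has_content m \<nu> w (\<lambda>i. \<Sum>j<m. M (i, j)) \<and> has_content m \<nu> v (\<lambda>j. \<Sum>i<m. M (i, j))} (mats m w \<gamma>)"
      by (rule bij_betw_byWitness[of _ "\<lambda>N (i, j). N j i"])
        (auto simp: contents_def has_content_def mats_def row col total not_less)
    then show ?thesis unfolding matrix_count_def by (rule bij_betw_same_card)
  qed
  have "(\<Sum>w | w permutes {..<m}. sign w * int (matrix_count n m \<nu> w v)) = G m \<gamma>"
    unfolding G_def by (intro sum.cong) (simp_all add: mc)
  also have "G m \<gamma> = (if v = id then 1 else 0)"
  proof (cases "v = id")
    case True
    then have "\<alpha> = \<nu>" by (auto simp: \<alpha>_def)
    then have "G m (\<lambda>i. if i < m then (if i < m then \<alpha> i else 0) + (m - 1 - i) else 0) = 1"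
      using anti by (intro G_truncation) auto
    moreover have "(\<lambda>i. if i < m then (if i < m then \<alpha> i else 0) + (m - 1 - i) else 0) = \<gamma>"
      by (auto simp: \<gamma>_def \<open>\<alpha> = \<nu>\<close>)
    ultimately show ?thesis using True by simp
  next
    case False
    then obtain t where t: "t \<le> m" "(\<Sum>i<t. i) < (\<Sum>i<t. v i)" using permutes_first_moved[OF v] by blast
    have sd: "sdec \<gamma>"
      unfolding sdec_def
    proof (intro allI impI)
      fix i assume "Suc i < m"
      with anti[of i] show "\<gamma> (Suc i) < \<gamma> i" by (auto simp: \<gamma>_def)
    qed
    have "G m \<gamma> = 0"
    proof (rule ccontr)
      assume "G m \<gamma> \<noteq> 0"
      from G_dominance[OF sd this t(1) t(1)]
      have "(\<Sum>j<t. \<alpha> j) + (\<Sum>i<t. m - 1 - i) \<le> (\<Sum>i<t. \<gamma> i)" .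
      also have "(\<Sum>i<t. \<gamma> i) = (\<Sum>i<t. \<nu> i) + (\<Sum>i<t. m - 1 - i)"
        unfolding sum.distrib[symmetric] using t(1) by (intro sum.cong) (auto simp: \<gamma>_def)
      finally have "(\<Sum>j<t. \<alpha> j) \<le> (\<Sum>i<t. \<nu> i)" by simp
      moreover have "(\<Sum>j<t. \<alpha> j) + (\<Sum>j<t. j) = (\<Sum>j<t. \<nu> j) + (\<Sum>j<t. v j)"
        unfolding sum.distrib[symmetric] using True t(1) by (intro sum.cong) (auto simp: \<alpha>_def)
      ultimately show False using t(2) by linarith
    qed
    then show ?thesis using False by simp
  qed
  finally show ?thesis .
qed

lemma det_char_norm:
  assumes "\<And>i. Suc i < m \<Longrightarrow> \<nu> (Suc i) \<le> \<nu> i" "(\<Sum>i<m. \<nu> i) = n"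
  shows "(\<Sum>\<sigma>\<in>Sym n. det_char n m \<nu> \<sigma> * det_char n m \<nu> \<sigma>) = fact n"
proof -
  let ?S = "{w. w permutes {..<m}}"
  have "(\<Sum>\<sigma>\<in>Sym n. det_char n m \<nu> \<sigma> * det_char n m \<nu> \<sigma>) =
    (\<Sum>\<sigma>\<in>Sym n. \<Sum>v\<in>?S. \<Sum>w\<in>?S. sign v * sign w * int (psi n m \<nu> w \<sigma> * psi n m \<nu> v \<sigma>))"
    by (simp add: det_char_def sum_product mult_ac)
  also have "\<dots> = (\<Sum>v\<in>?S. \<Sum>w\<in>?S. \<Sum>\<sigma>\<in>Sym n. sign v * sign w * int (psi n m \<nu> w \<sigma> * psi n m \<nu> v \<sigma>))"
    by (subst sum.swap) (intro sum.cong refl sum.swap)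
  also have "\<dots> = (\<Sum>v\<in>?S. \<Sum>w\<in>?S. sign v * sign w * int (fact n * matrix_count n m \<nu> w v))"
    unfolding psi_inner[symmetric] by (simp only: of_nat_sum sum_distrib_left)
  also have "\<dots> = (\<Sum>v\<in>?S. fact n * sign v * (\<Sum>w\<in>?S. sign w * int (matrix_count n m \<nu> w v)))"
    by (simp add: sum_distrib_left mult_ac)
  also have "\<dots> = (\<Sum>v\<in>?S. fact n * sign v * (if v = id then 1 else 0))"
    using alternating_matrix_count[OF assms] by (intro sum.cong refl) simp
  also have "\<dots> = (\<Sum>v\<in>?S. if v = id then fact n else 0)"
    by (intro sum.cong) (auto simp: sign_id)
  also have "\<dots> = fact n" by (simp add: permutes_id finite_permutations)
  finally show ?thesis .
qed

section \<open>The determinantal formula for the characters of Specht modules\<close>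

context young_tableau
begin

text \<open>Summing over words first leaves sums of \<open>chi\<close> over stabilizers of words.
  For \<open>w = id\<close> the words have content \<open>\<nu>\<close> and
  \<open>sum_chi_word_rows\<close> applies; otherwise some prefix of the content exceeds that of
  \<open>\<nu>\<close> and \<open>sum_chi_word_zero\<close> applies.\<close>

lemma chi_psi:
  assumes m: "size \<nu> \<le> m" and w: "w permutes {..<m}"
  shows "(\<Sum>\<sigma>\<in>Sym n. chi \<sigma> * of_nat (psi n m (\<lambda>i. part \<nu> (Suc i)) w \<sigma>)) = (if w = id then fact n else 0)"
proof -
  let ?E = "{1..n} \<rightarrow>\<^sub>E {..<m}" and ?R = "has_content m (\<lambda>i. part \<nu> (Suc i)) w"
  have finE: "finite ?E" by (simp add: finite_words)
  have "(\<Sum>\<sigma>\<in>Sym n. chi \<sigma> * of_nat (psi n m (\<lambda>i. part \<nu> (Suc i)) w \<sigma>)) =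
     (\<Sum>\<sigma>\<in>Sym n. \<Sum>z | z \<in> {z \<in> ?E. ?R (cnt n z)} \<and> z \<circ> \<sigma> = z. chi \<sigma>)"
  proof (intro sum.cong refl)
    fix \<sigma>
    have "{z \<in> {z \<in> ?E. ?R (cnt n z)}. z \<circ> \<sigma> = z} = {z \<in> ?E. z \<circ> \<sigma> = z \<and> ?R (cnt n z)}" by auto
    then show "chi \<sigma> * of_nat (psi n m (\<lambda>i. part \<nu> (Suc i)) w \<sigma>) =
        (\<Sum>z | z \<in> {z \<in> ?E. ?R (cnt n z)} \<and> z \<circ> \<sigma> = z. chi \<sigma>)"
      by (simp add: psi_def)
  qed
  also have "\<dots> = (\<Sum>z | z \<in> ?E \<and> ?R (cnt n z). \<Sum>\<sigma> | \<sigma> \<in> Sym n \<and> z \<circ> \<sigma> = z. chi \<sigma>)"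
    by (rule sum.swap_restrict) (use finite_Sym finE in auto)
  also have "\<dots> = (\<Sum>z | z \<in> ?E \<and> ?R (cnt n z). \<Sum>\<sigma> | \<sigma> permutes {1..n} \<and> z \<circ> \<sigma> = z. chi \<sigma>)"
    by simp
  also have "\<dots> = (if w = id then fact n else 0)"
  proof (cases "w = id")
    case True
    have sum: "(\<Sum>i<m. part \<nu> (Suc i)) = n"
      using sum_part[OF m] by (simp add: n_def sum_shift_Suc)
    have R: "?R M \<longleftrightarrow> M = (\<lambda>i. part \<nu> (Suc i))" if "M \<in> contents n {..<m}" for M
    proof -
      have "part \<nu> (Suc i) = M i" if "\<not> i < m" for i
        using \<open>M \<in> contents n {..<m}\<close> that m by (simp add: contents_def part_eq_0)
      then show ?thesis by (auto simp: has_content_def True fun_eq_iff) metis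
    qed
    have Mc: "(\<lambda>i. part \<nu> (Suc i)) \<in> contents n {..<m}"
      using m sum by (simp add: contents_def part_eq_0)
    have eqset: "{z \<in> ?E. ?R (cnt n z)} = {z \<in> ?E. cnt n z = (\<lambda>i. part \<nu> (Suc i))}"
      using R cnt_contents[of "{..<m}"] by blast
    have "(\<Sum>\<sigma> | \<sigma> permutes {1..n} \<and> z \<circ> \<sigma> = z. chi \<sigma>) = of_nat (card {\<sigma> \<in> Sym n. z \<circ> \<sigma> = z})"
      if "cnt n z = (\<lambda>i. part \<nu> (Suc i))" for z
      using sum_chi_word_rows[of z] that by (simp add: cnt_def fun_eq_iff)
    then have "(\<Sum>z | z \<in> ?E \<and> ?R (cnt n z). \<Sum>\<sigma> | \<sigma> permutes {1..n} \<and> z \<circ> \<sigma> = z. chi \<sigma>) =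
       of_nat (\<Sum>z | z \<in> ?E \<and> cnt n z = (\<lambda>i. part \<nu> (Suc i)). card {\<sigma> \<in> Sym n. z \<circ> \<sigma> = z})"
      unfolding eqset of_nat_sum by (intro sum.cong) auto
    also have "\<dots> = fact n" unfolding sum_stabilizers[OF finite_lessThan Mc] by simp
    finally show ?thesis using True by simp
  next
    case False
    then obtain t where t: "t \<le> m" "(\<Sum>i<t. i) < (\<Sum>i<t. w i)" using permutes_first_moved[OF w] by blast
    have "(\<Sum>\<sigma> | \<sigma> permutes {1..n} \<and> z \<circ> \<sigma> = z. chi \<sigma>) = 0" if z: "?R (cnt n z)" for z
    proof (rule sum_chi_word_zero[of t])
      have "(\<Sum>i<t. cnt n z i + i) = (\<Sum>i<t. part \<nu> (Suc i) + w i)"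
        using z t(1) by (intro sum.cong) (auto simp: has_content_def)
      then have "(\<Sum>i<t. part \<nu> (Suc i)) < (\<Sum>i<t. cnt n z i)"
        using t(2) unfolding sum.distrib by linarith
      also have "(\<Sum>i<t. cnt n z i) = card (\<Union>i<t. {a \<in> {1..n}. z a = i})"
        unfolding cnt_def by (rule card_UN_disjoint[symmetric]) auto
      also have "(\<Union>i<t. {a \<in> {1..n}. z a = i}) = {a \<in> {1..n}. z a < t}" by auto
      also have "(\<Sum>i<t. part \<nu> (Suc i)) = (\<Sum>i = 1..t. part \<nu> i)"
        by (simp add: sum_shift_Suc)
      finally show "(\<Sum>i = 1..t. part \<nu> i) < card {a \<in> {1..n}. z a < t}" .
    qed
    then show ?thesis using False by simp
  qed
  finally show ?thesis .
qed

text \<open>The squares of \<open>r - f\<close> are nonnegative reals with sum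
  \<open>fact n - 2 * fact n + fact n\<close>.\<close>

theorem specht_character_det_char:
  assumes m: "size \<nu> \<le> m" and s: "\<sigma> permutes {1..n}"
  shows "specht_character \<nu> \<sigma> = of_int (det_char n m (\<lambda>i. part \<nu> (Suc i)) \<sigma>)"
proof -
  define f where "f \<sigma> = det_char n m (\<lambda>i. part \<nu> (Suc i)) \<sigma>" for \<sigma>
  have sum: "(\<Sum>i<m. part \<nu> (Suc i)) = n"
    using sum_part[OF m] by (simp add: n_def sum_shift_Suc)
  define r where "r \<sigma> = Re (chi \<sigma>)" for \<sigma>
  have r: "chi \<sigma> = of_real (r \<sigma>)" if "\<sigma> permutes {1..n}" for \<sigma>
    using chi_real[OF that] by (simp add: r_def)
  have cc: "(\<Sum>\<sigma>\<in>Sym n. r \<sigma> * r \<sigma>) = fact n"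
  proof -
    \<comment> \<open>\<open>chi_inv\<close> removes the inverse in \<open>character_norm\<close>,
      which makes this a sum of squares.\<close>
    have "complex_of_real (\<Sum>\<sigma>\<in>Sym n. r \<sigma> * r \<sigma>) = (\<Sum>\<sigma>\<in>Sym n. chi \<sigma> * chi (inv \<sigma>))"
      unfolding of_real_sum of_real_mult by (intro sum.cong) (auto simp: chi_inv r)
    also have "\<dots> = complex_of_real (fact n)" by (simp add: character_norm)
    finally show ?thesis by (simp only: of_real_eq_iff)
  qed
  have cf: "(\<Sum>\<sigma>\<in>Sym n. r \<sigma> * real_of_int (f \<sigma>)) = fact n"
  proof -
    have "complex_of_real (\<Sum>\<sigma>\<in>Sym n. r \<sigma> * real_of_int (f \<sigma>)) =
      (\<Sum>\<sigma>\<in>Sym n. \<Sum>w | w permutes {..<m}. of_int (sign w) * (chi \<sigma> * of_nat (psi n m (\<lambda>i. part \<nu> (Suc i)) w \<sigma>)))"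
      unfolding of_real_sum of_real_mult
      by (intro sum.cong) (auto simp: r f_def det_char_def sum_distrib_left mult_ac)
    also have "\<dots> = (\<Sum>w | w permutes {..<m}. of_int (sign w) * (\<Sum>\<sigma>\<in>Sym n. chi \<sigma>
      * of_nat (psi n m (\<lambda>i. part \<nu> (Suc i)) w \<sigma>)))"
      by (subst sum.swap) (simp add: sum_distrib_left)
    also have "\<dots> = (\<Sum>w | w permutes {..<m}. if w = id then fact n else 0)"
      by (intro sum.cong) (auto simp: chi_psi[OF m] sign_id)
    also have "\<dots> = complex_of_real (fact n)" by (simp add: permutes_id finite_permutations)
    finally show ?thesis by (simp only: of_real_eq_iff)
  qed
  have ff: "(\<Sum>\<sigma>\<in>Sym n. real_of_int (f \<sigma>) * real_of_int (f \<sigma>)) = fact n"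
  proof -
    have "(\<Sum>\<sigma>\<in>Sym n. f \<sigma> * f \<sigma>) = fact n"
      unfolding f_def using part_antimono[of "Suc _" "Suc (Suc _)" \<nu>]
      by (intro det_char_norm sum) auto
    from arg_cong[OF this, of real_of_int] show ?thesis by simp
  qed
  have "(\<Sum>\<sigma>\<in>Sym n. (r \<sigma> - real_of_int (f \<sigma>))\<^sup>2) = 0"
  proof -
    have "(\<Sum>\<sigma>\<in>Sym n. (r \<sigma> - real_of_int (f \<sigma>))\<^sup>2) =
      (\<Sum>\<sigma>\<in>Sym n. r \<sigma> * r \<sigma> - 2 * (r \<sigma> * real_of_int (f \<sigma>)) + real_of_int (f \<sigma>) * real_of_int (f \<sigma>))"
      by (intro sum.cong) (auto simp: power2_eq_square algebra_simps)
    also have "\<dots> = 0"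
      by (simp add: sum.distrib sum_subtractf cc cf ff flip: sum_distrib_left)
    finally show ?thesis .
  qed
  then have "(r \<sigma> - real_of_int (f \<sigma>))\<^sup>2 = 0"
    using s finite_Sym by (subst (asm) sum_nonneg_eq_0_iff) auto
  then show ?thesis using r[OF s] by (simp add: specht_character_eq f_def)
qed

end

section \<open>Expansion of \<open>P\<^sub>d\<close> as a Vandermonde determinant\<close>

text \<open>Each level of the recursion uses a suffix of the variables; the one starting after
  \<open>i\<close> contributes the factors \<open>1 - y\<^sub>j / y\<^sub>i\<close>, whose quotients
  are products of consecutive variables.\<close>

lemma P_poly_interval:
  "a \<le> d \<Longrightarrow> P_poly (map f [Suc a..<Suc d]) = (\<Prod>i = a..<d. \<Prod>j\<in>{i<..d}. 1 - (\<Prod>l\<in>{i<..j}. f l))"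
proof (induction "d - a" arbitrary: a)
  case (Suc x)
  then have ad: "a < d" by simp
  let ?ws = "map f [Suc a..<Suc d]"
  have ws: "?ws = f (Suc a) # map f [Suc (Suc a)..<Suc d]" using ad
    by (simp add: upt_conv_Cons del: upt_Suc)
  have tk: "prod_list (take j ?ws) = (\<Prod>l\<in>{a<..a + j}. f l)" if "j \<le> d - a" for j
  proof -
    have "take j ?ws = map f [Suc a..<Suc a + j]" using that ad by (simp add: take_map del: upt_Suc)
    also have "prod_list \<dots> = (\<Prod>l\<in>{Suc a..<Suc a + j}. f l)"
      by (subst prod.distinct_set_conv_list[symmetric]) (simp_all del: upt_Suc)
    also have "{Suc a..<Suc a + j} = {a<..a + j}" by auto
    finally show ?thesis .
  qed
  have "P_poly ?ws = (\<Prod>j = 1..d - a. 1 - prod_list (take j ?ws)) * P_poly (map f [Suc (Suc a)..<Suc d])"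
    unfolding ws P_poly.simps using ad by (simp add: Suc_diff_Suc del: upt_Suc)
  also have "(\<Prod>j = 1..d - a. 1 - prod_list (take j ?ws)) = (\<Prod>j = 1..d - a. 1 - (\<Prod>l\<in>{a<..a + j}. f l))"
    by (intro prod.cong refl) (simp add: tk del: upt_Suc)
  also have "\<dots> = (\<Prod>j\<in>{a<..d}. 1 - (\<Prod>l\<in>{a<..j}. f l))"
    using ad by (intro prod.reindex_bij_witness[of _ "\<lambda>j. j - a" "\<lambda>j. a + j"]) auto
  also have "P_poly (map f [Suc (Suc a)..<Suc d]) = (\<Prod>i = Suc a..<d. \<Prod>j\<in>{i<..d}. 1 - (\<Prod>l\<in>{i<..j}. f l))"
    using Suc by (intro Suc.hyps(1)) auto
  finally show ?case using ad by (simp add: prod.atLeast_Suc_lessThan del: upt_Suc)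
qed simp

text \<open>In the Newton basis \<open>q k\<close> of the polynomials of degree at most \<open>d\<close> the matrix is triangular.\<close>

lemma vandermonde:
  fixes Y :: "nat \<Rightarrow> 'a :: comm_ring_1"
  shows "(\<Sum>p | p permutes {..<Suc d}. of_int (sign p) * (\<Prod>i<Suc d. Y i ^ (d - p i))) =
    (\<Prod>i<Suc d. \<Prod>j\<in>{i<..d}. Y i - Y j)"
proof -
  define q where "q k = (\<Prod>l\<in>{k<..d}. [:- Y l, 1:])" for k
  have q_poly: "poly (q k) x = (\<Prod>l\<in>{k<..d}. x - Y l)" for k x
    by (simp add: q_def poly_prod)
  \<comment> \<open>Degrees of products need not add over a ring with zero divisors, so monicity is
    carried along.\<close>
  have q_deg: "degree (q k) = d - k \<and> coeff (q k) (d - k) = 1" for k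
  proof -
    have "degree (\<Prod>l\<in>S. [:- Y l, 1:]) = card S \<and> coeff (\<Prod>l\<in>S. [:- Y l, 1:]) (card S) = 1"
      if "finite S" for S
      using that
    proof (induction S)
      case (insert l S)
      let ?r = "\<Prod>l\<in>S. [:- Y l, 1:]"
      have "[:- Y l, 1:] * ?r = smult (- Y l) ?r + pCons 0 ?r" by simp
      then have c: "coeff ([:- Y l, 1:] * ?r) n = - Y l * coeff ?r n + (case n of 0 \<Rightarrow> 0 | Suc n' \<Rightarrow> coeff ?r n')" for n
        by (simp add: coeff_pCons)
      have 1: "coeff ([:- Y l, 1:] * ?r) (Suc (card S)) = 1"
        unfolding c using insert by (simp add: coeff_eq_0)
      have "degree ([:- Y l, 1:] * ?r) \<le> Suc (card S)"
      proof (rule degree_le, intro allI impI)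
        fix n assume "Suc (card S) < n"
        then show "coeff ([:- Y l, 1:] * ?r) n = 0"
          unfolding c using insert by (cases n) (auto simp: coeff_eq_0)
      qed
      moreover have "Suc (card S) \<le> degree ([:- Y l, 1:] * ?r)" by (rule le_degree) (simp only: 1, simp)
      ultimately show ?case using 1 insert by (simp del: mult_pCons_left)
    qed simp
    from this[of "{k<..d}"] show ?thesis by (simp add: q_def)
  qed
  define V where "V = mat (Suc d) (Suc d) (\<lambda>(i, k). Y i ^ (d - k))"
  define C where "C = mat (Suc d) (Suc d) (\<lambda>(k', k). coeff (q k) (d - k'))"
  define A where "A = mat (Suc d) (Suc d) (\<lambda>(i, k). poly (q k) (Y i))"
  have carrier: "V \<in> carrier_mat (Suc d) (Suc d)" "C \<in> carrier_mat (Suc d)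
    (Suc d)" "A \<in> carrier_mat (Suc d) (Suc d)"
    by (simp_all add: V_def C_def A_def)
  \<comment> \<open>\<open>C\<close> holds the coefficients of the Newton basis in descending
    powers, which makes it unitriangular.\<close>
  have "V * C = A"
  proof (rule eq_matI)
    fix i k assume ik: "i < dim_row A" "k < dim_col A"
    have "poly (q k) (Y i) = (\<Sum>n\<le>d. coeff (q k) n * Y i ^ n)"
      unfolding poly_altdef using q_deg[of k]
      by (intro sum.mono_neutral_left) (auto simp: coeff_eq_0)
    also have "\<dots> = (\<Sum>k' = 0..<Suc d. Y i ^ (d - k') * coeff (q k) (d - k'))"
      by (rule sum.reindex_bij_witness[of _ "\<lambda>k'. d - k'" "\<lambda>n. d - n"]) (auto simp: mult.commute)
    finally show "(V * C) $$ (i, k) = A $$ (i, k)"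
      using ik by (simp add: V_def C_def A_def scalar_prod_def)
  qed (simp_all add: V_def C_def A_def)
  then have "det V * det C = det A" using det_mult[OF carrier(1,2)] by simp
  moreover have "det C = 1"
  proof -
    have "det C = prod_list (diag_mat C)"
    proof (rule det_lower_triangular[OF _ carrier(2)])
      fix k' k assume k: "k' < k" "k < Suc d"
      then have "degree (q k) < d - k'" using q_deg[of k] by simp
      then show "C $$ (k', k) = 0" using k by (simp add: C_def coeff_eq_0)
    qed
    also have "\<dots> = 1" unfolding prod_list_diag_prod using q_deg by (intro prod.neutral) (simp add: C_def)
    finally show ?thesis .
  qed
  moreover have "det A = (\<Prod>i<Suc d. \<Prod>j\<in>{i<..d}. Y i - Y j)"
  proof -
    have "upper_triangular A"
    proof (rule upper_triangularI)
      fix i k assume "k < i" "i < dim_row A"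
      then show "A $$ (i, k) = 0" by (auto simp: A_def q_poly intro!: prod_zero)
    qed
    then have "det A = prod_list (diag_mat A)" by (rule det_upper_triangular[OF _ carrier(3)])
    then show ?thesis unfolding prod_list_diag_prod by (simp add: A_def q_poly atLeast0LessThan)
  qed
  moreover have "det V = (\<Sum>p | p permutes {..<Suc d}. of_int (sign p) * (\<Prod>i<Suc d. Y i ^ (d - p i)))"
  proof -
    have "det V = (\<Sum>p | p permutes {..<Suc d}. of_int (sign p) * (\<Prod>i<Suc d. V $$ (i, p i)))"
      using carrier(1) by (simp add: det_def V_def atLeast0LessThan)
    also have "\<dots> = (\<Sum>p | p permutes {..<Suc d}. of_int (sign p) * (\<Prod>i<Suc d. Y i ^ (d - p i)))"
    proof (intro sum.cong prod.cong refl arg_cong2[of _ _ _ _ "(*)"])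
      fix p i assume "p \<in> {p. p permutes {..<Suc d}}" "i \<in> {..<Suc d}"
      then have "p i < Suc d" using permutes_in_image[of p "{..<Suc d}" i] by auto
      then show "V $$ (i, p i) = Y i ^ (d - p i)" using \<open>i \<in> {..<Suc d}\<close> by (simp add: V_def)
    qed
    finally show ?thesis .
  qed
  ultimately show ?thesis by simp
qed

text \<open>The factor \<open>y\<^sub>i ^ (d - i)\<close> gives one \<open>y\<^sub>i\<close> to each
  pair \<open>i < j\<close>, turning \<open>1 - y\<^sub>j / y\<^sub>i\<close> into
  \<open>y\<^sub>i - y\<^sub>j\<close>.\<close>

lemma P_poly_expansion:
  fixes f :: "nat \<Rightarrow> 'a :: comm_ring_1"
  shows "(\<Prod>i<Suc d. (\<Prod>l = 1..i. f l) ^ (d - i)) * P_poly (map f [1..<Suc d]) =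
    (\<Sum>p | p permutes {..<Suc d}. of_int (sign p) * (\<Prod>i<Suc d. (\<Prod>l = 1..i. f l) ^ (d - p i)))"
proof -
  define Y where "Y i = (\<Prod>l = 1..i. f l)" for i
  have split: "Y j = Y i * (\<Prod>l\<in>{i<..j}. f l)" if "i < j" for i j
  proof -
    have "{1..j} = {1..i} \<union> {i<..j}" using that by auto
    then show ?thesis unfolding Y_def by (simp only:) (rule prod.union_disjoint; auto)
  qed
  have "P_poly (map f [1..<Suc d]) = (\<Prod>i<d. \<Prod>j\<in>{i<..d}. 1 - (\<Prod>l\<in>{i<..j}. f l))"
    using P_poly_interval[of 0 d f] by (simp add: atLeast0LessThan One_nat_def)
  also have "\<dots> = (\<Prod>i<Suc d. \<Prod>j\<in>{i<..d}. 1 - (\<Prod>l\<in>{i<..j}. f l))" by simp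
  finally have P: "P_poly (map f [1..<Suc d]) = \<dots>" .
  have "(\<Prod>i<Suc d. Y i ^ (d - i)) * P_poly (map f [1..<Suc d]) =
     (\<Prod>i<Suc d. \<Prod>j\<in>{i<..d}. Y i * (1 - (\<Prod>l\<in>{i<..j}. f l)))"
    unfolding P by (simp only: prod.distrib[symmetric] prod_constant card_greaterThanAtMost)
      (simp only: prod.distrib prod_constant card_greaterThanAtMost)
  also have "\<dots> = (\<Prod>i<Suc d. \<Prod>j\<in>{i<..d}. Y i - Y j)"
    by (intro prod.cong refl) (auto simp: algebra_simps split)
  also have "\<dots> = (\<Sum>p | p permutes {..<Suc d}. of_int (sign p) * (\<Prod>i<Suc d. Y i ^ (d - p i)))"
    by (rule vandermonde[symmetric])
  finally show ?thesis by (simp only: Y_def)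
qed

text \<open>
  The term of \<open>P\<^sub>d\<close> belonging to the permutation \<open>p\<close> has the exponent \<open>shift_exp d p - shift_exp d id\<close>;
  adding \<open>shift_exp d id\<close> avoids the subtraction.
\<close>

definition shift_exp :: "nat \<Rightarrow> (nat \<Rightarrow> nat) \<Rightarrow> (nat \<Rightarrow>\<^sub>0 nat)" where
  "shift_exp d p = (\<Sum>l = 1..d. single l (\<Sum>i = l..d. d - p i))"

lemma lookup_shift_exp:
  "lookup (shift_exp d p) l = (if l \<in> {1..d} then \<Sum>i = l..d. d - p i else 0)"
  unfolding shift_exp_def by (rule lookup_sum_single) simp

section \<open>The product of a power series with \<open>P\<^sub>d\<close>\<close>

lemma prod_single: "finite I \<Longrightarrow> (\<Prod>i\<in>I. single (e i)
  (1::'b::comm_semiring_1)) = single (\<Sum>i\<in>I. e i :: 'c::comm_monoid_add) 1"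
  by (induction I rule: finite_induct) (simp_all add: mult_single)

lemma power_single: "single e (1::'b::comm_semiring_1) ^ k = single (\<Sum>_<k. e :: 'c::comm_monoid_add) 1"
  using prod_single[of "{..<k}" "\<lambda>_. e"] by simp

text \<open>\<open>w\<^sub>l\<close> divides \<open>y\<^sub>i\<close> exactly when
  \<open>l \<le> i\<close>, so its exponent is the sum of \<open>d - p i\<close> over
  \<open>i \<ge> l\<close>.\<close>

lemma monomial_shift:
  "(\<Prod>i<Suc d. (\<Prod>l = 1..i. mvar l) ^ (d - p i)) = (single (shift_exp d p) 1 :: 'a::comm_ring_1 mpoly)"
proof -
  have "(\<Prod>i<Suc d. (\<Prod>l = 1..i. mvar l) ^ (d - p i)) =
     (single (\<Sum>i<Suc d. \<Sum>_<d - p i. \<Sum>l = 1..i. single l 1) 1 :: 'a mpoly)"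
    unfolding mvar_def prod_single[OF finite_atLeastAtMost] power_single prod_single[OF finite_lessThan] ..
  also have "(\<Sum>i<Suc d. \<Sum>_<d - p i. \<Sum>l = 1..i. single l 1) = shift_exp d p"
  proof (rule poly_mapping_eqI)
    fix l
    have "lookup (\<Sum>i<Suc d. \<Sum>_<d - p i. \<Sum>l = 1..i. single l 1) l =
        (\<Sum>i<Suc d. (d - p i) * (if l \<in> {1..i} then 1 else 0))"
      unfolding lookup_sum by (simp add: lookup_single when_def)
    also have "\<dots> = (\<Sum>i\<in>{i \<in> {..<Suc d}. l \<in> {1..i}}. d - p i)"
      by (rule sum.mono_neutral_cong_right) auto
    also have "\<dots> = lookup (shift_exp d p) l"
      unfolding lookup_shift_exp by (auto intro: sum.cong)
    finally show "lookup (\<Sum>i<Suc d. \<Sum>_<d - p i. \<Sum>l = 1..i. single l 1) l = lookup (shift_exp d p) l" .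
  qed
  finally show ?thesis .
qed

lemma shifted_P_poly:
  "single (shift_exp d id) 1 * P_poly (map mvar [1..<Suc d]) =
    (\<Sum>p | p permutes {..<Suc d}. single (shift_exp d p) (of_int (sign p)) :: 'a::comm_ring_1 mpoly)"
  using P_poly_expansion[where d = d and f = "mvar :: nat \<Rightarrow> 'a mpoly"] monomial_shift[of d id, where 'a = 'a]
  unfolding monomial_shift by (simp add: mult_single del: upt_Suc flip: single_of_int)

lemma lookup_single_mult_add:
  fixes e a :: "'b :: cancel_comm_monoid_add" and P :: "'b \<Rightarrow>\<^sub>0 'a :: comm_semiring_1"
  shows "lookup (single e 1 * P) (e + a) = lookup P a"
proof -
  have "single e 1 * P = (\<Sum>t\<in>keys P. single (e + t) (lookup P t))"
    by (subst poly_mapping_sum_single[of P, symmetric]) (simp add: sum_distrib_left mult_single)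
  then show ?thesis by (simp add: lookup_sum lookup_single when_def in_keys_iff)
qed

lemma lookup_single_mult_outside:
  fixes e a :: "'b :: cancel_comm_monoid_add" and P :: "'b \<Rightarrow>\<^sub>0 'a :: comm_semiring_1"
  assumes "\<And>t. a \<noteq> e + t"
  shows "lookup (single e 1 * P) a = 0"
proof -
  have "single e 1 * P = (\<Sum>t\<in>keys P. single (e + t) (lookup P t))"
    by (subst poly_mapping_sum_single[of P, symmetric]) (simp add: sum_distrib_left mult_single)
  then show ?thesis by (simp add: lookup_sum lookup_single when_def assms[symmetric])
qed

text \<open>Multiplying \<open>P\<^sub>d\<close> by the monomial of \<open>shift_exp d id\<close>
  shifts the coefficient index and gives a signed sum of monomials, each of which selects the terms
  \<open>b\<close> that complete it.\<close>

lemma series_mult_P_poly: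
  fixes S :: "'a::comm_ring_1 mseries"
  shows "series_mult (series_of_poly (P_poly (map mvar [1..<Suc d]))) S k =
    (\<Sum>p | p permutes {..<Suc d}. of_int (sign p) * (\<Sum>b | shift_exp d p + b = shift_exp d id + k. S b))"
proof -
  let ?e = "shift_exp d id"
  let ?P = "P_poly (map mvar [1..<Suc d]) :: 'a mpoly"
  let ?Q = "single ?e 1 * ?P"
  have fin: "finite {b. c + b = (k' :: nat \<Rightarrow>\<^sub>0 nat)}" for c k'
  proof -
    have "{b. c + b = k'} = snd ` ({(a, b). a + b = k'} \<inter> {c} \<times> UNIV)" by force
    then show ?thesis using finite_factorisations[of k'] by simp
  qed
  have "series_mult (series_of_poly ?P) S k = (\<Sum>(a, b)\<in>{(a, b). a + b = k}. lookup ?Q (?e + a) * S b)"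
    by (simp add: series_mult_def series_of_poly_def lookup_single_mult_add)
  also have "\<dots> = (\<Sum>(a, b)\<in>(\<lambda>(a, b). (?e + a, b)) ` {(a, b). a + b = k}. lookup ?Q a * S b)"
    by (subst sum.reindex) (auto simp: inj_on_def intro!: sum.cong)
  \<comment> \<open>Enlarging the index set adds only monomials that are not multiples of
    \<open>?e\<close>, where \<open>?Q\<close> has coefficient 0.\<close>
  also have "\<dots> = (\<Sum>(a, b)\<in>{(a, b). a + b = ?e + k}. lookup ?Q a * S b)"
  proof (rule sum.mono_neutral_left)
    show "finite {(a, b). a + b = ?e + k}" by (rule finite_factorisations)
    show "(\<lambda>(a, b). (?e + a, b)) ` {(a, b). a + b = k} \<subseteq> {(a, b). a + b = ?e + k}"
      by (auto simp: add.assoc)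
    show "\<forall>x\<in>{(a, b). a + b = ?e + k} - (\<lambda>(a, b). (?e + a, b)) ` {(a, b). a + b = k}.
        (case x of (a, b) \<Rightarrow> lookup ?Q a * S b) = 0"
    proof safe
      fix a b assume ab: "a + b = ?e + k" "(a, b) \<notin> (\<lambda>(a, b). (?e + a, b)) ` {(a, b). a + b = k}"
      have "a \<noteq> ?e + t" for t
      proof
        assume a: "a = ?e + t"
        then have "t + b = k" using ab(1) by (simp add: add.assoc)
        then show False using ab(2) a by auto
      qed
      then show "lookup ?Q a * S b = 0" by (simp add: lookup_single_mult_outside)
    qed
  qed
  also have "\<dots> = (\<Sum>(a, b)\<in>{(a, b). a + b = ?e + k}. \<Sum>p | p permutes {..<Suc d}. if shift_exp d p
    = a then of_int (sign p) * S b else 0)"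
    unfolding shifted_P_poly by (intro sum.cong refl)
      (auto simp: lookup_sum lookup_single when_def sum_distrib_right intro!: sum.cong)
  also have "\<dots> = (\<Sum>p | p permutes {..<Suc d}. \<Sum>(a, b)\<in>{(a, b). a + b = ?e + k}. if shift_exp d p
    = a then of_int (sign p) * S b else 0)"
    unfolding case_prod_unfold by (rule sum.swap)
  also have "\<dots> = (\<Sum>p | p permutes {..<Suc d}. of_int (sign p) * (\<Sum>b | shift_exp d p + b = ?e + k. S b))"
  proof (intro sum.cong refl)
    fix p
    have "(\<Sum>(a, b)\<in>{(a, b). a + b = ?e + k}. if shift_exp d p = a then of_int (sign p) * S b else 0) =
        (\<Sum>(a, b)\<in>Pair (shift_exp d p) ` {b. shift_exp d p + b = ?e + k}. of_int (sign p) * S b)"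
      by (rule sum.mono_neutral_cong_right[OF finite_factorisations]) auto
    also have "\<dots> = (\<Sum>b | shift_exp d p + b = ?e + k. of_int (sign p) * S b)"
      by (subst sum.reindex) (auto simp: inj_on_def)
    finally show "(\<Sum>(a, b)\<in>{(a, b). a + b = ?e + k}. if shift_exp d p = a then of_int (sign p) * S b else 0) =
        of_int (sign p) * (\<Sum>b | shift_exp d p + b = ?e + k. S b)"
      by (simp add: sum_distrib_left)
  qed
  finally show ?thesis .
qed

section \<open>Evaluation of polynomials\<close>

definition mon_val :: "(nat \<Rightarrow> 'a::comm_semiring_1) \<Rightarrow> (nat \<Rightarrow>\<^sub>0 nat) \<Rightarrow> 'a" where
  "mon_val a m = (\<Prod>i\<in>keys m. a i ^ lookup m i)"

lemma mon_val_superset: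
  assumes "finite K" "keys m \<subseteq> K"
  shows "mon_val a m = (\<Prod>i\<in>K. a i ^ lookup m i)"
  unfolding mon_val_def using assms by (intro prod.mono_neutral_left) (auto simp: in_keys_iff)

lemma mon_val_add: "mon_val a (m + m') = mon_val a m * mon_val a m'"
proof -
  let ?K = "keys m \<union> keys m'"
  have "keys (m + m') \<subseteq> ?K" by (rule keys_add)
  then show ?thesis
    by (simp add: mon_val_superset[of ?K] lookup_add power_add prod.distrib)
qed

lemma mon_val_0 [simp]: "mon_val a 0 = 1"
  by (simp add: mon_val_def)

lemma meval_superset:
  assumes "finite K" "keys p \<subseteq> K"
  shows "meval p a = (\<Sum>m\<in>K. lookup p m * mon_val a m)"
  unfolding meval_def mon_val_def[symmetric] using assms
  by (intro sum.mono_neutral_left) (auto simp: in_keys_iff)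

lemma meval_add: "meval (p + q) a = meval p a + meval q a"
proof -
  let ?K = "keys p \<union> keys q"
  have "keys (p + q) \<subseteq> ?K" by (rule keys_add)
  then show ?thesis
    by (simp add: meval_superset[of ?K] lookup_add distrib_right sum.distrib)
qed

lemma meval_0 [simp]: "meval 0 a = 0"
  by (simp add: meval_def)

lemma meval_sum: "meval (sum f I) a = (\<Sum>i\<in>I. meval (f i) a)"
  by (induction I rule: infinite_finite_induct) (simp_all add: meval_add)

lemma meval_single: "meval (single m c) a = c * mon_val a m"
  by (subst meval_superset[of "{m}"]) (auto simp: lookup_single)

lemma meval_mult: "meval (p * q) a = meval p a * meval q a"
proof -
  have "p * q = (\<Sum>m\<in>keys p. \<Sum>m'\<in>keys q.
      single (m + m') (lookup p m * lookup q m'))"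
  proof -
    have "p * q = (\<Sum>m\<in>keys p. single m (lookup p m)) *
        (\<Sum>m'\<in>keys q. single m' (lookup q m'))"
      by (simp only: poly_mapping_sum_single)
    then show ?thesis by (simp only: sum_product mult_single)
  qed
  then have "meval (p * q) a = (\<Sum>m\<in>keys p. \<Sum>m'\<in>keys q.
      (lookup p m * mon_val a m) * (lookup q m' * mon_val a m'))"
    by (simp add: meval_sum meval_single mon_val_add mult_ac)
  then show ?thesis by (simp add: meval_def mon_val_def sum_product)
qed

lemma meval_mconst [simp]: "meval (mconst c) a = c"
  by (simp add: mconst_def meval_single)

lemma meval_1 [simp]: "meval 1 a = 1"
  using meval_mconst[of 1 a] by (simp add: mconst_def)

lemma meval_mvar [simp]: "meval (mvar i) a = a i"
  by (simp add: mvar_def meval_single mon_val_def)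

lemma meval_of_nat [simp]: "meval (of_nat k) a = of_nat k"
  by (induction k) (simp_all add: meval_add)

lemma meval_uminus: "meval (- p) a = - meval p (a :: nat \<Rightarrow> 'a::comm_ring_1)"
  using meval_add[of p "- p" a] by (simp add: eq_neg_iff_add_eq_0 add.commute)

lemma meval_diff: "meval (p - q) a = meval p a - meval q (a :: nat \<Rightarrow> 'a::comm_ring_1)"
  using meval_add[of p "- q" a] by (simp add: meval_uminus)

lemma meval_of_int [simp]: "meval (of_int k) (a :: nat \<Rightarrow> 'a::comm_ring_1) = of_int k"
  by (cases k) (simp_all add: meval_uminus meval_add meval_diff)

lemma meval_prod: "meval (prod f I) a = (\<Prod>i\<in>I. meval (f i) a)"
  by (induction I rule: infinite_finite_induct) (simp_all add: meval_mult)

lemma meval_poly_binom: "meval (poly_binom p b) a = (meval p a gchoose b)"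
  by (simp add: poly_binom_def meval_mult meval_prod meval_diff gbinomial_prod_rev atLeast0LessThan)

section \<open>Closure properties of polynomials without the variable of index 0\<close>

lemma x_polys_add: "p \<in> x_polys \<Longrightarrow> q \<in> x_polys \<Longrightarrow> p + q \<in> x_polys"
  using keys_add[of p q] by (auto simp: x_polys_def)

lemma x_polys_mult: "p \<in> x_polys \<Longrightarrow> q \<in> x_polys \<Longrightarrow> p * q \<in> x_polys"
proof -
  assume pq: "p \<in> x_polys" "q \<in> x_polys"
  have "0 \<notin> keys m" if m: "m \<in> keys (p * q)" for m
  proof -
    obtain m1 m2 where "m1 \<in> keys p" "m2 \<in> keys q" "m = m1 + m2"
      using keys_mult[of p q] m by blast
    then show ?thesis using keys_add[of m1 m2] pq by (auto simp: x_polys_def)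
  qed
  then show ?thesis by (simp add: x_polys_def)
qed

lemma x_polys_mconst: "mconst c \<in> x_polys"
  by (simp add: x_polys_def mconst_def)

lemma x_polys_0: "0 \<in> x_polys"
  by (simp add: x_polys_def)

lemma x_polys_1: "1 \<in> x_polys"
  by (simp add: x_polys_def)

lemma x_polys_uminus: "p \<in> x_polys \<Longrightarrow> - p \<in> x_polys"
  by (simp add: x_polys_def in_keys_iff)

lemma x_polys_diff: "p \<in> x_polys \<Longrightarrow> q \<in> x_polys \<Longrightarrow> p - q \<in> x_polys"
  using x_polys_add[of p "- q"] x_polys_uminus[of q] by simp

lemma x_polys_of_nat: "of_nat k \<in> x_polys"
  by (induction k) (auto intro: x_polys_0 x_polys_1 x_polys_add)

lemma x_polys_of_int: "of_int k \<in> x_polys"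
proof (cases k)
  case (nonneg n)
  then show ?thesis by (simp add: x_polys_of_nat)
next
  case (neg n)
  have "- of_nat (Suc n) \<in> x_polys" by (intro x_polys_uminus x_polys_of_nat)
  then show ?thesis using neg by simp
qed

lemma x_polys_mvar: "1 \<le> i \<Longrightarrow> mvar i \<in> x_polys"
  by (simp add: x_polys_def mvar_def)

lemma x_polys_sum: "(\<And>i. i \<in> I \<Longrightarrow> f i \<in> x_polys) \<Longrightarrow> sum f I \<in> x_polys"
  by (induction I rule: infinite_finite_induct) (auto intro: x_polys_0 x_polys_add)

lemma x_polys_prod: "(\<And>i. i \<in> I \<Longrightarrow> f i \<in> x_polys) \<Longrightarrow> prod f I \<in> x_polys"
  by (induction I rule: infinite_finite_induct) (auto intro: x_polys_1 x_polys_mult)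

lemma x_polys_x_binom: "is_partition \<beta> \<Longrightarrow> x_binom \<beta> \<in> x_polys"
  unfolding x_binom_def poly_binom_def is_partition_def
  by (intro x_polys_prod x_polys_mult x_polys_mconst x_polys_diff x_polys_mvar x_polys_of_nat)
    (metis One_nat_def not_less_eq_eq le0 Suc_leI neq0_conv)

section \<open>A polynomial is determined by its values at cycle types\<close>

lemma digits_less:
  fixes x :: "nat \<Rightarrow> nat"
  assumes "\<And>i. i < k \<Longrightarrow> x i < B"
  shows "(\<Sum>i<k. x i * B ^ i) < B ^ k"
  using assms
proof (induction k)
  case (Suc k)
  have "(\<Sum>i<Suc k. x i * B ^ i) < B ^ k + x k * B ^ k" using Suc by simp
  also have "\<dots> = Suc (x k) * B ^ k" by simp
  also have "\<dots> \<le> B * B ^ k" using Suc.prems[of k] by (intro mult_right_mono) auto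
  finally show ?case by simp
qed simp

lemma digits_inj:
  fixes x y :: "nat \<Rightarrow> nat"
  assumes "\<And>i. i < k \<Longrightarrow> x i < B" "\<And>i. i < k \<Longrightarrow> y i < B"
    and "(\<Sum>i<k. x i * B ^ i) = (\<Sum>i<k. y i * B ^ i)" and "i < k"
  shows "x i = y i"
  using assms
proof (induction k)
  case (Suc k)
  let ?X = "\<Sum>i<k. x i * B ^ i" and ?Y = "\<Sum>i<k. y i * B ^ i"
  have lt: "?X < B ^ k" "?Y < B ^ k" using Suc.prems by (auto intro: digits_less)
  have eq: "?X + x k * B ^ k = ?Y + y k * B ^ k" using Suc.prems(3) by simp
  have d: "(X + z * c) div c = z" if "X < c" for X z c :: nat using that by simp
  have xy: "x k = y k" using d[OF lt(1), of "x k"] d[OF lt(2), of "y k"] eq by simp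
  then have "?X = ?Y" using eq by simp
  then show ?case using Suc xy by (cases "i = k") auto
qed simp

text \<open>Kronecker substitution \<open>x\<^sub>i = t ^ (B ^ i)\<close> reduces the claim to one variable.\<close>

lemma x_poly_eq_0:
  assumes p: "p \<in> x_polys"
    and ev: "\<And>a :: nat \<Rightarrow> nat. finite {i. a i \<noteq> 0} \<Longrightarrow> a 0 = 0 \<Longrightarrow> N \<le> (\<Sum>i | a i \<noteq> 0. i * a i) \<Longrightarrow>
      meval p (\<lambda>i. of_nat (a i)) = 0"
  shows "p = 0"
proof -
  let ?K = "keys p"
  \<comment> \<open>The second \<open>Suc\<close> ensures \<open>1 < k\<close>, so that
    \<open>a 1\<close> below is available.\<close>
  define k where "k = Suc (Suc (Max (insert 0 (\<Union>m\<in>?K. keys m))))"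
  define B where "B = Suc (Suc (Max (insert 0 (\<Union>m\<in>?K. lookup m ` keys m))))"
  have k: "i < k" if "m \<in> ?K" "i \<in> keys m" for m i
  proof -
    have "i \<le> Max (insert 0 (\<Union>m\<in>?K. keys m))" using that by (intro Max_ge) auto
    then show ?thesis by (simp add: k_def)
  qed
  have B: "lookup m i < B" if "m \<in> ?K" for m i
  proof (cases "i \<in> keys m")
    case True
    then have "lookup m i \<le> Max (insert 0 (\<Union>m\<in>?K. lookup m ` keys m))"
      using that by (intro Max_ge) auto
    then show ?thesis by (simp add: B_def)
  next
    case False
    then show ?thesis by (simp add: in_keys_iff B_def)
  qed
  define code where "code m = (\<Sum>i<k. lookup m i * B ^ i)" for m :: "nat \<Rightarrow>\<^sub>0 nat"
  have inj: "inj_on code ?K"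
  proof (rule inj_onI)
    fix m m' assume m: "m \<in> ?K" "m' \<in> ?K" "code m = code m'"
    show "m = m'"
    proof (rule poly_mapping_eqI)
      fix i
      show "lookup m i = lookup m' i"
      proof (cases "i < k")
        case True
        show ?thesis
          by (rule digits_inj[of k "lookup m" B "lookup m'"])
            (use m B True in \<open>auto simp: code_def\<close>)
      next
        case False
        then have "i \<notin> keys m" "i \<notin> keys m'" using k m by blast+
        then show ?thesis by (simp add: in_keys_iff)
      qed
    qed
  qed
  define Q where "Q = (\<Sum>m\<in>?K. monom (lookup p m) (code m))"
  have root: "poly Q (of_nat t) = 0" if t: "t \<ge> Suc N" for t
  proof -
    define a where "a i = (if 1 \<le> i \<and> i < k then t ^ (B ^ i) else 0)" for i
    have supp: "{i. a i \<noteq> 0} \<subseteq> {..<k}" by (auto simp: a_def)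
    then have fin: "finite {i. a i \<noteq> 0}" by (rule finite_subset) simp
    \<comment> \<open>The size condition is met by the 1-cycles alone, of which there are
      \<open>t ^ B\<close>.\<close>
    have "N \<le> t" using t by simp
    also have "t \<le> t ^ (B ^ 1)" using t by (intro self_le_power) (auto simp: B_def)
    also have "\<dots> = 1 * a 1" by (simp add: a_def k_def)
    also have "\<dots> \<le> (\<Sum>i | a i \<noteq> 0. i * a i)"
      using fin t by (intro member_le_sum[of 1 _ "\<lambda>i. i * a i"]) (auto simp: a_def k_def)
    finally have "meval p (\<lambda>i. of_nat (a i)) = 0" by (intro ev fin) (simp_all add: a_def)
    moreover have "mon_val (\<lambda>i. of_nat (a i)) m = (of_nat t :: complex) ^ code m" if m: "m \<in> ?K" for m
    proof -
      have "mon_val (\<lambda>i. of_nat (a i)) m = (\<Prod>i\<in>{..<k}. (of_nat (a i) :: complex) ^ lookup m i)"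
        using k[OF m] by (intro mon_val_superset) auto
      also have "\<dots> = (\<Prod>i\<in>{..<k}. (of_nat t) ^ (lookup m i * B ^ i))"
      proof (intro prod.cong refl)
        fix i assume i: "i \<in> {..<k}"
        show "(of_nat (a i) :: complex) ^ lookup m i = of_nat t ^ (lookup m i * B ^ i)"
        proof (cases "i = 0")
          \<comment> \<open>\<open>a 0\<close> is 0 and not \<open>t\<close>, but no monomial of
            \<open>p\<close> contains the index 0.\<close>
          case True
          then have "lookup m i = 0" using p m by (auto simp: x_polys_def in_keys_iff)
          then show ?thesis by simp
        next
          case False
          then show ?thesis using i by (simp add: a_def power_mult[symmetric] mult.commute)
        qed
      qed
      also have "\<dots> = of_nat t ^ code m" by (simp add: code_def power_sum)
      finally show ?thesis .
    qed
    ultimately show ?thesis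
      by (simp add: Q_def poly_sum poly_monom meval_superset[OF finite_keys order_refl])
  qed
  have "Q = 0"
  proof (rule ccontr)
    assume "Q \<noteq> 0"
    then have "finite {x. poly Q x = 0}" by (rule poly_roots_finite)
    moreover have "of_nat ` {Suc N..} \<subseteq> {x. poly Q x = 0}" using root by auto
    ultimately have "finite ((of_nat :: nat \<Rightarrow> complex) ` {Suc N..})" by (rule rev_finite_subset)
    then have "finite {Suc N..}" by (rule finite_imageD) (simp add: inj_on_def)
    then show False using infinite_Ici by blast
  qed
  have "lookup p m = 0" if m: "m \<in> ?K" for m
  proof -
    \<comment> \<open>The codes are distinct, so no two monomials of \<open>p\<close> merge in
      \<open>Q\<close>.\<close>
    have "coeff Q (code m) = (\<Sum>m'\<in>?K. if m' = m then lookup p m' else 0)"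
      unfolding Q_def coeff_sum using inj m by (intro sum.cong) (auto simp: inj_on_def)
    then show ?thesis using \<open>Q = 0\<close> m by simp
  qed
  then show ?thesis by (intro poly_mapping_eqI) (metis in_keys_iff lookup_zero)
qed

text \<open>The new cycle is put on the fresh points from \<open>n + 1\<close> to
  \<open>n + i\<close>, where it leaves the old orbits alone.\<close>

lemma extend_by_cycle:
  assumes s: "\<sigma> permutes {1..n}" and i: "1 \<le> i"
  shows "\<exists>\<sigma>'. \<sigma>' permutes {1..n + i} \<and> (\<forall>j. cycle_count (n + i) \<sigma>' j = cycle_count n \<sigma> j + (if j = i then 1 else 0))"
proof -
  define \<sigma>' where "\<sigma>' x = (if x \<le> n then \<sigma> x else if x < n + i then Suc x else if x = n + i then Suc n else x)" for x
  have sle: "\<sigma> x \<le> n" if "x \<le> n" for x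
    using permutes_in_image[OF s, of x] permutes_not_in[OF s, of x] that by (cases "x = 0") auto
  have "\<sigma>' permutes {1..n + i}"
  proof (rule inj_imp_permutes)
    show "inj_on \<sigma>' {1..n + i}"
    proof (rule inj_onI)
      fix x y assume xy: "x \<in> {1..n + i}" "y \<in> {1..n + i}" "\<sigma>' x = \<sigma>' y"
      show "x = y"
      proof (cases "x \<le> n \<or> y \<le> n")
        case True
        then have "x \<le> n \<and> y \<le> n" using xy sle[of x] sle[of y] by (auto simp: \<sigma>'_def split: if_splits)
        then show ?thesis using xy(3) permutes_inj[OF s] by (simp add: \<sigma>'_def inj_eq)
      next
        case False
        then show ?thesis using xy by (auto simp: \<sigma>'_def split: if_splits)
      qed
    qed
    show "\<sigma>' x \<in> {1..n + i}" if "x \<in> {1..n + i}" for x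
      using that sle[of x] permutes_in_image[OF s, of x] i by (auto simp: \<sigma>'_def)
    show "\<sigma>' x = x" if "x \<notin> {1..n + i}" for x
      using that permutes_not_in[OF s, of x] by (auto simp: \<sigma>'_def)
  qed simp
  moreover have old: "orbit \<sigma>' x = orbit \<sigma> x" if x: "x \<in> {1..n}" for x
  proof (rule orbit_cong)
    show "x \<in> orbit \<sigma> x"
      by (rule permutation_self_in_orbit) (rule permutes_imp_permutation[OF _ s], simp)
    show "\<sigma>' y = \<sigma> y" if "y \<in> orbit \<sigma> x" for y
      using permutes_orbit_subset[OF s x] that by (auto simp: \<sigma>'_def)
  qed
  have new0: "orbit \<sigma>' (n + i) = {n + 1..n + i}"
  proof (intro equalityI subsetI)
    fix y assume "y \<in> orbit \<sigma>' (n + i)"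
    then show "y \<in> {n + 1..n + i}" by induction (use i in \<open>auto simp: \<sigma>'_def\<close>)
  next
    have "n + Suc k \<in> orbit \<sigma>' (n + i)" if "Suc k \<le> i" for k
      using that
    proof (induction k)
      case 0
      have "\<sigma>' (n + i) = n + Suc 0" using i by (simp add: \<sigma>'_def)
      then show ?case using orbit.base[of \<sigma>' "n + i"] by simp
    next
      case (Suc k)
      have "\<sigma>' (n + Suc k) = n + Suc (Suc k)" using Suc.prems by (simp add: \<sigma>'_def)
      then show ?case using orbit.step[OF Suc.IH] Suc.prems by (metis Suc_leD)
    qed
    note r = this
    fix y assume "y \<in> {n + 1..n + i}"
    then show "y \<in> orbit \<sigma>' (n + i)" using r[of "y - n - 1"] by auto
  qed
  have new: "orbit \<sigma>' x = {n + 1..n + i}" if "x \<in> {n + 1..n + i}" for x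
  proof -
    have "cyclic_on \<sigma>' {n + 1..n + i}" unfolding cyclic_on_def using new0 i
      by (intro bexI[of _ "n + i"]) auto
    then show ?thesis using that by (rule orbit_cyclic_eq3)
  qed
  have "{1..n + i} = {1..n} \<union> {n + 1..n + i}" by auto
  then have im: "orbit \<sigma>' ` {1..n + i} = insert {n + 1..n + i} (orbit \<sigma> ` {1..n})"
  proof -
    assume e: "{1..n + i} = {1..n} \<union> {n + 1..n + i}"
    have "n + 1 \<in> {n + 1..n + i}" using i by simp
    then have c: "(\<lambda>_. {n + 1..n + i}) ` {n + 1..n + i} = {{n + 1..n + i}}" by (rule image_constant)
    have b: "orbit \<sigma>' ` {n + 1..n + i} = (\<lambda>_. {n + 1..n + i}) ` {n + 1..n + i}"
      by (rule image_cong[OF refl new])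
    have a: "orbit \<sigma>' ` {1..n} = orbit \<sigma> ` {1..n}"
      by (rule image_cong[OF refl old])
    show ?thesis unfolding e image_Un a b c by (rule Un_insert_right[THEN trans]) simp
  qed
  have "cycle_count (n + i) \<sigma>' j = cycle_count n \<sigma> j + (if j = i then 1 else 0)" for j
  proof -
    have notin: "{n + 1..n + i} \<notin> orbit \<sigma> ` {1..n}"
    proof
      assume "{n + 1..n + i} \<in> orbit \<sigma> ` {1..n}"
      then obtain x where "x \<in> {1..n}" "{n + 1..n + i} = orbit \<sigma> x" by blast
      then have "{n + 1..n + i} \<subseteq> {1..n}" using permutes_orbit_subset[OF s] by metis
      moreover have "n + 1 \<in> {n + 1..n + i}" using i by simp
      ultimately have "n + 1 \<in> {1..n}" by blast
      then show False by simp
    qed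
    have "{C \<in> insert {n + 1..n + i} (orbit \<sigma> ` {1..n}). card C = j} =
        (if j = i then insert {n + 1..n + i} {C \<in> orbit \<sigma> ` {1..n}. card C = j} else {C \<in> orbit \<sigma> ` {1..n}. card C = j})"
      by auto
    then show ?thesis using notin unfolding cycle_count_def im by simp
  qed
  ultimately show ?thesis by blast
qed

lemma permutation_of_type:
  assumes "0 \<notin># M"
  shows "\<exists>\<sigma>. \<sigma> permutes {1..sum_mset M} \<and> (\<forall>j. cycle_count (sum_mset M) \<sigma> j = count M j)"
  using assms
proof (induction M)
  case empty
  have "id permutes {1..0::nat}" by (rule permutes_id)
  then show ?case by (auto simp: cycle_count_def)
next
  case (add i M)
  then obtain \<sigma> where s: "\<sigma> permutes {1..sum_mset M}" "\<forall>j. cycle_count (sum_mset M) \<sigma> j = count M j"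
    by auto
  have "1 \<le> i" using add.prems by (cases i) auto
  from extend_by_cycle[OF s(1) this] s(2) show ?case by (auto simp: add.commute)
qed

text \<open>Uniqueness of the polynomial in \<open>specht_poly\<close>: every vector of cycle counts
  of size at least \<open>N\<close> belongs to a permutation of exactly that many points.\<close>

lemma x_poly_eqI:
  assumes "p \<in> x_polys" "q \<in> x_polys"
    and ev: "\<And>n \<sigma>. N \<le> n \<Longrightarrow> \<sigma> permutes {1..n} \<Longrightarrow>
      meval p (\<lambda>i. of_nat (cycle_count n \<sigma> i)) = meval q (\<lambda>i. of_nat (cycle_count n \<sigma> i))"
  shows "p = q"
proof -
  have "p - q = 0"
  proof (rule x_poly_eq_0[of _ N])
    show "p - q \<in> x_polys" using assms by (intro x_polys_diff)
    fix a :: "nat \<Rightarrow> nat" assume a: "finite {i. a i \<noteq> 0}" "a 0 = 0" "N \<le> (\<Sum>i | a i \<noteq> 0. i * a i)"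
    define M where "M = (\<Sum>i | a i \<noteq> 0. replicate_mset (a i) i)"
    have cM: "count M i = a i" for i
      using a(1) by (cases "a i = 0") (auto simp: M_def count_sum)
    have "sum_mset (\<Sum>i\<in>I. replicate_mset (a i) i) = (\<Sum>i\<in>I. i * a i)" for I
      by (induction I rule: infinite_finite_induct) (auto simp: mult.commute)
    then have sM: "sum_mset M = (\<Sum>i | a i \<noteq> 0. i * a i)" by (simp add: M_def)
    have "0 \<notin># M" using a(2) by (simp add: not_in_iff cM)
    from permutation_of_type[OF this] obtain \<sigma> where
      "\<sigma> permutes {1..sum_mset M}" "\<forall>j. cycle_count (sum_mset M) \<sigma> j = a j" by (auto simp: cM)
    then show "meval (p - q) (\<lambda>i. of_nat (a i)) = 0"
      using ev[of "sum_mset M" \<sigma>] a(3) by (simp add: meval_diff sM)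
  qed
  then show ?thesis by simp
qed

section \<open>Counting chains of unions of cycles\<close>

lemma partition_binom_superset:
  assumes "finite K" "set_mset \<beta> \<subseteq> K"
  shows "partition_binom \<alpha> \<beta> = (\<Prod>i\<in>K. count \<alpha> i choose count \<beta> i)"
  unfolding partition_binom_def using assms
  by (intro prod.mono_neutral_left) (auto simp: not_in_iff)

text \<open>Pascal's rule in the factor for \<open>i\<close>; the other factors do not
  change.\<close>

lemma partition_binom_add_mset:
  "partition_binom (add_mset i \<alpha>) \<beta> = partition_binom \<alpha> \<beta> +
     (if i \<in># \<beta> then partition_binom \<alpha> (\<beta> - {#i#}) else 0)"
proof (cases "i \<in># \<beta>")
  case True
  let ?K = "set_mset \<beta> - {i}"
  have split: "partition_binom \<alpha>' \<beta>' = (count \<alpha>' i choose count \<beta>' i) * (\<Prod>j\<in>?K. count \<alpha>' j choose count \<beta>' j)"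
    if "set_mset \<beta>' \<subseteq> set_mset \<beta>" for \<alpha>' \<beta>'
    using partition_binom_superset[OF _ that, of \<alpha>'] prod.remove[OF _ True, of "\<lambda>j. count \<alpha>' j choose count \<beta>' j"] by simp
  have rest: "(\<Prod>j\<in>?K. count \<alpha>' j choose count \<beta>' j) = (\<Prod>j\<in>?K. count \<alpha> j choose count \<beta> j)"
    if "\<And>j. j \<noteq> i \<Longrightarrow> count \<alpha>' j = count \<alpha> j \<and> count \<beta>' j = count \<beta> j" for \<alpha>' \<beta>'
    using that by (intro prod.cong) auto
  obtain b where b: "count \<beta> i = Suc b" using True by (metis count_eq_zero_iff not0_implies_Suc)
  have "partition_binom (add_mset i \<alpha>) \<beta> = (Suc (count \<alpha> i) choose Suc b) * (\<Prod>j\<in>?K. count \<alpha> j choose count \<beta> j)"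
    using split[OF order.refl, of "add_mset i \<alpha>"] rest[of "add_mset i \<alpha>" \<beta>] by (simp add: b)
  moreover have "partition_binom \<alpha> \<beta> = (count \<alpha> i choose Suc b) * (\<Prod>j\<in>?K. count \<alpha> j choose count \<beta> j)"
    using split[OF order.refl, of \<alpha>] by (simp add: b)
  moreover have "partition_binom \<alpha> (\<beta> - {#i#}) = (count \<alpha> i choose b) * (\<Prod>j\<in>?K. count \<alpha> j choose count \<beta> j)"
    using split[of "\<beta> - {#i#}" \<alpha>] rest[of \<alpha> "\<beta> - {#i#}"] by (auto simp: b dest: in_diffD)
  ultimately show ?thesis using True by (simp add: algebra_simps)
next
  case False
  then show ?thesis unfolding partition_binom_def by (auto intro!: prod.cong)
qed

definition type_of :: "('c \<Rightarrow> nat) \<Rightarrow> 'c set \<Rightarrow> nat multiset" where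
  "type_of s A = image_mset s (mset_set A)"

text \<open>A subset of \<open>insert c A\<close> omits or contains \<open>c\<close>, which matches
  the two terms of Pascal's rule.\<close>

lemma card_subsets_of_type:
  assumes "finite A"
  shows "card {B. B \<subseteq> A \<and> type_of s B = \<beta>} = partition_binom (type_of s A) \<beta>"
  using assms
proof (induction A arbitrary: \<beta>)
  case empty
  have "{B. B \<subseteq> {} \<and> type_of s B = \<beta>} = (if \<beta> = {#} then {{}} else {})" by (auto simp: type_of_def)
  moreover have "partition_binom {#} \<beta> = (if \<beta> = {#} then 1 else 0)"
    by (auto simp: partition_binom_def binomial_eq_0_iff count_eq_zero_iff)
  ultimately show ?case by (simp add: type_of_def)
next
  case (insert c A)
  have ins: "type_of s (insert c B) = add_mset (s c) (type_of s B)" if "B \<subseteq> A" for B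
  proof -
    have "finite B" "c \<notin> B" using insert that finite_subset by auto
    then show ?thesis by (simp add: type_of_def)
  qed
  let ?without = "{B. B \<subseteq> A \<and> type_of s B = \<beta>}" and ?with = "{B. B \<subseteq> A \<and> add_mset (s c)
    (type_of s B) = \<beta>}"
  have fin: "finite {B. B \<subseteq> A \<and> P B}" for P using insert by simp
  have "{B. B \<subseteq> insert c A \<and> type_of s B = \<beta>} = ?without \<union> insert c ` ?with"
  proof (intro equalityI subsetI)
    fix B assume B: "B \<in> {B. B \<subseteq> insert c A \<and> type_of s B = \<beta>}"
    show "B \<in> ?without \<union> insert c ` ?with"
    proof (cases "c \<in> B")
      case True
      then have e: "B = insert c (B - {c})" "B - {c} \<subseteq> A" using B by auto
      then have "B - {c} \<in> ?with" using B ins[OF e(2)] by auto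
      then show ?thesis using e(1) by blast
    next
      case False
      then show ?thesis using B by auto
    qed
  next
    fix B assume "B \<in> ?without \<union> insert c ` ?with"
    then show "B \<in> {B. B \<subseteq> insert c A \<and> type_of s B = \<beta>}" using ins by auto
  qed
  moreover have "card (?without \<union> insert c ` ?with) = card ?without + card (insert c ` ?with)"
    using insert(2) by (intro card_Un_disjoint finite_imageI fin) auto
  moreover have "card (insert c ` ?with) = card ?with"
    using insert(2) by (intro card_image)
      (auto simp: inj_on_def dest!: insert_ident[THEN iffD1, rotated 2])
  moreover have "card ?with = (if s c \<in># \<beta> then partition_binom (type_of s A) (\<beta> - {#s c#}) else 0)"
  proof (cases "s c \<in># \<beta>")
    case True
    then have "?with = {B. B \<subseteq> A \<and> type_of s B = \<beta> - {#s c#}}" by auto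
    then show ?thesis using True insert.IH by simp
  next
    case False
    then have e: "?with = {}" by auto
    show ?thesis unfolding e using False by simp
  qed
  ultimately show ?case
    using insert.IH[of \<beta>] insert(1,2) ins[of A] by (simp add: partition_binom_add_mset)
qed

text \<open>The number of descending chains of subsets with prescribed types in a set of type
  \<open>\<alpha>\<close>; see \<open>card_functions_with_levels\<close>.\<close>

fun chain_prod :: "nat multiset \<Rightarrow> nat multiset list \<Rightarrow> nat" where
  "chain_prod \<alpha> [] = 1"
| "chain_prod \<alpha> (\<beta> # \<beta>s) = partition_binom \<alpha> \<beta> * chain_prod \<beta> \<beta>s"

lemma chain_prod_nth:
  "\<beta>s \<noteq> [] \<Longrightarrow> chain_prod \<alpha> \<beta>s =
     partition_binom \<alpha> (\<beta>s ! 0) * (\<Prod>j<length \<beta>s - 1. partition_binom (\<beta>s ! j) (\<beta>s ! Suc j))"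
proof (induction \<beta>s arbitrary: \<alpha>)
  case (Cons \<beta> \<beta>s)
  show ?case
  proof (cases \<beta>s)
    case (Cons \<gamma> \<gamma>s)
    then have "chain_prod \<beta> \<beta>s = partition_binom \<beta> (\<beta>s ! 0) *
       (\<Prod>j<length \<beta>s - 1. partition_binom (\<beta>s ! j) (\<beta>s ! Suc j))" by (intro Cons.IH) simp
    then show ?thesis using Cons by (simp add: prod.lessThan_Suc_shift del: prod.lessThan_Suc)
  qed simp
qed simp

text \<open>A function \<open>y : A \<rightarrow> {0..d}\<close> encodes the chain of its superlevel sets \<open>{y \<ge> 1} \<supseteq> \<dots> \<supseteq> {y \<ge> d}\<close>.\<close>

definition levels :: "('c \<Rightarrow> nat) \<Rightarrow> 'c set \<Rightarrow> nat \<Rightarrow> ('c \<Rightarrow> nat) \<Rightarrow> nat multiset list" where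
  "levels s A d y = map (\<lambda>j. type_of s {c \<in> A. Suc j \<le> y c}) [0..<d]"

text \<open>A function is given by the set \<open>B\<close> where it is at least 1 and by its values
  minus 1 on \<open>B\<close>; the levels above the first are those of the latter.\<close>

lemma card_functions_with_levels:
  assumes "finite A"
  shows "card {y \<in> A \<rightarrow>\<^sub>E {..length \<beta>s}. levels s A (length \<beta>s) y = \<beta>s} = chain_prod (type_of s A) \<beta>s"
  using assms
proof (induction \<beta>s arbitrary: A)
  case Nil
  have "card (A \<rightarrow>\<^sub>E {..0::nat}) = 1" using Nil by (simp add: card_PiE)
  then show ?case by (simp add: levels_def)
next
  case (Cons \<beta> \<beta>s)
  let ?d = "length \<beta>s"
  let ?F = "{y \<in> A \<rightarrow>\<^sub>E {..Suc ?d}. levels s A (Suc ?d) y = \<beta> # \<beta>s}"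
  let ?S = "Sigma {B. B \<subseteq> A \<and> type_of s B = \<beta>} (\<lambda>B. {y \<in> B \<rightarrow>\<^sub>E {..?d}. levels s B ?d y = \<beta>s})"
  define up :: "'a set \<times> ('a \<Rightarrow> nat) \<Rightarrow> 'a \<Rightarrow> nat"
    where "up = (\<lambda>(B, y). \<lambda>c\<in>A. if c \<in> B then Suc (y c) else 0)"
  define down :: "('a \<Rightarrow> nat) \<Rightarrow> 'a set \<times> ('a \<Rightarrow> nat)"
    where "down y = ({c \<in> A. 1 \<le> y c}, \<lambda>c\<in>{c \<in> A. 1 \<le> y c}. y c - 1)" for y
  have lev: "levels s A (Suc d) y
    = type_of s {c \<in> A. 1 \<le> y c} # levels s {c \<in> A. 1 \<le> y c} d (\<lambda>c\<in>{c \<in> A. 1 \<le> y c}. y c - 1)" for d y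
  proof -
    have "{c \<in> A. Suc (Suc j) \<le> y c} = {c \<in> {c \<in> A. 1 \<le> y c}. Suc j \<le> (\<lambda>c\<in>{c \<in> A. 1 \<le> y c}. y c - 1) c}" for j
      by auto
    then show ?thesis unfolding levels_def upt_conv_Cons[OF zero_less_Suc] list.map map_Suc_upt[symmetric]
      by (simp add: One_nat_def)
  qed
  have "bij_betw up ?S ?F"
  proof (rule bij_betw_byWitness[of _ down])
    have du: "down (up (B, y)) = (B, y)" if "B \<subseteq> A" "y \<in> B \<rightarrow>\<^sub>E {..?d}" for B y
    proof -
      have "{c \<in> A. 1 \<le> up (B, y) c} = B" using that(1) by (auto simp: up_def)
      moreover have "(\<lambda>c\<in>B. up (B, y) c - 1) = y"
        using that by (auto simp: up_def fun_eq_iff PiE_iff extensional_def)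
      ultimately show ?thesis by (simp add: down_def)
    qed
    then show "\<forall>x\<in>?S. down (up x) = x" by auto
    show "\<forall>y\<in>?F. up (down y) = y"
      by (auto simp: up_def down_def fun_eq_iff PiE_iff extensional_def)
    show "up ` ?S \<subseteq> ?F"
    proof
      fix x assume "x \<in> up ` ?S"
      then obtain B y where x: "x = up (B, y)" and B: "B \<subseteq> A" "type_of s B = \<beta>"
        and y: "y \<in> B \<rightarrow>\<^sub>E {..?d}" "levels s B ?d y = \<beta>s" by auto
      have "up (B, y) \<in> A \<rightarrow>\<^sub>E {..Suc ?d}" using y(1) by (auto simp: up_def PiE_iff)
      moreover have "levels s A (Suc ?d) (up (B, y)) = \<beta> # \<beta>s"
      proof -
        have e: "{c \<in> A. 1 \<le> up (B, y) c} = B"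
          "(\<lambda>c\<in>{c \<in> A. 1 \<le> up (B, y) c}. up (B, y) c - 1) = y"
          using du[OF B(1) y(1)] unfolding down_def prod.inject by blast+
        show ?thesis unfolding lev e(2) unfolding e(1) B(2) y(2) by (rule refl)
      qed
      ultimately show "x \<in> ?F" by (simp add: x)
    qed
    show "down ` ?F \<subseteq> ?S"
    proof
      fix x assume "x \<in> down ` ?F"
      then obtain y where x: "x = down y" and y: "y \<in> A \<rightarrow>\<^sub>E {..Suc ?d}" "levels s A (Suc ?d) y = \<beta> # \<beta>s" by blast
      have "(\<lambda>c\<in>{c \<in> A. 1 \<le> y c}. y c - 1) \<in> {c \<in> A. 1 \<le> y c} \<rightarrow>\<^sub>E {..?d}"
        using y(1) by (auto simp: PiE_iff)
      then show "x \<in> ?S" using y(2) unfolding lev down_def x by auto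
    qed
  qed
  then have "card ?F = card ?S" by (simp add: bij_betw_same_card)
  also have "\<dots> = (\<Sum>B | B \<subseteq> A \<and> type_of s B = \<beta>. card {y \<in> B \<rightarrow>\<^sub>E {..?d}. levels s B ?d y = \<beta>s})"
  proof (rule card_SigmaI)
    show "finite {B. B \<subseteq> A \<and> type_of s B = \<beta>}" using Cons.prems by simp
    show "\<forall>B\<in>{B. B \<subseteq> A \<and> type_of s B = \<beta>}. finite {y \<in> B \<rightarrow>\<^sub>E {..?d}. levels s B ?d y = \<beta>s}"
    proof
      fix B assume "B \<in> {B. B \<subseteq> A \<and> type_of s B = \<beta>}"
      then have "finite B" using Cons.prems finite_subset by auto
      then have "finite (B \<rightarrow>\<^sub>E {..?d})" by (rule finite_PiE) simp
      then show "finite {y \<in> B \<rightarrow>\<^sub>E {..?d}. levels s B ?d y = \<beta>s}" by simp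
    qed
  qed
  also have "\<dots> = (\<Sum>B | B \<subseteq> A \<and> type_of s B = \<beta>. chain_prod \<beta> \<beta>s)"
    using Cons.IH Cons.prems finite_subset by (intro sum.cong refl) auto
  also have "\<dots> = chain_prod (type_of s A) (\<beta> # \<beta>s)"
    by (simp add: card_subsets_of_type[OF Cons.prems])
  finally show ?case by simp
qed

section \<open>Fixed words as functions on the cycles\<close>

definition cycles_of :: "nat \<Rightarrow> (nat \<Rightarrow> nat) \<Rightarrow> nat set set" where
  "cycles_of n \<sigma> = orbit \<sigma> ` {1..n}"

lemma count_type_of:
  "finite A \<Longrightarrow> count (type_of s A) i = card {c \<in> A. s c = i}"
  by (simp add: type_of_def count_image_mset_eq_card_vimage)

lemma sum_mset_type_of: "sum_mset (type_of s A) = (\<Sum>c\<in>A. s c)"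
  by (simp add: type_of_def sum_unfold_sum_mset)

text \<open>At cycle counts \<open>x_binom\<close> becomes \<open>partition_binom\<close> of the
  cycle type, the top of the chain.\<close>

lemma meval_tuple_coeff:
  assumes "length \<beta>s = d" "d \<ge> 1"
  shows "meval (tuple_coeff d \<beta>s) (\<lambda>i. of_nat (cycle_count n \<sigma> i)) =
    of_nat (chain_prod (type_of card (cycles_of n \<sigma>)) \<beta>s)"
proof -
  have "meval (x_binom \<beta>) (\<lambda>i. of_nat (cycle_count n \<sigma> i)) =
      of_nat (partition_binom (type_of card (cycles_of n \<sigma>)) \<beta>)" for \<beta>
    by (simp add: x_binom_def meval_prod meval_poly_binom partition_binom_def count_type_of
        cycles_of_def cycle_count_def binomial_gbinomial)
  moreover have "\<beta>s \<noteq> []" using assms by auto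
  ultimately show ?thesis
    using assms by (simp add: tuple_coeff_def meval_mult meval_prod chain_prod_nth)
qed

text \<open>A word is fixed by \<open>\<sigma>\<close> exactly when it is constant on
  cycles.\<close>

lemma fixed_words_bij:
  assumes s: "\<sigma> permutes {1..n}"
  shows "bij_betw (\<lambda>y. \<lambda>a\<in>{1..n}. y (orbit \<sigma> a)) (cycles_of n \<sigma> \<rightarrow>\<^sub>E D) {z \<in> {1..n} \<rightarrow>\<^sub>E D. z \<circ> \<sigma> = z}"
proof -
  have perm: "permutation \<sigma>" by (rule permutes_imp_permutation[OF _ s]) simp
  have step: "orbit \<sigma> (\<sigma> a) = orbit \<sigma> a" for a
  proof -
    have "cyclic_on \<sigma> (orbit \<sigma> a)" by (rule cyclic_on_orbit'[OF perm])
    moreover have "\<sigma> a \<in> orbit \<sigma> a" by (rule orbit.base)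
    ultimately show ?thesis by (rule orbit_cyclic_eq3)
  qed
  have s_in: "\<sigma> a \<in> {1..n} \<longleftrightarrow> a \<in> {1..n}" for a using permutes_in_image[OF s] .
  let ?f = "\<lambda>y. \<lambda>a\<in>{1..n}. y (orbit \<sigma> a)"
  show ?thesis
  proof (rule bij_betw_imageI)
    show "inj_on ?f (cycles_of n \<sigma> \<rightarrow>\<^sub>E D)"
    proof (rule inj_onI)
      fix y y' assume y: "y \<in> cycles_of n \<sigma> \<rightarrow>\<^sub>E D" "y' \<in> cycles_of n \<sigma> \<rightarrow>\<^sub>E D" "?f y = ?f y'"
      show "y = y'"
      proof (rule PiE_ext[OF y(1,2)])
        fix C assume "C \<in> cycles_of n \<sigma>"
        then obtain a where "a \<in> {1..n}" "C = orbit \<sigma> a" by (auto simp: cycles_of_def)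
        then show "y C = y' C" using fun_cong[OF y(3), of a] by simp
      qed
    qed
    show "?f ` (cycles_of n \<sigma> \<rightarrow>\<^sub>E D) = {z \<in> {1..n} \<rightarrow>\<^sub>E D. z \<circ> \<sigma> = z}"
    proof (intro equalityI subsetI)
      fix z assume "z \<in> ?f ` (cycles_of n \<sigma> \<rightarrow>\<^sub>E D)"
      then obtain y where y: "y \<in> cycles_of n \<sigma> \<rightarrow>\<^sub>E D" "z = ?f y" by blast
      have "z (\<sigma> a) = z a" for a unfolding y(2) by (simp add: s_in step del: atLeastAtMost_iff)
      moreover have "z \<in> {1..n} \<rightarrow>\<^sub>E D" using y by (auto simp: cycles_of_def)
      ultimately show "z \<in> {z \<in> {1..n} \<rightarrow>\<^sub>E D. z \<circ> \<sigma> = z}" by (simp add: fun_eq_iff)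
    next
      fix z assume z: "z \<in> {z \<in> {1..n} \<rightarrow>\<^sub>E D. z \<circ> \<sigma> = z}"
      have const: "z b = z a" if "b \<in> orbit \<sigma> a" for a b
        using that z by induction (auto simp: fun_eq_iff)
      define y where "y = (\<lambda>C\<in>cycles_of n \<sigma>. z (SOME b. b \<in> C))"
      have y_orbit: "y (orbit \<sigma> a) = z a" if "a \<in> {1..n}" for a
      proof -
        have "(SOME b. b \<in> orbit \<sigma> a) \<in> orbit \<sigma> a"
          using orbit.base[of \<sigma> a] by (rule someI)
        then show ?thesis using const that by (simp add: y_def cycles_of_def)
      qed
      have "y \<in> cycles_of n \<sigma> \<rightarrow>\<^sub>E D"
      proof (rule PiE_I)
        fix C assume "C \<in> cycles_of n \<sigma>"
        then obtain a where "a \<in> {1..n}" "C = orbit \<sigma> a" by (auto simp: cycles_of_def)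
        then show "y C \<in> D" using y_orbit z by auto
      qed (simp add: y_def)
      moreover have "?f y = z"
        using z y_orbit by (auto simp: fun_eq_iff PiE_iff extensional_def)
      ultimately show "z \<in> ?f ` (cycles_of n \<sigma> \<rightarrow>\<^sub>E D)" by blast
    qed
  qed
qed

text \<open>The exponent of the product of the \<open>y\<^sub>i\<close> over the letters
  \<open>i\<close> of the word, since \<open>w\<^sub>l\<close> divides \<open>y\<^sub>i\<close>
  exactly for \<open>l \<le> i\<close>; the letter 0 contributes nothing.\<close>

definition tail_content :: "nat \<Rightarrow> nat \<Rightarrow> (nat \<Rightarrow> nat) \<Rightarrow> (nat \<Rightarrow>\<^sub>0 nat)" where
  "tail_content n d z = (\<Sum>l = 1..d. single l (card {a \<in> {1..n}. l \<le> z a}))"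

lemma lookup_tail_content:
  "lookup (tail_content n d z) l = (if l \<in> {1..d} then card {a \<in> {1..n}. l \<le> z a} else 0)"
  unfolding tail_content_def by (rule lookup_sum_single) simp

text \<open>The cycles with value at least \<open>l\<close> are disjoint and cover the places with
  letters at least \<open>l\<close>, so their lengths add up to the number of these places.\<close>

lemma tuple_exponent_levels:
  assumes s: "\<sigma> permutes {1..n}"
  shows "tuple_exponent d (levels card (cycles_of n \<sigma>) d y) = tail_content n d (\<lambda>a\<in>{1..n}. y (orbit \<sigma> a))"
proof (rule poly_mapping_eqI)
  fix l
  have perm: "permutation \<sigma>" by (rule permutes_imp_permutation[OF _ s]) simp
  show "lookup (tuple_exponent d (levels card (cycles_of n \<sigma>) d y)) l =
      lookup (tail_content n d (\<lambda>a\<in>{1..n}. y (orbit \<sigma> a))) l"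
  proof (cases "l \<in> {1..d}")
    case True
    let ?S = "{C \<in> cycles_of n \<sigma>. l \<le> y C}"
    have "levels card (cycles_of n \<sigma>) d y ! (l - 1) = type_of card ?S"
      using True by (cases l) (auto simp: levels_def)
    then have "lookup (tuple_exponent d (levels card (cycles_of n \<sigma>) d y)) l = (\<Sum>C\<in>?S. card C)"
      using True by (simp add: lookup_tuple_exponent sum_mset_type_of)
    also have "\<dots> = card (\<Union>C\<in>?S. C)"
    proof (rule card_UN_disjoint[symmetric])
      show "finite ?S" by (simp add: cycles_of_def)
      show "\<forall>C\<in>?S. finite C"
        using permutes_orbit_subset[OF s] finite_subset by (auto simp: cycles_of_def) blast
      show "\<forall>C\<in>?S. \<forall>C'\<in>?S. C \<noteq> C' \<longrightarrow> C \<inter> C' = {}"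
      proof (intro ballI impI)
        fix C C' assume C: "C \<in> ?S" "C' \<in> ?S" "C \<noteq> C'"
        have "cyclic_on \<sigma> X" if "X \<in> ?S" for X
          using that cyclic_on_orbit'[OF perm] by (auto simp: cycles_of_def)
        then show "C \<inter> C' = {}" using C orbit_cyclic_eq3[of \<sigma>] by blast
      qed
    qed
    also have "(\<Union>C\<in>?S. C) = {a \<in> {1..n}. l \<le> (\<lambda>a\<in>{1..n}. y (orbit \<sigma> a)) a}"
    proof (intro equalityI subsetI)
      fix a assume "a \<in> (\<Union>C\<in>?S. C)"
      then obtain x where x: "x \<in> {1..n}" "l \<le> y (orbit \<sigma> x)" "a \<in> orbit \<sigma> x"
        by (auto simp: cycles_of_def)
      then have "orbit \<sigma> a = orbit \<sigma> x" using cyclic_on_orbit'[OF perm] by (intro orbit_cyclic_eq3)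
      moreover have "a \<in> {1..n}" using permutes_orbit_subset[OF s x(1)] x(3) by blast
      ultimately show "a \<in> {a \<in> {1..n}. l \<le> (\<lambda>a\<in>{1..n}. y (orbit \<sigma> a)) a}" using x(2) by simp
    next
      fix a assume "a \<in> {a \<in> {1..n}. l \<le> (\<lambda>a\<in>{1..n}. y (orbit \<sigma> a)) a}"
      then show "a \<in> (\<Union>C\<in>?S. C)"
        using permutation_self_in_orbit[OF perm, of a] by (auto simp: cycles_of_def)
    qed
    finally show ?thesis using True by (simp add: lookup_tail_content)
  next
    case False
    then show ?thesis by (simp only: lookup_tail_content lookup_tuple_exponent if_False)
  qed
qed

text \<open>The tuples of partitions sort the functions on cycles by the types of their superlevel
  sets, and the exponent of the tuple is that of the corresponding word. So at every permutation the
  series is the generating function of its fixed words.\<close>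

lemma meval_tuple_series:
  assumes s: "\<sigma> permutes {1..n}" and d: "d \<ge> 1"
  shows "meval (formal_sum (partition_tuples d) (tuple_coeff d) (tuple_exponent d) b)
    (\<lambda>i. of_nat (cycle_count n \<sigma> i)) =
    of_nat (card {z \<in> {1..n} \<rightarrow>\<^sub>E {..d}. z \<circ> \<sigma> = z \<and> tail_content n d z = b})"
proof -
  let ?C = "cycles_of n \<sigma>"
  let ?T = "{\<beta>s \<in> partition_tuples d. tuple_exponent d \<beta>s = b}"
  have finC: "finite ?C" by (simp add: cycles_of_def)
  have finF: "finite (?C \<rightarrow>\<^sub>E {..d})" by (rule finite_PiE[OF finC]) simp
  \<comment> \<open>Cycles are nonempty, so the types of the levels have no part 0 and are
    partitions.\<close>
  have pos: "card C \<noteq> 0" if C: "C \<in> ?C" for C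
  proof -
    obtain a where "a \<in> {1..n}" "C = orbit \<sigma> a" using C by (auto simp: cycles_of_def)
    then have "C \<noteq> {}" "finite C" using orbit.base[of \<sigma> a] permutes_orbit_subset[OF s] finite_subset
      by blast+
    then show ?thesis by simp
  qed
  have part: "levels card ?C d y \<in> partition_tuples d" for y
    using finC by (auto simp: partition_tuples_def levels_def is_partition_def type_of_def dest: pos)
  have "meval (formal_sum (partition_tuples d) (tuple_coeff d) (tuple_exponent d) b)
    (\<lambda>i. of_nat (cycle_count n \<sigma> i)) =
     (\<Sum>\<beta>s\<in>?T. of_nat (chain_prod (type_of card ?C) \<beta>s))"
    unfolding formal_sum_def meval_sum
    by (intro sum.cong refl meval_tuple_coeff d) (auto simp: partition_tuples_def)
  also have "\<dots> = of_nat (\<Sum>\<beta>s\<in>?T. card {y \<in> ?C \<rightarrow>\<^sub>E {..d}. levels card ?C d y = \<beta>s})"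
    unfolding of_nat_sum
  proof (intro sum.cong refl arg_cong[of _ _ of_nat])
    fix \<beta>s assume "\<beta>s \<in> ?T"
    then have "length \<beta>s = d" by (simp add: partition_tuples_def)
    then show "chain_prod (type_of card ?C) \<beta>s = card {y \<in> ?C \<rightarrow>\<^sub>E {..d}. levels card ?C d y = \<beta>s}"
      using card_functions_with_levels[OF finC, where \<beta>s = \<beta>s and s = card] by simp
  qed
  also have "(\<Sum>\<beta>s\<in>?T. card {y \<in> ?C \<rightarrow>\<^sub>E {..d}. levels card ?C d y = \<beta>s}) =
      card {y \<in> ?C \<rightarrow>\<^sub>E {..d}. tuple_exponent d (levels card ?C d y) = b}"
  proof -
    have "card (\<Union>\<beta>s\<in>?T. {y \<in> ?C \<rightarrow>\<^sub>E {..d}. levels card ?C d y = \<beta>s}) =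
       (\<Sum>\<beta>s\<in>?T. card {y \<in> ?C \<rightarrow>\<^sub>E {..d}. levels card ?C d y = \<beta>s})"
      by (rule card_UN_disjoint) (use finF finite_right_terms[of d b] in auto)
    moreover have "(\<Union>\<beta>s\<in>?T. {y \<in> ?C \<rightarrow>\<^sub>E {..d}. levels card ?C d y = \<beta>s}) =
        {y \<in> ?C \<rightarrow>\<^sub>E {..d}. tuple_exponent d (levels card ?C d y) = b}"
      using part by auto
    ultimately show ?thesis by simp
  qed
  also have "\<dots> = card {z \<in> {1..n} \<rightarrow>\<^sub>E {..d}. z \<circ> \<sigma> = z \<and> tail_content n d z = b}"
  proof -
    let ?f = "\<lambda>y. \<lambda>a\<in>{1..n}. y (orbit \<sigma> a)"
    have bij: "bij_betw ?f (?C \<rightarrow>\<^sub>E {..d}) {z \<in> {1..n} \<rightarrow>\<^sub>E {..d}. z \<circ> \<sigma> = z}"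
      by (rule fixed_words_bij[OF s])
    have "bij_betw ?f {y \<in> ?C \<rightarrow>\<^sub>E {..d}. tail_content n d (?f y) = b}
       {z \<in> {z \<in> {1..n} \<rightarrow>\<^sub>E {..d}. z \<circ> \<sigma> = z}. tail_content n d z = b}"
    proof (rule bij_betw_imageI)
      show "inj_on ?f {y \<in> ?C \<rightarrow>\<^sub>E {..d}. tail_content n d (?f y) = b}"
        using bij by (auto simp: bij_betw_def intro: inj_on_subset)
      have im: "?f ` (?C \<rightarrow>\<^sub>E {..d}) = {z \<in> {1..n} \<rightarrow>\<^sub>E {..d}. z \<circ> \<sigma> = z}" using bij
        by (simp add: bij_betw_def)
      have "f ` {y \<in> X. P (f y)} = {z \<in> f ` X. P z}" for f :: "'x \<Rightarrow> 'y" and X P by blast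
      then show "?f ` {y \<in> ?C \<rightarrow>\<^sub>E {..d}. tail_content n d (?f y) = b} =
          {z \<in> {z \<in> {1..n} \<rightarrow>\<^sub>E {..d}. z \<circ> \<sigma> = z}. tail_content n d z = b}" unfolding im[symmetric] .
    qed
    from bij_betw_same_card[OF this] show ?thesis by (simp add: tuple_exponent_levels[OF s])
  qed
  finally show ?thesis .
qed

section \<open>Assembling the generating function\<close>

lemma part_nth: "part \<mu> (Suc j) = nth_default 0 (rev (sorted_list_of_multiset \<mu>)) j"
  by (simp add: part_def)

lemma mem_le_part1:
  assumes "x \<in># \<mu>"
  shows "x \<le> part \<mu> 1"
proof -
  have "x \<in> set (rev (sorted_list_of_multiset \<mu>))" using assms by simp
  then obtain j where j: "j < length (rev (sorted_list_of_multiset \<mu>))" "rev (sorted_list_of_multiset \<mu>) ! j = x"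
    unfolding in_set_conv_nth by blast
  then have "part \<mu> (Suc j) = x" unfolding part_nth by (simp only: nth_default_nth)
  then show ?thesis using part_antimono[of 1 "Suc j" \<mu>] by simp
qed

text \<open>A partition has no part 0, so its length is visible in the padded sequence of
  parts.\<close>

lemma partition_eqI:
  assumes p: "is_partition \<mu>" "is_partition \<mu>'" and eq: "\<And>i. 1 \<le> i \<Longrightarrow> part \<mu> i = part \<mu>' i"
  shows "\<mu> = \<mu>'"
proof -
  define xs ys where "xs = rev (sorted_list_of_multiset \<mu>)" and "ys = rev (sorted_list_of_multiset \<mu>')"
  have nz: "0 \<notin> set xs" "0 \<notin> set ys" using p by (simp_all add: xs_def ys_def is_partition_def)
  have e: "nth_default 0 xs j = nth_default 0 ys j" for j
    using eq[of "Suc j"] by (simp add: part_nth xs_def ys_def)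
  have len: "j < length xs \<longleftrightarrow> j < length ys" for j
    using e[of j] nz by (auto simp: nth_default_def split: if_splits) (metis nth_mem)+
  have l: "length xs = length ys" using len[of "length xs"] len[of "length ys"] by auto
  have "xs = ys"
  proof (rule nth_equalityI[OF l])
    fix j assume "j < length xs"
    then show "xs ! j = ys ! j" using e[of j] l by (simp add: nth_default_nth)
  qed
  then have "mset xs = mset ys" by simp
  then show ?thesis by (simp add: xs_def ys_def)
qed

text \<open>Consecutive tail sums differ by one entry.\<close>

lemma interval_sums_eq_iff:
  fixes u v :: "nat \<Rightarrow> nat"
  shows "(\<forall>l\<in>{1..d}. (\<Sum>i = l..d. u i) = (\<Sum>i = l..d. v i)) \<longleftrightarrow> (\<forall>i\<in>{1..d}. u i = v i)"
proof
  assume L: "\<forall>l\<in>{1..d}. (\<Sum>i = l..d. u i) = (\<Sum>i = l..d. v i)"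
  show "\<forall>i\<in>{1..d}. u i = v i"
  proof
    fix i assume i: "i \<in> {1..d}"
    have split: "(\<Sum>j = i..d. h j) = h i + (\<Sum>j = Suc i..d. h j)" for h :: "nat \<Rightarrow> nat"
      using i by (intro sum.atLeast_Suc_atMost) auto
    have "(\<Sum>j = Suc i..d. u j) = (\<Sum>j = Suc i..d. v j)"
      using L by (cases "Suc i \<le> d") auto
    then show "u i = v i" using L i split[of u] split[of v] by auto
  qed
next
  assume "\<forall>i\<in>{1..d}. u i = v i"
  then show "\<forall>l\<in>{1..d}. (\<Sum>i = l..d. u i) = (\<Sum>i = l..d. v i)"
    by (intro ballI sum.cong) auto
qed

text \<open>Hence each coefficient on the left of the generating function involves at most one
  partition.\<close>

lemma tail_sums_inj:
  assumes "\<mu> \<in> partitions_le d" "\<mu>' \<in> partitions_le d" "tail_sums d \<mu> = tail_sums d \<mu>'"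
  shows "\<mu> = \<mu>'"
proof (rule partition_eqI)
  have "lookup (tail_sums d \<mu>) l = lookup (tail_sums d \<mu>') l" for l
    using assms(3) by simp
  then have "\<forall>l\<in>{1..d}. (\<Sum>i = l..d. part \<mu> i) = (\<Sum>i = l..d. part \<mu>' i)"
    unfolding lookup_tail_sums by (metis (full_types))
  then have "\<forall>i\<in>{1..d}. part \<mu> i = part \<mu>' i" by (rule interval_sums_eq_iff[THEN iffD1])
  then show "part \<mu> i = part \<mu>' i" if "1 \<le> i" for i
    using that assms(1,2) part_eq_0[of \<mu> i] part_eq_0[of \<mu>' i]
      by (cases "i \<le> d") (auto simp: partitions_le_def)
qed (use assms in \<open>auto simp: partitions_le_def\<close>)

text \<open>By the bound on \<open>n\<close> the new part is at least \<open>\<mu>\<^sub>1\<close>,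
  so it comes first. If it is 0, then \<open>\<mu>\<close> is empty.\<close>

lemma pad_partition_part:
  assumes p: "is_partition \<mu>" and n: "sum_mset \<mu> + part \<mu> 1 \<le> n"
  shows "part (pad_partition \<mu> n) (Suc i) = (if i = 0 then n - sum_mset \<mu> else part \<mu> i)"
proof (cases "n = sum_mset \<mu>")
  case True
  have "\<mu> = {#}"
  proof (rule ccontr)
    assume "\<mu> \<noteq> {#}"
    then obtain x where x: "x \<in># \<mu>" by blast
    then have "x \<le> 0" using mem_le_part1[OF x] n True by simp
    then show False using p x by (simp add: is_partition_def)
  qed
  then show ?thesis using True by (simp add: pad_partition_def part_def nth_default_def)
next
  case False
  let ?x = "n - sum_mset \<mu>"
  have x: "0 < ?x" "part \<mu> 1 \<le> ?x" using n False by auto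
  have "filter_mset (\<lambda>k. 0 < k) \<mu> = \<mu>"
    using p by (auto simp: is_partition_def filter_mset_eq_conv intro!: Nat.gr0I)
  then have "pad_partition \<mu> n = add_mset ?x \<mu>" using x by (simp add: pad_partition_def)
  moreover have "insort ?x (sorted_list_of_multiset \<mu>) = sorted_list_of_multiset \<mu> @ [?x]"
    using mem_le_part1[of _ \<mu>] x(2) by (intro sorted_insort_is_snoc) (auto intro: order_trans)
  ultimately have "rev (sorted_list_of_multiset (pad_partition \<mu> n)) = ?x # rev (sorted_list_of_multiset \<mu>)"
    by simp
  then show ?thesis unfolding part_nth by (cases i) (simp_all add: part_nth)
qed

lemma pad_partition_sum:
  assumes "sum_mset \<mu> \<le> n"
  shows "sum_mset (pad_partition \<mu> n) = n"
proof -
  have "sum_mset (filter_mset (\<lambda>k. 0 < k) M) = sum_mset M" for M :: "nat multiset"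
    by (induction M) auto
  then show ?thesis using assms by (simp add: pad_partition_def del: filter_mset_add_mset)
qed

lemma pad_partition_size: "size (pad_partition \<mu> n) \<le> Suc (size \<mu>)"
  unfolding pad_partition_def using size_filter_mset_lesseq[of "\<lambda>k. 0 < k" "add_mset (n - sum_mset \<mu>) \<mu>"] by simp

text \<open>The exponents of \<open>w\<close> compare the letters from 1 to \<open>d\<close> through
  tail sums. The letter 0 has no variable; its count agrees because both contents sum to
  \<open>n\<close>, a permutation keeping the sum of the indices.\<close>

lemma tail_content_has_content:
  assumes z: "z \<in> {1..n} \<rightarrow>\<^sub>E {..d}" and p: "p permutes {..<Suc d}"
    and \<mu>: "size \<mu> \<le> d" "sum_mset \<mu> \<le> n"
    and \<nu>: "\<And>i. \<nu> i = (if i = 0 then n - sum_mset \<mu> else part \<mu> i)"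
  shows "shift_exp d p + tail_content n d z = shift_exp d id + tail_sums d \<mu> \<longleftrightarrow>
    has_content (Suc d) \<nu> p (cnt n z)"
proof -
  let ?u = "\<lambda>i. cnt n z i + i" and ?v = "\<lambda>i. \<nu> i + p i"
  have p_le: "p i \<le> d" if "i \<le> d" for i
    using permutes_in_image[OF p, of i] that by simp
  have tail: "card {a \<in> {1..n}. l \<le> z a} = (\<Sum>i = l..d. cnt n z i)" for l
  proof -
    have "(\<Sum>i = l..d. cnt n z i) = card (\<Union>i\<in>{l..d}. {a \<in> {1..n}. z a = i})"
      unfolding cnt_def by (rule card_UN_disjoint[symmetric]) auto
    moreover have "(\<Union>i\<in>{l..d}. {a \<in> {1..n}. z a = i}) = {a \<in> {1..n}. l \<le> z a}"
      using z by (auto simp: PiE_iff)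
    ultimately show ?thesis by simp
  qed
  \<comment> \<open>Moves the truncated \<open>d - p i\<close> to the other side as
    \<open>p i\<close>; this is exact because \<open>p\<close> maps \<open>{..d}\<close> to
    itself.\<close>
  have shift: "(\<Sum>i = l..d. d - q i) + (\<Sum>i = l..d. q i) = (\<Sum>i = l..d. d)"
    if "\<And>i. i \<le> d \<Longrightarrow> q i \<le> d" for q :: "nat \<Rightarrow> nat" and l
    unfolding sum.distrib[symmetric] using that by (intro sum.cong) auto
  have \<nu>_sum: "(\<Sum>i = l..d. \<nu> i) = (\<Sum>i = l..d. part \<mu> i)" if "1 \<le> l" for l
    using that by (intro sum.cong) (auto simp: \<nu>)
  have "shift_exp d p + tail_content n d z = shift_exp d id + tail_sums d \<mu> \<longleftrightarrow>
     (\<forall>l\<in>{1..d}. (\<Sum>i = l..d. d - p i) + (\<Sum>i = l..d. cnt n z i) = (\<Sum>i = l..d. d - i) + (\<Sum>i = l..d. part \<mu> i))"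
    unfolding poly_mapping_eq_iff fun_eq_iff lookup_add lookup_shift_exp lookup_tail_content lookup_tail_sums tail
    by auto
  also have "\<dots> \<longleftrightarrow> (\<forall>l\<in>{1..d}. (\<Sum>i = l..d. ?u i) = (\<Sum>i = l..d. ?v i))"
  proof (intro ball_cong refl)
    fix l assume l: "l \<in> {1..d}"
    have "(\<Sum>i = l..d. d - p i) + (\<Sum>i = l..d. p i) = (\<Sum>i = l..d. d - i) + (\<Sum>i = l..d. i)"
      using shift[of p l, OF p_le] shift[of "\<lambda>i. i" l] by simp
    then show "((\<Sum>i = l..d. d - p i) + (\<Sum>i = l..d. cnt n z i) = (\<Sum>i = l..d. d - i) + (\<Sum>i = l..d. part \<mu> i)) =
       ((\<Sum>i = l..d. ?u i) = (\<Sum>i = l..d. ?v i))"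
      unfolding sum.distrib using \<nu>_sum[of l] l by auto
  qed
  also have "\<dots> \<longleftrightarrow> (\<forall>i\<in>{1..d}. ?u i = ?v i)" by (rule interval_sums_eq_iff)
  also have "\<dots> \<longleftrightarrow> has_content (Suc d) \<nu> p (cnt n z)"
  proof
    assume R: "\<forall>i\<in>{1..d}. ?u i = ?v i"
    have split: "(\<Sum>i<Suc d. h i) = h 0 + (\<Sum>i = 1..d. h i)" for h :: "nat \<Rightarrow> nat"
      unfolding sum_shift_Suc by (rule sum.lessThan_Suc_shift)
    have "(\<Sum>i<Suc d. cnt n z i) = n"
      using cnt_contents[of "{..<Suc d}" z n] z by (simp add: contents_def lessThan_Suc_atMost)
    moreover have "(\<Sum>i<Suc d. \<nu> i) = n"
      unfolding split using \<nu>_sum[of 1] sum_part[OF \<mu>(1)] \<mu>(2) by (simp add: \<nu>[of 0])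
    moreover have "(\<Sum>i<Suc d. p i) = (\<Sum>i<Suc d. i)"
      using sum.permute[OF p, of "\<lambda>i. i"] by (simp add: o_def)
    ultimately have "(\<Sum>i<Suc d. ?u i) = (\<Sum>i<Suc d. ?v i)" unfolding sum.distrib by simp
    moreover have "(\<Sum>i = 1..d. ?u i) = (\<Sum>i = 1..d. ?v i)" using R by (intro sum.cong) auto
    ultimately have "?u 0 = ?v 0" unfolding split by linarith
    then show "has_content (Suc d) \<nu> p (cnt n z)"
      using R unfolding has_content_def
        by (metis One_nat_def Suc_leI atLeastAtMost_iff less_Suc_eq_le neq0_conv)
  next
    assume "has_content (Suc d) \<nu> p (cnt n z)"
    then show "\<forall>i\<in>{1..d}. ?u i = ?v i" by (auto simp: has_content_def)
  qed
  finally show ?thesis .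
qed

abbreviation rhs_series :: "nat \<Rightarrow> complex mpoly mseries" where
  "rhs_series d \<equiv> series_mult (series_of_poly (P_poly (map mvar [1..<Suc d])))
     (formal_sum (partition_tuples d) (tuple_coeff d) (tuple_exponent d))"

text \<open>Both sides are alternating sums over permutations of \<open>{..<Suc d}\<close> and agree
  term by term: the fixed words whose exponent completes \<open>shift_exp d w\<close> are those
  counted by \<open>psi\<close>.\<close>

lemma meval_rhs_series:
  assumes d: "d \<ge> 1" and \<mu>: "\<mu> \<in> partitions_le d" and n: "sum_mset \<mu> + part \<mu> 1 \<le> n"
    and s: "\<sigma> permutes {1..n}"
  shows "specht_character (pad_partition \<mu> n) \<sigma> =
    meval (rhs_series d (tail_sums d \<mu>)) (\<lambda>i. of_nat (cycle_count n \<sigma> i))"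
proof -
  have p: "is_partition \<mu>" and size: "size \<mu> \<le> d" using \<mu> by (simp_all add: partitions_le_def)
  define \<nu> where "\<nu> i = part (pad_partition \<mu> n) (Suc i)" for i
  have \<nu>: "\<nu> i = (if i = 0 then n - sum_mset \<mu> else part \<mu> i)" for i
    unfolding \<nu>_def by (rule pad_partition_part[OF p n])
  obtain T where T: "tableau (pad_partition \<mu> n) T" using tableau_exists by blast
  interpret young_tableau "pad_partition \<mu> n" T n
    by unfold_locales (use T n pad_partition_sum[of \<mu> n] in auto)
  have "size (pad_partition \<mu> n) \<le> Suc d" using pad_partition_size[of \<mu> n] size by linarith
  from specht_character_det_char[OF this s]
  have "specht_character (pad_partition \<mu> n) \<sigma> = of_int (det_char n (Suc d) \<nu> \<sigma>)"
    by (simp only: \<nu>_def[abs_def])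
  also have "\<dots> = (\<Sum>w | w permutes {..<Suc d}. of_int (sign w) * of_nat (psi n (Suc d) \<nu> w \<sigma>))"
    by (simp add: det_char_def)
  also have "\<dots> = (\<Sum>w | w permutes {..<Suc d}. of_int (sign w) * (\<Sum>b | shift_exp d w + b = shift_exp d id + tail_sums d \<mu>.
      of_nat (card {z \<in> {1..n} \<rightarrow>\<^sub>E {..d}. z \<circ> \<sigma> = z \<and> tail_content n d z = b})))"
  proof (intro sum.cong refl arg_cong2[of _ _ _ _ "(*)"])
    fix w assume "w \<in> {w. w permutes {..<Suc d}}"
    then have w: "w permutes {..<Suc d}" by simp
    let ?B = "{b. shift_exp d w + b = shift_exp d id + tail_sums d \<mu>}"
    have "?B \<subseteq> snd ` {(a, b). a + b = shift_exp d id + tail_sums d \<mu>}" by force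
    then have finB: "finite ?B" using finite_factorisations finite_subset by blast
    have finW: "finite ({1..n} \<rightarrow>\<^sub>E {..d})" by (simp add: finite_words)
    have "card (\<Union>b\<in>?B. {z \<in> {1..n} \<rightarrow>\<^sub>E {..d}. z \<circ> \<sigma> = z \<and> tail_content n d z = b}) =
       (\<Sum>b\<in>?B. card {z \<in> {1..n} \<rightarrow>\<^sub>E {..d}. z \<circ> \<sigma> = z \<and> tail_content n d z = b})"
      by (rule card_UN_disjoint) (use finB finW in auto)
    moreover have "(\<Union>b\<in>?B. {z \<in> {1..n} \<rightarrow>\<^sub>E {..d}. z \<circ> \<sigma> = z \<and> tail_content n d z = b}) =
       {z \<in> {1..n} \<rightarrow>\<^sub>E {..<Suc d}. z \<circ> \<sigma> = z \<and> has_content (Suc d) \<nu> w (cnt n z)}"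
      using tail_content_has_content[OF _ w size _ \<nu>] n unfolding lessThan_Suc_atMost by auto
    ultimately show "of_nat (psi n (Suc d) \<nu> w \<sigma>) = (\<Sum>b\<in>?B.
        of_nat (card {z \<in> {1..n} \<rightarrow>\<^sub>E {..d}. z \<circ> \<sigma> = z \<and> tail_content n d z = b}))"
      unfolding psi_def by (simp only: of_nat_sum)
  qed
  also have "\<dots> = meval (rhs_series d (tail_sums d \<mu>)) (\<lambda>i. of_nat (cycle_count n \<sigma> i))"
    unfolding series_mult_P_poly meval_sum meval_mult meval_of_int meval_tuple_series[OF s d] ..
  finally show ?thesis .
qed

text \<open>The parts of a partition are positive, so \<open>x_binom\<close> avoids the variable of
  index 0.\<close>

lemma rhs_series_x_polys:
  assumes "d \<ge> 1"
  shows "rhs_series d k \<in> x_polys"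
proof -
  have "tuple_coeff d \<beta>s \<in> x_polys" if "\<beta>s \<in> partition_tuples d" for \<beta>s
  proof -
    have "is_partition (\<beta>s ! 0)" using that assms by (auto simp: partition_tuples_def)
    then show ?thesis unfolding tuple_coeff_def
      by (intro x_polys_mult x_polys_prod x_polys_of_nat x_polys_x_binom)
  qed
  then show ?thesis
    unfolding series_mult_P_poly formal_sum_def
    by (intro x_polys_sum x_polys_mult x_polys_of_int) auto
qed

text \<open>The two halves of the definite description: the coefficient has the required values, and
  \<open>x_poly_eqI\<close> makes it unique although only large \<open>n\<close> are tested.\<close>

lemma specht_poly_eq_rhs_series:
  assumes d: "d \<ge> 1" and \<mu>: "\<mu> \<in> partitions_le d"
  shows "specht_poly \<mu> = rhs_series d (tail_sums d \<mu>)"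
  unfolding specht_poly_def
proof (rule the_equality)
  show "rhs_series d (tail_sums d \<mu>) \<in> x_polys \<and>
    (\<forall>n \<sigma>. sum_mset \<mu> + part \<mu> 1 \<le> n \<longrightarrow> \<sigma> permutes {1..n} \<longrightarrow>
       specht_character (pad_partition \<mu> n) \<sigma> =
       meval (rhs_series d (tail_sums d \<mu>)) (\<lambda>i. of_nat (cycle_count n \<sigma> i)))"
    using rhs_series_x_polys[OF d] meval_rhs_series[OF d \<mu>] by blast
next
  fix q :: "complex mpoly"
  assume q: "q \<in> x_polys \<and> (\<forall>n \<sigma>. sum_mset \<mu> + part \<mu> 1 \<le> n \<longrightarrow> \<sigma> permutes {1..n} \<longrightarrow>
       specht_character (pad_partition \<mu> n) \<sigma> = meval q (\<lambda>i. of_nat (cycle_count n \<sigma> i)))"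
  show "q = rhs_series d (tail_sums d \<mu>)"
  proof (rule x_poly_eqI[of _ _ "sum_mset \<mu> + part \<mu> 1"])
    show "q \<in> x_polys" using q by blast
    show "rhs_series d (tail_sums d \<mu>) \<in> x_polys" by (rule rhs_series_x_polys[OF d])
    show "meval q (\<lambda>i. of_nat (cycle_count n \<sigma> i)) =
        meval (rhs_series d (tail_sums d \<mu>)) (\<lambda>i. of_nat (cycle_count n \<sigma> i))"
      if "sum_mset \<mu> + part \<mu> 1 \<le> n" "\<sigma> permutes {1..n}" for n \<sigma>
      using q meval_rhs_series[OF d \<mu> that] that by metis
  qed
qed

theorem theorem3p7:
  fixes d :: nat
  assumes "d \<ge> 1"
  shows "formal_sum (partitions_le d) specht_poly (tail_sums d) =
    partition_terms d
      (series_mult (series_of_poly (P_poly (map mvar [1..<Suc d])))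
        (formal_sum (partition_tuples d) (tuple_coeff d) (tuple_exponent d)))"
proof
  fix k
  show "formal_sum (partitions_le d) specht_poly (tail_sums d) k = partition_terms d (rhs_series d) k"
  proof (cases "k \<in> tail_sums d ` partitions_le d")
    case True
    then obtain \<mu> where \<mu>: "\<mu> \<in> partitions_le d" "k = tail_sums d \<mu>" by blast
    then have only: "{\<mu>' \<in> partitions_le d. tail_sums d \<mu>' = k} = {\<mu>}" using tail_sums_inj by auto
    have "formal_sum (partitions_le d) specht_poly (tail_sums d) k = specht_poly \<mu>"
      unfolding formal_sum_def only by simp
    also have "\<dots> = rhs_series d k" unfolding \<mu>(2) by (rule specht_poly_eq_rhs_series[OF assms \<mu>(1)])
    also have "\<dots> = partition_terms d (rhs_series d) k" using True
      by (simp only: partition_terms_def if_True)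
    finally show ?thesis .
  next
    case False
    then have none: "{\<mu>' \<in> partitions_le d. tail_sums d \<mu>' = k} = {}" by auto
    show ?thesis using False by (simp only: formal_sum_def none partition_terms_def if_False) simp
  qed
qed

end
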